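(* There exist two numerical constants $C,C'>0$ such that the following holds for every biased linear bandit problem (as described in the context) for which the maximizer $x^*\in\arg\max_{x\in\mathcal X}x^\top\gamma^*$ is unique, and every horizon $T\ge1$. Let $\Delta_x=(x^*-x)^\top\gamma^*$, $\Delta=(\Delta_x)_{x\in\mathcal X}$, $$\Delta_{\min}=\min_{x\in\mathcal X\setminus\{x^*\}}\Delta_x,\qquad \Delta_{\neq}=\min_{x\in\mathcal X:\,z_x=-z_{x^*}}\Delta_x,\qquad \varepsilon_T=\left(\frac{\kappa_*\log(T)}{T}\right)^{1/3}.$$ Then the regret $R_T$ of the Fair Phased Elimination algorithm run with $\delta=T^{-1}$ satisfies $$R_T\le C\left(\left(\frac{d}{\Delta_{\min}}\vee\frac{\kappa(\Delta\vee\Delta_{\neq}\vee\varepsilon_T)}{\Delta_{\neq}^2}\right)\log(T)+d^2+\frac{d}{\Delta_{\min}}\log(k)\right),$$ and moreover $$R_T\le C'\left(\frac{d}{\Delta_{\min}}\vee\frac{\kappa(\Delta\vee\Delta_{\neq}\vee\varepsilon_T)}{\Delta_{\neq}^2}\right)\log(T)\qquad\text{whenever } T\ge k\vee e^{d\Delta_{\min}}.$$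
   Context: **Problem (biased linear bandit).** $\mathcal X\subset\mathbb R^d$ is a finite set of $k=|\mathcal X|$ distinct actions; each $x\in\mathcal X$ has a known sensitive attribute (group) $z_x\in\{-1,1\}$. Write $a_x=\binom{x}{z_x}\in\mathbb R^{d+1}$. Both groups are nonempty and $\{a_x:x\in\mathcal X\}$ spans $\mathbb R^{d+1}$. The unknown parameter is $\theta^*=\binom{\gamma^*}{\omega^*}$ with $\gamma^*\in\mathbb R^d$, $\omega^*\in\mathbb R$, and $\max_{x\in\mathcal X}|x^\top\gamma^*|\le 1$. At each round $t\le T$ the player chooses $x_t\in\mathcal X$ and observes $y_t=x_t^\top\gamma^*+z_{x_t}\omega^*+\xi_t$, with $\xi_t$ i.i.d. $\mathcal N(0,1)$. The regret is $R_T=\mathbb E\big[\sum_{t\le T}(x^*-x_t)^\top\gamma^*\big]$ with $x^*\in\arg\max_{x\in\mathcal X}x^\top\gamma^*$. **Notation.** $u\vee v=\max(u,v)$, $u\wedge v=\min(u,v)$; the maximum of a vector and a scalar is taken coordinatewise, so $(\Delta\vee\Delta_{\neq}\vee\varepsilon_T)_x=\max(\Delta_x,\Delta_{\neq},\varepsilon_T)$. $M^+$ is a generalized inverse of $M$; $e_{d+1}$ is the last canonical basis vector of $\mathbb R^{d+1}$. For $\mu:\mathcal X\to[0,\infty)$ let $V(\mu)=\sum_x\mu(x)a_xa_x^\top$. $\mathcal M_{e_{d+1}}^{\mathcal X}$ (resp. $\mathcal P_{e_{d+1}}^{\mathcal X}$) is the set of functions $\mu:\mathcal X\to[0,\infty)$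 (resp. probability measures on $\mathcal X$) with $e_{d+1}\in\mathrm{Range}(V(\mu))$. The minimal variance of the bias estimator is $\kappa_*=\min_{\pi\in\mathcal P_{e_{d+1}}^{\mathcal X}}e_{d+1}^\top V(\pi)^+e_{d+1}$. For a vector $\Delta\in(0,\infty)^{\mathcal X}$, a $\Delta$-optimal design is a minimizer of $\sum_x\mu(x)\Delta_x$ over $\mu\in\mathcal M_{e_{d+1}}^{\mathcal X}$ with $e_{d+1}^\top V(\mu)^+e_{d+1}\le1$, and $\kappa(\Delta)$ is the minimal value. **Fair Phased Elimination algorithm** (inputs $\delta,T,\mathcal X$). Set $\epsilon_l=2^{2-l}$, $\mathcal X_1^{(z)}=\{x:z_x=z\}$ for $z=\pm1$, $\widehat{z^*_1}=0$ (best group not yet identified), $\widehat\Delta^1_x=2$ for all $x$. For $l=1,2,\dots$, until $T$ rounds have been played, put by default $\widehat{z^*_{l+1}}=\widehat{z^*_l}$, $\widehat\Delta^{l+1}=\widehat\Delta^l$, and: 1. For each $z\in\{-1,1\}$ with $z\ne-\widehat{z^*_l}$: let $\pi_l^{(z)}$ be a probability measure on $\mathcal X_l^{(z)}$, with support of size at most $(d+1)(d+2)/2$, minimizing $\max_{x\in\mathcal X_l^{(z)}}a_x^\top V(\pi)^+a_x$ among probability measures $\pi$ on $\mathcal X_l^{(z)}$ such that $a_x\in\mathrm{Range}(V(\pi))$ for all $x\in\mathcal X_l^{(z)}$. Let $\mu_l^{(z)}(x)=\big\lceil\frac{2(d+1)\pi_l^{(z)}(x)}{\epsilon_l^2}\log\frac{kl(l+1)}{\delta}\big\rceil$.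 If at least $\sum_x\mu_l^{(z)}(x)$ rounds remain, sample each $x\in\mathcal X_l^{(z)}$ exactly $\mu_l^{(z)}(x)$ times, compute from these samples only the least-squares estimator $\widehat\theta_l^{(z)}=V(\mu_l^{(z)})^+\sum_t y_ta_{x_t}$, and set $\mathcal X_{l+1}^{(z)}=\{x\in\mathcal X_l^{(z)}:\max_{x'\in\mathcal X_l^{(z)}}(a_{x'}-a_x)^\top\widehat\theta_l^{(z)}\le3\epsilon_l\}$. Otherwise, spend all remaining rounds on the empirically best action in $\mathcal X_l^{(z)}$. 2. If $\widehat{z^*_l}=0$: compute a $\widehat\Delta^l$-optimal design $\widehat\mu_l$ with support of size at most $d+1$, and $\kappa(\widehat\Delta^l)$. (a) (Recovery) If $\epsilon_l\le(\kappa(\widehat\Delta^l)\log(T)/T)^{1/3}$, sample the empirically best action in $\mathcal X_{l+1}^{(-1)}\cup\mathcal X_{l+1}^{(1)}$ for all remaining rounds. (b) Otherwise let $\mu_l^{(0)}(x)=\big\lceil\frac{2\widehat\mu_l(x)}{\epsilon_l^2}\log\frac{l(l+1)}{\delta}\big\rceil$ for $x\in\mathcal X$. If fewer than $\sum_x\mu_l^{(0)}(x)$ rounds remain, spend all of them on the empirically best action in $\mathcal X_{l+1}^{(-1)}\cup\mathcal X_{l+1}^{(1)}$. Otherwise sample each $x\in\mathcal X$ exactly $\mu_l^{(0)}(x)$ times, and from these samples only compute $\widehat\omega_l^{(0)}=e_{d+1}^\top V(\mu_l^{(0)})^+\sum_ty_ta_{x_t}$. For $x\in\mathcal X_{l+1}^{(-1)}\cup\mathcal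 X_{l+1}^{(1)}$ let $\widehat m_{l,x}=a_x^\top\widehat\theta_l^{(z_x)}-z_x\widehat\omega_l^{(0)}$ and set $\widehat\Delta_x^{l+1}=2\wedge\big(\max_{x'\in\mathcal X_{l+1}^{(-1)}\cup\mathcal X_{l+1}^{(1)}}\widehat m_{l,x'}-\widehat m_{l,x}+4\epsilon_l\big)$. If for some $z\in\{-1,1\}$, $\max_{x\in\mathcal X_{l+1}^{(z)}}\widehat m_{l,x}-2\epsilon_l\ge\max_{x\in\mathcal X_{l+1}^{(-z)}}\widehat m_{l,x}+2\epsilon_l$, set $\widehat{z^*_{l+1}}=z$. Here "the empirically best action" of a set means an element of that set chosen as a function of past observations; the ranking rule is not specified further. *)

theory Defs
  imports "HOL-Probability.Probability" "Jordan_Normal_Form.VS_Connect"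
begin

hide_type (open) Finite_Cartesian_Product.vec
hide_const (open) Finite_Cartesian_Product.vec
no_notation inner (infix \<open>\<bullet>\<close> 70)
no_notation vec_nth (infixl \<open>$\<close> 90)

text \<open>The dimension is quantified inside the scope of the numerical constants, so vectors are
  dimension-carrying vectors (type \<open>Matrix.vec\<close>) rather than vectors indexed by a type.
  An action is its own feature vector.\<close>

type_synonym rvec = "real Matrix.vec"

section \<open>Biased linear bandits\<close>

text \<open>What the learner knows about the problem: the dimension \<open>d\<close>, the actions and their groups.\<close>

record arm_set =
  dimn :: nat
  acts :: "rvec set"
  grp :: "rvec \<Rightarrow> int"

definition feat :: "arm_set \<Rightarrow> rvec \<Rightarrow> rvec" where
  "feat B x = x @\<^sub>v vec 1 (\<lambda>_. of_int (grp B x))"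

definition e_last :: "arm_set \<Rightarrow> rvec" where
  "e_last B = unit_vec (dimn B + 1) (dimn B)"

definition biased_bandit :: "arm_set \<Rightarrow> rvec \<Rightarrow> bool" where
  "biased_bandit B \<gamma> \<longleftrightarrow>
     finite (acts B) \<and> acts B \<subseteq> carrier_vec (dimn B) \<and>
     (\<forall>x\<in>acts B. grp B x \<in> {-1, 1}) \<and>
     (\<forall>z\<in>{-1, 1}. {x \<in> acts B. grp B x = z} \<noteq> {}) \<and>
     LinearCombinations.module.span class_ring (module_vec TYPE(real) (dimn B + 1))
       (feat B ` acts B) = carrier_vec (dimn B + 1) \<and>
     \<gamma> \<in> carrier_vec (dimn B) \<and>
     (MAX x\<in>acts B. \<bar>x \<bullet> \<gamma>\<bar>) \<le> 1"

text \<open>The i.i.d. standard Gaussian noise sequence, realised on its canonical space.\<close>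

definition noise :: "(nat \<Rightarrow> real) measure" where
  "noise = (\<Pi>\<^sub>M t\<in>UNIV. density lborel std_normal_density)"

text \<open>The observation made if \<open>x\<close> is the action of the round number \<open>t\<close> (starting with \<open>0\<close>).\<close>

definition observe :: "arm_set \<Rightarrow> rvec \<Rightarrow> real \<Rightarrow> (nat \<Rightarrow> real) \<Rightarrow> nat \<Rightarrow> rvec \<Rightarrow> real" where
  "observe B \<gamma> \<omega> \<xi> t x = x \<bullet> \<gamma> + of_int (grp B x) * \<omega> + \<xi> t"

section \<open>Designs\<close>

text \<open>Some generalized inverse. Only values \<open>u \<bullet> (ginv M *\<^sub>v w)\<close> with \<open>M\<close> symmetric and
  \<open>u, w\<close> in its range matter below; these do not depend on the choice.\<close>

definition ginv :: "real mat \<Rightarrow> real mat" where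
  "ginv M = (SOME G. G \<in> carrier_mat (dim_col M) (dim_row M) \<and> M * G * M = M)"

definition mat_range :: "real mat \<Rightarrow> rvec set" where
  "mat_range M = (\<lambda>v. M *\<^sub>v v) ` carrier_vec (dim_col M)"

text \<open>Here and below, measures on a set \<open>S\<close> of actions are functions of which only the values
  on \<open>S\<close> matter.\<close>

definition V :: "arm_set \<Rightarrow> rvec set \<Rightarrow> (rvec \<Rightarrow> real) \<Rightarrow> real mat" where
  "V B S \<mu> = mat (dimn B + 1) (dimn B + 1)
     (\<lambda>(i, j). \<Sum>x\<in>S. \<mu> x * (feat B x $ i * feat B x $ j))"

definition var_form :: "arm_set \<Rightarrow> rvec set \<Rightarrow> (rvec \<Rightarrow> real) \<Rightarrow> rvec \<Rightarrow> real" where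
  "var_form B S \<mu> u = u \<bullet> (ginv (V B S \<mu>) *\<^sub>v u)"

definition prob_on :: "rvec set \<Rightarrow> (rvec \<Rightarrow> real) \<Rightarrow> bool" where
  "prob_on S \<pi> \<longleftrightarrow> (\<forall>x\<in>S. 0 \<le> \<pi> x) \<and> (\<Sum>x\<in>S. \<pi> x) = 1"

definition bias_measures :: "arm_set \<Rightarrow> (rvec \<Rightarrow> real) set" where
  "bias_measures B = {\<mu>. (\<forall>x\<in>acts B. 0 \<le> \<mu> x) \<and> e_last B \<in> mat_range (V B (acts B) \<mu>)}"

definition kappa_star :: "arm_set \<Rightarrow> real" where
  "kappa_star B = (INF \<pi>\<in>{\<pi> \<in> bias_measures B. prob_on (acts B) \<pi>}.
     var_form B (acts B) \<pi> (e_last B))"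

definition unit_variance_measures :: "arm_set \<Rightarrow> (rvec \<Rightarrow> real) set" where
  "unit_variance_measures B =
     {\<mu> \<in> bias_measures B. var_form B (acts B) \<mu> (e_last B) \<le> 1}"

definition kappa :: "arm_set \<Rightarrow> (rvec \<Rightarrow> real) \<Rightarrow> real" where
  "kappa B D = (INF \<mu>\<in>unit_variance_measures B. \<Sum>x\<in>acts B. \<mu> x * D x)"

definition gap_optimal :: "arm_set \<Rightarrow> (rvec \<Rightarrow> real) \<Rightarrow> (rvec \<Rightarrow> real) \<Rightarrow> bool" where
  "gap_optimal B D \<mu> \<longleftrightarrow> \<mu> \<in> unit_variance_measures B \<and>
     (\<forall>\<nu>\<in>unit_variance_measures B. (\<Sum>x\<in>acts B. \<mu> x * D x) \<le> (\<Sum>x\<in>acts B. \<nu> x * D x))"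

definition G_feasible :: "arm_set \<Rightarrow> rvec set \<Rightarrow> (rvec \<Rightarrow> real) set" where
  "G_feasible B S = {\<pi>. prob_on S \<pi> \<and> (\<forall>x\<in>S. feat B x \<in> mat_range (V B S \<pi>))}"

definition G_optimal :: "arm_set \<Rightarrow> rvec set \<Rightarrow> (rvec \<Rightarrow> real) \<Rightarrow> bool" where
  "G_optimal B S \<pi> \<longleftrightarrow> \<pi> \<in> G_feasible B S \<and>
     (\<forall>\<pi>'\<in>G_feasible B S.
        (MAX x\<in>S. var_form B S \<pi> (feat B x)) \<le> (MAX x\<in>S. var_form B S \<pi>' (feat B x)))"

section \<open>Fair Phased Elimination\<close>

text \<open>The rounds played so far: actions with the observations they gave.\<close>

type_synonym history = "(rvec \<times> real) list"

text \<open>Everything that the description of the algorithm leaves open. In phase \<open>l\<close>,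
  \<open>group_order l\<close> is the order in which the groups are treated, \<open>g_design l S\<close> is the design
  computed for a set \<open>S\<close> of remaining actions, \<open>gap_design l D\<close> is the \<open>D\<close>-optimal design, and
  \<open>schedule l \<mu>\<close> is the order in which every action \<open>x\<close> is sampled \<open>\<mu> x\<close> times.
  \<open>emp_best h S\<close> is the ``empirically best'' action in \<open>S\<close> after the observations \<open>h\<close>.\<close>

record choices =
  group_order :: "nat \<Rightarrow> int list"
  g_design :: "nat \<Rightarrow> rvec set \<Rightarrow> rvec \<Rightarrow> real"
  gap_design :: "nat \<Rightarrow> (rvec \<Rightarrow> real) \<Rightarrow> rvec \<Rightarrow> real"
  schedule :: "nat \<Rightarrow> (rvec \<Rightarrow> nat) \<Rightarrow> rvec list"
  emp_best :: "history \<Rightarrow> rvec set \<Rightarrow> rvec"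

text \<open>The two measurability conditions make the actions played random variables.\<close>

definition valid_choices :: "arm_set \<Rightarrow> choices \<Rightarrow> bool" where
  "valid_choices B c \<longleftrightarrow>
     (\<forall>l. group_order c l \<in> {[-1, 1], [1, -1]}) \<and>
     (\<forall>l S. S \<noteq> {} \<longrightarrow> S \<subseteq> acts B \<longrightarrow>
        G_optimal B S (g_design c l S) \<and>
        real (card {x \<in> S. g_design c l S x \<noteq> 0}) \<le> (real (dimn B) + 1) * (real (dimn B) + 2) / 2) \<and>
     (\<forall>l D. (\<forall>x\<in>acts B. 0 < D x) \<longrightarrow>
        gap_optimal B D (gap_design c l D) \<and>
        card {x \<in> acts B. gap_design c l D x \<noteq> 0} \<le> dimn B + 1) \<and>
     (\<forall>l. \<forall>x\<in>acts B.
        (\<lambda>D. gap_design c l D x) \<in> borel_measurable (\<Pi>\<^sub>M x\<in>acts B. (borel :: real measure))) \<and>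
     (\<forall>l \<mu>. {x. \<mu> x \<noteq> 0} \<subseteq> acts B \<longrightarrow> (\<forall>x. count_list (schedule c l \<mu>) x = \<mu> x)) \<and>
     (\<forall>h S. S \<noteq> {} \<longrightarrow> S \<subseteq> acts B \<longrightarrow> emp_best c h S \<in> S) \<and>
     (\<forall>S xs. S \<noteq> {} \<longrightarrow> S \<subseteq> acts B \<longrightarrow> set xs \<subseteq> acts B \<longrightarrow>
        (\<lambda>y. emp_best c (map (\<lambda>i. (xs ! i, y i)) [0..<length xs]) S)
          \<in> measurable (\<Pi>\<^sub>M i\<in>{..<length xs}. (borel :: real measure)) (count_space UNIV))"

text \<open>In the state reached before phase \<open>l\<close>, \<open>cand z\<close> is the set of remaining actions of group
  \<open>z\<close>, \<open>est z\<close> is the last estimator computed for group \<open>z\<close>, \<open>best_grp\<close> is the estimated best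
  group (\<open>0\<close> if not identified yet), and \<open>est_gap\<close> is the vector of estimated gaps.\<close>

record fpe_state =
  hist :: history
  cand :: "int \<Rightarrow> rvec set"
  est :: "int \<Rightarrow> rvec"
  best_grp :: int
  est_gap :: "rvec \<Rightarrow> real"

definition fpe_init :: "arm_set \<Rightarrow> fpe_state" where
  "fpe_init B = \<lparr>hist = [], cand = (\<lambda>z. {x \<in> acts B. grp B x = z}),
     est = (\<lambda>_. 0\<^sub>v (dimn B + 1)), best_grp = 0, est_gap = (\<lambda>x\<in>acts B. 2)\<rparr>"

definition eps :: "nat \<Rightarrow> real" where
  "eps l = 2 powi (2 - int l)"

text \<open>The rounds resulting from playing the actions \<open>xs\<close> in this order after the history \<open>h\<close>.
  The algorithm accesses the observation table \<open>obs\<close> only through this function.\<close>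

definition play :: "(nat \<Rightarrow> rvec \<Rightarrow> real) \<Rightarrow> history \<Rightarrow> rvec list \<Rightarrow> history" where
  "play obs h xs = map (\<lambda>i. (xs ! i, obs (length h + i) (xs ! i))) [0..<length xs]"

definition exhaust ::
  "choices \<Rightarrow> nat \<Rightarrow> (nat \<Rightarrow> rvec \<Rightarrow> real) \<Rightarrow> rvec set \<Rightarrow> fpe_state \<Rightarrow> fpe_state" where
  "exhaust c T obs S s = s\<lparr>hist := hist s @
     play obs (hist s) (replicate (T - length (hist s)) (emp_best c (hist s) S))\<rparr>"

definition least_squares :: "arm_set \<Rightarrow> rvec set \<Rightarrow> (rvec \<Rightarrow> nat) \<Rightarrow> history \<Rightarrow> rvec" where
  "least_squares B S \<mu> h = ginv (V B S (\<lambda>x. real (\<mu> x))) *\<^sub>v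
     vec (dimn B + 1) (\<lambda>i. \<Sum>(x, y)\<leftarrow>h. y * feat B x $ i)"

definition group_step ::
  "arm_set \<Rightarrow> choices \<Rightarrow> real \<Rightarrow> nat \<Rightarrow> (nat \<Rightarrow> rvec \<Rightarrow> real) \<Rightarrow> nat \<Rightarrow> int \<Rightarrow> fpe_state \<Rightarrow> fpe_state" where
  "group_step B c \<delta> T obs l z s =
    (if z = - best_grp s then s
     else
       let S = cand s z;
           \<mu> = (\<lambda>x. if x \<in> S
                 then nat \<lceil>2 * (real (dimn B) + 1) * g_design c l S x / (eps l)\<^sup>2
                            * ln (real (card (acts B)) * real l * (real l + 1) / \<delta>)\<rceil>
                 else 0)
       in if length (hist s) + (\<Sum>x\<in>S. \<mu> x) \<le> T then
            let blk = play obs (hist s) (schedule c l \<mu>);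
                \<theta> = least_squares B S \<mu> blk
            in s\<lparr>hist := hist s @ blk,
                 cand := (cand s)(z :=
                   {x \<in> S. (MAX x'\<in>S. (feat B x' - feat B x) \<bullet> \<theta>) \<le> 3 * eps l}),
                 est := (est s)(z := \<theta>)\<rparr>
          else exhaust c T obs S s)"

text \<open>When this step is reached, \<open>cand s\<close> already holds the sets for phase \<open>l + 1\<close>, while
  \<open>best_grp s\<close> and \<open>est_gap s\<close> still are those of phase \<open>l\<close>.\<close>

definition bias_step ::
  "arm_set \<Rightarrow> choices \<Rightarrow> real \<Rightarrow> nat \<Rightarrow> (nat \<Rightarrow> rvec \<Rightarrow> real) \<Rightarrow> nat \<Rightarrow> fpe_state \<Rightarrow> fpe_state" where
  "bias_step B c \<delta> T obs l s =
    (if best_grp s \<noteq> 0 then s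
     else
       let X = acts B;
           D = est_gap s;
           A = cand s (-1) \<union> cand s 1;
           \<mu> = (\<lambda>x. if x \<in> X
                 then nat \<lceil>2 * gap_design c l D x / (eps l)\<^sup>2 * ln (real l * (real l + 1) / \<delta>)\<rceil>
                 else 0)
       in if eps l \<le> root 3 (kappa B D * ln (real T) / real T) then exhaust c T obs A s
          else if T < length (hist s) + (\<Sum>x\<in>X. \<mu> x) then exhaust c T obs A s
          else
            let blk = play obs (hist s) (schedule c l \<mu>);
                w = e_last B \<bullet> least_squares B X \<mu> blk;
                m = (\<lambda>x. feat B x \<bullet> est s (grp B x) - of_int (grp B x) * w);
                wins = (\<lambda>z. (MAX x\<in>cand s z. m x) - 2 * eps l
                              \<ge> (MAX x\<in>cand s (- z). m x) + 2 * eps l)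
            in s\<lparr>hist := hist s @ blk,
                 best_grp := (if wins 1 then 1 else if wins (-1) then -1 else 0),
                 est_gap := (\<lambda>x. if x \<in> A then min 2 ((MAX x'\<in>A. m x') - m x + 4 * eps l)
                                  else D x)\<rparr>)"

definition fpe_phase ::
  "arm_set \<Rightarrow> choices \<Rightarrow> real \<Rightarrow> nat \<Rightarrow> (nat \<Rightarrow> rvec \<Rightarrow> real) \<Rightarrow> nat \<Rightarrow> fpe_state \<Rightarrow> fpe_state" where
  "fpe_phase B c \<delta> T obs l s =
     bias_step B c \<delta> T obs l (fold (group_step B c \<delta> T obs l) (group_order c l) s)"

text \<open>The state after the phases \<open>1, \<dots>, n\<close>, stopping once \<open>T\<close> rounds have been played.\<close>

primrec fpe_run ::
  "arm_set \<Rightarrow> choices \<Rightarrow> real \<Rightarrow> nat \<Rightarrow> (nat \<Rightarrow> rvec \<Rightarrow> real) \<Rightarrow> nat \<Rightarrow> fpe_state" where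
  "fpe_run B c \<delta> T obs 0 = fpe_init B"
| "fpe_run B c \<delta> T obs (Suc n) =
     (let s = fpe_run B c \<delta> T obs n
      in if length (hist s) < T then fpe_phase B c \<delta> T obs (Suc n) s else s)"

text \<open>Every phase plays at least one round as long as fewer than \<open>T\<close> rounds have been played, so
  that \<open>T\<close> phases are enough to play \<open>T\<close> rounds.\<close>

definition fpe_history ::
  "arm_set \<Rightarrow> choices \<Rightarrow> real \<Rightarrow> nat \<Rightarrow> (nat \<Rightarrow> rvec \<Rightarrow> real) \<Rightarrow> history" where
  "fpe_history B c \<delta> T obs = hist (fpe_run B c \<delta> T obs T)"

section \<open>Regret\<close>

definition is_unique_best :: "arm_set \<Rightarrow> rvec \<Rightarrow> rvec \<Rightarrow> bool" where
  "is_unique_best B \<gamma> xs \<longleftrightarrow> {x \<in> acts B. \<forall>x'\<in>acts B. x' \<bullet> \<gamma> \<le> x \<bullet> \<gamma>} = {xs}"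

definition gap :: "rvec \<Rightarrow> rvec \<Rightarrow> rvec \<Rightarrow> real" where
  "gap \<gamma> xs x = (xs - x) \<bullet> \<gamma>"

definition gap_min :: "arm_set \<Rightarrow> rvec \<Rightarrow> rvec \<Rightarrow> real" where
  "gap_min B \<gamma> xs = (MIN x\<in>acts B - {xs}. gap \<gamma> xs x)"

definition gap_neq :: "arm_set \<Rightarrow> rvec \<Rightarrow> rvec \<Rightarrow> real" where
  "gap_neq B \<gamma> xs = (MIN x\<in>{x \<in> acts B. grp B x = - grp B xs}. gap \<gamma> xs x)"

definition eps_T :: "arm_set \<Rightarrow> nat \<Rightarrow> real" where
  "eps_T B T = root 3 (kappa_star B * ln (real T) / real T)"

definition fpe_regret ::
  "arm_set \<Rightarrow> rvec \<Rightarrow> real \<Rightarrow> rvec \<Rightarrow> choices \<Rightarrow> real \<Rightarrow> nat \<Rightarrow> real" where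
  "fpe_regret B \<gamma> \<omega> xs c \<delta> T =
     (LINT \<xi>|noise. (\<Sum>(x, y)\<leftarrow>fpe_history B c \<delta> T (observe B \<gamma> \<omega> \<xi>). gap \<gamma> xs x))"

end

theory Submission
  imports Defs "Jordan_Normal_Form.Determinant" "Jordan_Normal_Form.Gauss_Jordan_Elimination"
begin

text \<open>Fair Phased Elimination has small regret for two reasons, one probabilistic and one
  deterministic.

  \<^bold>\<open>All estimates are accurate, with probability at least \<open>1 - 6/T\<close>.\<close> Let \<open>n = d + 1\<close>. An
  estimator is computed from one block of samples, and its error at a vector \<open>u\<close> is a linear form
  in the Gaussian noise of the block, with variance \<open>u \<bullet> V(\<mu>)\<^sup>+ u\<close> (\<open>least_squares_error\<close>). By the
  Kiefer--Wolfowitz theorem (\<open>kiefer_wolfowitz\<close>) the design of a group step makes this variance at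
  most \<open>n\<close> at every feature vector before rescaling, and the gap-optimal design of a bias step makes
  it at most \<open>1\<close> at \<open>e\<^sub>d\<^sub>+\<^sub>1\<close>; the sample sizes are such that the Gaussian tail then gives accuracy
  \<open>\<epsilon>\<^sub>l\<close>, up to a probability summable over actions and phases. The beginning and
  the schedule of a block depend on the past. However, they are measurable functions of the noise of
  the earlier rounds, and given their values the noise of the block is fresh
  (\<open>stopped_block_bound\<close>). This needs the states of the algorithm to be measurable and to depend
  only on the noise of the rounds already played. On the exceptional event the regret is at
  most \<open>2T\<close>, which costs a constant.

  \<^bold>\<open>Accurate estimates give a small regret.\<close> The bias cancels within a group, so the
  actions of a group that are still in play in phase \<open>l\<close> are within \<open>10 \<epsilon>\<^sub>l\<close> of the best action of
  the group (\<open>elimination\<close>). Subtracting the estimated bias makes the two groups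
  comparable: the better group is identified as soon as \<open>8 \<epsilon>\<^sub>l \<le> \<Delta>\<^sub>\<noteq>\<close>, so that while both groups are
  sampled all remaining gaps are of order \<open>\<epsilon>\<^sub>l\<close> (\<open>phase_inv\<close>). Exploring the groups therefore costs
  about \<open>\<epsilon>\<^sub>l \<cdot> (n log(kT) / \<epsilon>\<^sub>l\<^sup>2 + n\<^sup>2)\<close> in phase \<open>l\<close>, and nothing once \<open>\<epsilon>\<^sub>l\<close> is well below \<open>\<Delta>\<^sub>m\<^sub>i\<^sub>n\<close>; the sum
  is geometric and its last term is of order \<open>n log(kT) / \<Delta>\<^sub>m\<^sub>i\<^sub>n\<close> (\<open>gcost_sum\<close>).

  The estimated gaps dominate the true gaps and are at most of order \<open>\<Delta>\<^sub>x \<or> \<epsilon>\<^sub>l\<close>, so exploring the bias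
  in phase \<open>l\<close> costs about \<open>\<kappa>(\<Delta> \<or> \<epsilon>\<^sub>l) log(T) / \<epsilon>\<^sub>l\<^sup>2\<close>. The two ways of giving up the exploration cost
  no more: the recovery rule \<open>\<epsilon>\<^sub>l\<^sup>3 \<le> \<kappa> log(T) / T\<close> bounds the cost \<open>T \<epsilon>\<^sub>l\<close> of playing on by that
  very quantity, and if too few rounds remain, there are fewer of them than samples in the design
  (\<open>bias_step_analysis\<close>). As \<open>\<kappa>\<close> is monotone and homogeneous, \<open>\<kappa>(\<Delta> \<or> \<epsilon>\<^sub>l)\<close> is at most
  \<open>1 + \<epsilon>\<^sub>l / \<Delta>\<^sub>\<noteq>\<close> times the \<open>\<kappa>\<close> of the theorem, and since only phases with \<open>16 \<epsilon>\<^sub>l > \<Delta>\<^sub>\<noteq>\<close> explore the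
  bias, the sum is of order \<open>\<kappa> log(T) / \<Delta>\<^sub>\<noteq>\<^sup>2\<close> (\<open>bcost_sum\<close>).\<close>

section \<open>Generalized inverses and Gram matrices\<close>

text \<open>Row reduction writes \<open>A = Q * C\<close> with \<open>Q\<close> invertible and \<open>C\<close> in reduced row echelon form. The map
  \<open>H\<close> that sends the \<open>i\<close>-th unit vector to the unit vector of the \<open>i\<close>-th pivot column inverts \<open>C\<close> on
  its range, so \<open>H * Q\<inverse>\<close> is a generalized inverse of \<open>A\<close>.\<close>

lemma generalized_inverse_exists:
  fixes A :: "'a :: field mat"
  assumes A: "A \<in> carrier_mat nr nc"
  shows "\<exists>G. G \<in> carrier_mat nc nr \<and> A * G * A = A"
proof -
  define C where "C = gauss_jordan_single A"
  note gj = gauss_jordan_single[OF A C_def[symmetric]]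
  from gj(4) obtain P Q where CP: "C = P * A" and P: "P \<in> carrier_mat nr nr"
    and Q: "Q \<in> carrier_mat nr nr" and PQ: "P * Q = 1\<^sub>m nr" "Q * P = 1\<^sub>m nr" by blast
  have C: "C \<in> carrier_mat nr nc" by (rule gj(2))
  from gj(3) obtain f where f: "pivot_fun C f nc" using C unfolding row_echelon_form_def by auto
  note pf = pivot_funD[OF carrier_matD(1)[OF C] f]
  define H where "H = mat nc nr (\<lambda>(j, i). if f i = j then 1 else (0::'a))"
  have H: "H \<in> carrier_mat nc nr" unfolding H_def by simp
  have CH: "(C * H) $$ (i, i') = (if i = i' \<and> f i < nc then 1 else 0)"
    if i: "i < nr" and i': "i' < nr" for i i'
  proof -
    have "(C * H) $$ (i, i') = (\<Sum>j\<in>{0..<nc}. C $$ (i, j) * H $$ (j, i'))"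
      using C H i i' by (simp add: scalar_prod_def)
    also have "\<dots> = (\<Sum>j\<in>{0..<nc}. if j = f i' then C $$ (i, j) else 0)"
      using i' by (intro sum.cong) (auto simp: H_def)
    also have "\<dots> = (if f i' < nc then C $$ (i, f i') else 0)" by (simp add: sum.delta)
    also have "\<dots> = (if i = i' \<and> f i < nc then 1 else 0)"
      using pf(4)[OF i'] pf(5)[OF i' _ i] by auto
    finally show ?thesis .
  qed
  define E where "E = C * H"
  have E: "E \<in> carrier_mat nr nr" unfolding E_def using C H by simp
  have EE: "E $$ (i, i') = (if i = i' \<and> f i < nc then 1 else 0)"
    if i: "i < nr" and i': "i' < nr" for i i'
    unfolding E_def by (rule CH[OF i i'])
  have "E * C = C"
  proof (rule eq_matI)
    fix i j assume ij: "i < dim_row C" "j < dim_col C"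
    have i: "i < nr" and j: "j < nc" using ij C by auto
    have "(E * C) $$ (i, j) = (\<Sum>k\<in>{0..<nr}. E $$ (i, k) * C $$ (k, j))"
      using C E i j by (simp add: scalar_prod_def)
    also have "\<dots> = (\<Sum>k\<in>{0..<nr}. if k = i then (if f i < nc then C $$ (i, j) else 0) else 0)"
      using i by (intro sum.cong) (auto simp: EE)
    also have "\<dots> = (if f i < nc then C $$ (i, j) else 0)" using i by (simp add: sum.delta)
    also have "\<dots> = C $$ (i, j)" using pf(1)[OF i] pf(2)[OF i, of j] j by auto
    finally show "(E * C) $$ (i, j) = C $$ (i, j)" .
  qed (use C E in auto)
  then have CHC: "C * H * C = C" unfolding E_def .
  have QC: "Q * C = A"
  proof -
    have "Q * C = (Q * P) * A" unfolding CP using P Q A by (simp add: assoc_mult_mat[of _ nr nr _ nr _ nc])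
    then show ?thesis using PQ A by simp
  qed
  define G where "G = H * P"
  have G: "G \<in> carrier_mat nc nr" unfolding G_def using H P by simp
  have "A * G * A = A * (G * A)" using A G by (simp add: assoc_mult_mat[of _ nr nc _ nr _ nc])
  also have "G * A = H * C" unfolding G_def CP using H P A
    by (simp add: assoc_mult_mat[of _ nc nr _ nr _ nc])
  also have "A * (H * C) = Q * C * (H * C)" by (simp add: QC)
  also have "\<dots> = Q * (C * (H * C))" using Q C H
    by (intro assoc_mult_mat[of _ nr nr _ nc _ nc]) auto
  also have "C * (H * C) = C * H * C" using C H
    by (intro assoc_mult_mat[symmetric, of _ nr nc _ nr _ nc]) auto
  also have "Q * \<dots> = A" using CHC QC by simp
  finally show ?thesis using G by blast
qed

lemma ginv:
  assumes "M \<in> carrier_mat n m"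
  shows "ginv M \<in> carrier_mat m n" "M * ginv M * M = M"
proof -
  have "\<exists>G. G \<in> carrier_mat (dim_col M) (dim_row M) \<and> M * G * M = M"
    using generalized_inverse_exists[of M n m] assms by auto
  from someI_ex[OF this] show "ginv M \<in> carrier_mat m n" "M * ginv M * M = M"
    using assms unfolding ginv_def by auto
qed

text \<open>This is \<open>V\<close> for an arbitrary indexed family of vectors. The Kiefer--Wolfowitz theorem is proved
  with auxiliary vectors that are not features of actions.\<close>

definition gram :: "nat \<Rightarrow> 'i set \<Rightarrow> ('i \<Rightarrow> real) \<Rightarrow> ('i \<Rightarrow> rvec) \<Rightarrow> real mat" where
  "gram n I p f = mat n n (\<lambda>(i, j). \<Sum>x\<in>I. p x * (f x $ i * f x $ j))"

text \<open>The quadratic form of the Gram matrix, in which designs are compared.\<close>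

definition gram_form :: "'i set \<Rightarrow> ('i \<Rightarrow> real) \<Rightarrow> ('i \<Rightarrow> rvec) \<Rightarrow> rvec \<Rightarrow> real" where
  "gram_form I p f a = (\<Sum>x\<in>I. p x * (a \<bullet> f x)\<^sup>2)"

lemma gram_carrier [simp]: "gram n I p f \<in> carrier_mat n n"
  "dim_row (gram n I p f) = n" "dim_col (gram n I p f) = n"
  unfolding gram_def by auto

lemma gram_mult_vec:
  assumes "a \<in> carrier_vec n" "\<And>x. x \<in> I \<Longrightarrow> f x \<in> carrier_vec n"
  shows "gram n I p f *\<^sub>v a = vec n (\<lambda>i. \<Sum>x\<in>I. p x * (a \<bullet> f x) * f x $ i)"
proof (rule eq_vecI)
  fix i assume "i < dim_vec (vec n (\<lambda>i. \<Sum>x\<in>I. p x * (a \<bullet> f x) * f x $ i))"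
  then have i: "i < n" by simp
  have "(gram n I p f *\<^sub>v a) $ i = (\<Sum>j\<in>{0..<n}. (\<Sum>x\<in>I. p x * (f x $ i * f x $ j)) * a $ j)"
    using assms(1) i by (simp add: gram_def scalar_prod_def)
  also have "\<dots> = (\<Sum>x\<in>I. \<Sum>j\<in>{0..<n}. p x * (f x $ i * f x $ j) * a $ j)"
    unfolding sum_distrib_right by (rule sum.swap)
  also have "\<dots> = (\<Sum>x\<in>I. p x * (a \<bullet> f x) * f x $ i)"
    using assms(2) by (intro sum.cong) (auto simp: scalar_prod_def sum_distrib_left sum_distrib_right mult_ac dest!: carrier_vecD)
  finally show "(gram n I p f *\<^sub>v a) $ i = vec n (\<lambda>i. \<Sum>x\<in>I. p x * (a \<bullet> f x) * f x $ i) $ i"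
    using i by simp
qed (simp add: gram_def)

lemma gram_bilinear:
  assumes "a \<in> carrier_vec n" "b \<in> carrier_vec n" "\<And>x. x \<in> I \<Longrightarrow> f x \<in> carrier_vec n"
  shows "b \<bullet> (gram n I p f *\<^sub>v a) = (\<Sum>x\<in>I. p x * (a \<bullet> f x) * (b \<bullet> f x))"
proof -
  have "b \<bullet> (gram n I p f *\<^sub>v a) = (\<Sum>i\<in>{0..<n}. b $ i * (\<Sum>x\<in>I. p x * (a \<bullet> f x) * f x $ i))"
  proof -
    have "b \<bullet> vec n g = (\<Sum>i\<in>{0..<n}. b $ i * g i)" for g
      by (simp add: scalar_prod_def)
    then show ?thesis using gram_mult_vec[of a n I f p] assms by simp
  qed
  also have "\<dots> = (\<Sum>x\<in>I. \<Sum>i\<in>{0..<n}. b $ i * (p x * (a \<bullet> f x) * f x $ i))"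
    unfolding sum_distrib_left by (rule sum.swap)
  also have "\<dots> = (\<Sum>x\<in>I. p x * (a \<bullet> f x) * (\<Sum>i\<in>{0..<n}. b $ i * f x $ i))"
    unfolding sum_distrib_left by (intro sum.cong) (auto simp: mult_ac)
  also have "\<dots> = (\<Sum>x\<in>I. p x * (a \<bullet> f x) * (b \<bullet> f x))"
    using assms(3) by (intro sum.cong) (auto simp: scalar_prod_def dest!: carrier_vecD)
  finally show ?thesis .
qed

lemma gram_quadratic:
  assumes "a \<in> carrier_vec n" "\<And>x. x \<in> I \<Longrightarrow> f x \<in> carrier_vec n"
  shows "a \<bullet> (gram n I p f *\<^sub>v a) = gram_form I p f a"
  using gram_bilinear[of a n a I f p] assms
  by (auto simp: gram_form_def power2_eq_square mult_ac intro!: sum.cong)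

lemma gram_sym:
  assumes "a \<in> carrier_vec n" "b \<in> carrier_vec n" "\<And>x. x \<in> I \<Longrightarrow> f x \<in> carrier_vec n"
  shows "b \<bullet> (gram n I p f *\<^sub>v a) = a \<bullet> (gram n I p f *\<^sub>v b)"
  using assms by (simp add: gram_bilinear mult_ac)

lemma vec_eq_from_scalar_prods:
  fixes u v :: rvec
  assumes "u \<in> carrier_vec n" "v \<in> carrier_vec n"
    and "\<And>w. w \<in> carrier_vec n \<Longrightarrow> w \<bullet> u = w \<bullet> v"
  shows "u = v"
proof (rule eq_vecI)
  fix i assume "i < dim_vec v"
  then have i: "i < n" using assms by auto
  have "unit_vec n i \<bullet> u = unit_vec n i \<bullet> v" by (rule assms(3)) simp
  then show "u $ i = v $ i" using i assms(1,2) by simp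
qed (use assms in auto)

lemma gram_ginv:
  fixes f :: "'i \<Rightarrow> rvec" and I :: "'i set" and p :: "'i \<Rightarrow> real"
  assumes b: "b \<in> carrier_vec n"
  defines "M \<equiv> gram n I p f"
  shows "M *\<^sub>v (ginv M *\<^sub>v (M *\<^sub>v b)) = M *\<^sub>v b"
proof -
  have M: "M \<in> carrier_mat n n" unfolding M_def by simp
  note G = ginv[OF M]
  have "M *\<^sub>v b = (M * ginv M * M) *\<^sub>v b" by (simp add: G)
  also have "\<dots> = (M * ginv M) *\<^sub>v (M *\<^sub>v b)" using M G b by (intro assoc_mult_mat_vec) auto
  also have "\<dots> = M *\<^sub>v (ginv M *\<^sub>v (M *\<^sub>v b))" using M G b by (intro assoc_mult_mat_vec) auto
  finally show ?thesis by simp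
qed

text \<open>On the range of \<open>M\<close> the values of the generalized inverse are determined by \<open>M\<close> alone.\<close>

lemma gram_range_value:
  fixes f :: "'i \<Rightarrow> rvec" and I :: "'i set" and p :: "'i \<Rightarrow> real"
  assumes a: "a \<in> carrier_vec n" and b: "b \<in> carrier_vec n"
    and f: "\<And>x. x \<in> I \<Longrightarrow> f x \<in> carrier_vec n"
  defines "M \<equiv> gram n I p f"
  shows "(M *\<^sub>v a) \<bullet> (ginv M *\<^sub>v (M *\<^sub>v b)) = a \<bullet> (M *\<^sub>v b)"
proof -
  have M: "M \<in> carrier_mat n n" unfolding M_def by simp
  note G = ginv[OF M]
  have c: "ginv M *\<^sub>v (M *\<^sub>v b) \<in> carrier_vec n" using M G b by auto
  have Ma: "M *\<^sub>v a \<in> carrier_vec n" using M a by auto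
  have "(M *\<^sub>v a) \<bullet> (ginv M *\<^sub>v (M *\<^sub>v b)) = (ginv M *\<^sub>v (M *\<^sub>v b)) \<bullet> (M *\<^sub>v a)"
    by (rule comm_scalar_prod[OF Ma c])
  also have "\<dots> = a \<bullet> (M *\<^sub>v (ginv M *\<^sub>v (M *\<^sub>v b)))"
    unfolding M_def using a c f unfolding M_def by (intro gram_sym) auto
  also have "\<dots> = a \<bullet> (M *\<^sub>v b)" unfolding M_def by (simp add: gram_ginv b)
  finally show ?thesis .
qed

lemma gram_cauchy_schwarz:
  assumes fin: "finite I" and p: "\<And>x. x \<in> I \<Longrightarrow> 0 \<le> p x"
    and a: "a \<in> carrier_vec n" and b: "b \<in> carrier_vec n"
    and f: "\<And>x. x \<in> I \<Longrightarrow> f x \<in> carrier_vec n"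
  shows "(b \<bullet> (gram n I p f *\<^sub>v a))\<^sup>2 \<le> gram_form I p f b * gram_form I p f a"
proof -
  have "b \<bullet> (gram n I p f *\<^sub>v a) = (\<Sum>x\<in>I. (sqrt (p x) * (a \<bullet> f x)) * (sqrt (p x) * (b \<bullet> f x)))"
    using p by (auto simp: gram_bilinear[where f = f and I = I, OF a b f] mult_ac intro!: sum.cong)
  also have "\<dots>\<^sup>2 \<le> (\<Sum>x\<in>I. (sqrt (p x) * (a \<bullet> f x))\<^sup>2) * (\<Sum>x\<in>I. (sqrt (p x) * (b \<bullet> f x))\<^sup>2)"
    by (rule Cauchy_Schwarz_ineq_sum)
  also have "\<dots> = gram_form I p f b * gram_form I p f a"
    using p by (simp add: gram_form_def power_mult_distrib mult.commute)
  finally show ?thesis .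
qed

text \<open>The variational form of a variance bound. It turns every statement about ranges and generalized
  inverses into a comparison of quadratic forms, which is monotone in the design. The direction from
  left to right is the Cauchy--Schwarz inequality. Conversely, the inequality makes \<open>u\<close> orthogonal to
  the kernel of \<open>M\<close>; as \<open>M\<close> is symmetric, \<open>u = M *\<^sub>v (G *\<^sub>v u)\<close>, and taking \<open>a = G *\<^sub>v u\<close> in
  the inequality bounds the variance.\<close>

lemma gram_range_iff:
  assumes fin: "finite I" and p: "\<And>x. x \<in> I \<Longrightarrow> 0 \<le> p x"
    and u: "u \<in> carrier_vec n" and f: "\<And>x. x \<in> I \<Longrightarrow> f x \<in> carrier_vec n"
  defines "M \<equiv> gram n I p f"
  shows "u \<in> mat_range M \<and> u \<bullet> (ginv M *\<^sub>v u) \<le> c \<longleftrightarrow>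
    0 \<le> c \<and> (\<forall>a\<in>carrier_vec n. (a \<bullet> u)\<^sup>2 \<le> c * gram_form I p f a)"
proof
  have M: "M \<in> carrier_mat n n" unfolding M_def by simp
  have q0: "0 \<le> gram_form I p f a" for a
    unfolding gram_form_def using p by (intro sum_nonneg) auto
  {
    assume l: "u \<in> mat_range M \<and> u \<bullet> (ginv M *\<^sub>v u) \<le> c"
    then obtain b where b: "b \<in> carrier_vec n" and ub: "u = M *\<^sub>v b"
      unfolding mat_range_def M_def by auto
    have "b \<bullet> (M *\<^sub>v b) = u \<bullet> (ginv M *\<^sub>v u)"
      unfolding ub M_def by (rule gram_range_value[where f = f and I = I, OF b b f, symmetric])
    then have qc: "gram_form I p f b \<le> c"
      using l gram_quadratic[where f = f and I = I and p = p, OF b f] unfolding M_def by simp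
    show "0 \<le> c \<and> (\<forall>a\<in>carrier_vec n. (a \<bullet> u)\<^sup>2 \<le> c * gram_form I p f a)"
    proof (intro conjI ballI)
      show "0 \<le> c" using qc q0[of b] by linarith
      fix a :: rvec assume a: "a \<in> carrier_vec n"
      have "(a \<bullet> u)\<^sup>2 \<le> gram_form I p f a * gram_form I p f b"
        unfolding ub M_def by (rule gram_cauchy_schwarz[where f = f and I = I and p = p, OF fin p b a f])
      also have "\<dots> \<le> gram_form I p f a * c" by (intro mult_left_mono qc q0)
      finally show "(a \<bullet> u)\<^sup>2 \<le> c * gram_form I p f a" by (simp add: mult.commute)
    qed
  }
  {
    assume r: "0 \<le> c \<and> (\<forall>a\<in>carrier_vec n. (a \<bullet> u)\<^sup>2 \<le> c * gram_form I p f a)"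
    define G where "G = ginv M"
    have G: "G \<in> carrier_mat n n" using ginv[OF M] unfolding G_def by simp
    have Gu: "G *\<^sub>v u \<in> carrier_vec n" using G u by auto
    have ortho: "a \<bullet> u = 0" if a: "a \<in> carrier_vec n" and z: "M *\<^sub>v a = 0\<^sub>v n" for a
    proof -
      have "gram_form I p f a = 0"
        using gram_quadratic[of a n I f p] z a f unfolding M_def by simp
      then have "(a \<bullet> u)\<^sup>2 \<le> 0" using r a by fastforce
      then show ?thesis by simp
    qed
    have "M *\<^sub>v (G *\<^sub>v u) = u"
    proof (rule vec_eq_from_scalar_prods[where n = n])
      fix w :: rvec assume w: "w \<in> carrier_vec n"
      \<comment> \<open>as \<open>M\<close> is symmetric, \<open>G\<^sup>T\<close> is a generalized inverse too, so \<open>w - v\<close> is in the kernel\<close>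
      define v where "v = transpose_mat G *\<^sub>v (M *\<^sub>v w)"
      have Mw: "M *\<^sub>v w \<in> carrier_vec n" using M w by auto
      have v: "v \<in> carrier_vec n" unfolding v_def using G Mw by auto
      have dotv: "v \<bullet> t = (M *\<^sub>v w) \<bullet> (G *\<^sub>v t)" if t: "t \<in> carrier_vec n" for t
        unfolding v_def using transpose_vec_mult_scalar[OF G t Mw] 
        by (metis G Mw comm_scalar_prod mult_mat_vec_carrier t transpose_carrier_mat v v_def)
      have sym: "(M *\<^sub>v a) \<bullet> t = a \<bullet> (M *\<^sub>v t)" if "a \<in> carrier_vec n" "t \<in> carrier_vec n" for a t
        using gram_sym[where f = f and I = I and p = p, OF that(1,2) f] that M unfolding M_def
        by (metis comm_scalar_prod gram_carrier(1) mult_mat_vec_carrier)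
      have "M *\<^sub>v v = M *\<^sub>v w"
      proof (rule vec_eq_from_scalar_prods[where n = n])
        fix t :: rvec assume t: "t \<in> carrier_vec n"
        have Mt: "M *\<^sub>v t \<in> carrier_vec n" using M t by auto
        have "t \<bullet> (M *\<^sub>v v) = (M *\<^sub>v t) \<bullet> v" by (rule sym[OF t v, symmetric])
        also have "\<dots> = v \<bullet> (M *\<^sub>v t)" by (rule comm_scalar_prod[OF Mt v])
        also have "\<dots> = (M *\<^sub>v w) \<bullet> (G *\<^sub>v (M *\<^sub>v t))" by (rule dotv[OF Mt])
        also have "\<dots> = w \<bullet> (M *\<^sub>v t)" unfolding G_def M_def by (rule gram_range_value[where f = f and I = I, OF w t f])
        also have "\<dots> = t \<bullet> (M *\<^sub>v w)" unfolding M_def by (rule gram_sym[where f = f and I = I, OF t w f])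
        finally show "t \<bullet> (M *\<^sub>v v) = t \<bullet> (M *\<^sub>v w)" .
      qed (use M v w in auto)
      then have "M *\<^sub>v (w - v) = 0\<^sub>v n"
        using M w v by (simp add: mult_minus_distrib_mat_vec[of _ n n])
      then have "(w - v) \<bullet> u = 0" using ortho[of "w - v"] w v by simp
      then have "w \<bullet> u = v \<bullet> u" using w v u by (simp add: minus_scalar_prod_distrib[of _ n])
      also have "\<dots> = (M *\<^sub>v w) \<bullet> (G *\<^sub>v u)" by (rule dotv[OF u])
      also have "\<dots> = w \<bullet> (M *\<^sub>v (G *\<^sub>v u))" by (rule sym[OF w Gu])
      finally show "w \<bullet> (M *\<^sub>v (G *\<^sub>v u)) = w \<bullet> u" by simp
    qed (use M G u in auto)
    then have rng: "u = M *\<^sub>v (G *\<^sub>v u)" by simp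
    define b where "b = G *\<^sub>v u"
    have b: "b \<in> carrier_vec n" unfolding b_def by (rule Gu)
    have ub: "u = M *\<^sub>v b" unfolding b_def by (rule rng)
    have bu: "b \<bullet> u = gram_form I p f b"
      unfolding ub M_def by (rule gram_quadratic[where f = f and I = I, OF b f])
    have "(gram_form I p f b)\<^sup>2 \<le> c * gram_form I p f b" using bspec[OF conjunct2[OF r] b] unfolding bu .
    then have "gram_form I p f b \<le> c"
      using conjunct1[OF r] q0[of b] by (cases "gram_form I p f b = 0") (simp_all add: power2_eq_square)
    moreover have "u \<bullet> b = b \<bullet> u" by (rule comm_scalar_prod[OF u b])
    ultimately have "u \<bullet> b \<le> c" using bu by linarith
    then have "u \<bullet> (ginv M *\<^sub>v u) \<le> c" unfolding b_def G_def .
    moreover have "b \<in> carrier_vec (dim_col M)" using b M by auto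
    then have "u \<in> mat_range M" unfolding mat_range_def using ub by blast
    ultimately show "u \<in> mat_range M \<and> u \<bullet> (ginv M *\<^sub>v u) \<le> c" by blast
  }
qed

section \<open>Optimal designs and the Kiefer--Wolfowitz bound\<close>

text \<open>Conjugating the block matrix with rows \<open>(I + u v\<^sup>T, u)\<close> and \<open>(0, 1)\<close> by the unitriangular
  matrix with last row \<open>(v\<^sup>T, 1)\<close> gives the rows \<open>(I, u)\<close> and \<open>(0, 1 + v \<bullet> u)\<close>.\<close>

lemma rank_one_det:
  fixes u v :: rvec
  assumes u: "u \<in> carrier_vec n" and v: "v \<in> carrier_vec n"
  shows "det (1\<^sub>m n + mat n n (\<lambda>(i, j). u $ i * v $ j)) = 1 + v \<bullet> u"
proof -
  define U where "U = mat n 1 (\<lambda>(i, j). u $ i)"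
  define W where "W = mat 1 n (\<lambda>(i, j). v $ j)"
  define Z where "Z = mat n n (\<lambda>(i, j). u $ i * v $ j)"
  define s where "s = mat 1 1 (\<lambda>(i, j). v \<bullet> u)"
  have c: "U \<in> carrier_mat n 1" "W \<in> carrier_mat 1 n" "Z \<in> carrier_mat n n" "s \<in> carrier_mat 1 1"
    unfolding U_def W_def Z_def s_def by auto
  have UW: "U * W = Z" unfolding U_def W_def Z_def
    by (rule eq_matI) (auto simp: scalar_prod_def)
  have WU: "W * U = s" unfolding U_def W_def s_def
    using u v by (intro eq_matI) (auto simp: scalar_prod_def)
  have Us: "U * s = Z * U"
    using assoc_mult_mat[OF c(1) c(2) c(1)] unfolding UW WU by simp
  let ?L = "four_block_mat (1\<^sub>m n) (0\<^sub>m n 1) W (1\<^sub>m 1)"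
  let ?M = "four_block_mat (1\<^sub>m n + Z) U (0\<^sub>m 1 n) (1\<^sub>m 1)"
  let ?R = "four_block_mat (1\<^sub>m n) (0\<^sub>m n 1) (- W) (1\<^sub>m 1)"
  have cL: "?L \<in> carrier_mat (n + 1) (n + 1)" and cM: "?M \<in> carrier_mat (n + 1) (n + 1)"
    and cR: "?R \<in> carrier_mat (n + 1) (n + 1)"
    using c by auto
  have WZ: "W * (1\<^sub>m n + Z) = W + W * Z"
    using c by (subst mult_add_distrib_mat[of _ 1 n _ n]) auto
  have LM: "?L * ?M = four_block_mat (1\<^sub>m n + Z) U (W + W * Z) (s + 1\<^sub>m 1)"
  proof -
    have "?L * ?M = four_block_mat (1\<^sub>m n * (1\<^sub>m n + Z) + 0\<^sub>m n 1 * 0\<^sub>m 1 n) (1\<^sub>m n * U + 0\<^sub>m n 1 * 1\<^sub>m 1)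
      (W * (1\<^sub>m n + Z) + 1\<^sub>m 1 * 0\<^sub>m 1 n) (W * U + 1\<^sub>m 1 * 1\<^sub>m 1)"
      using c by (intro mult_four_block_mat) auto
    moreover have "1\<^sub>m n * (1\<^sub>m n + Z) + 0\<^sub>m n 1 * 0\<^sub>m 1 n = 1\<^sub>m n + Z"
      "1\<^sub>m n * U + 0\<^sub>m n 1 * 1\<^sub>m 1 = U" "W * (1\<^sub>m n + Z) + 1\<^sub>m 1 * 0\<^sub>m 1 n = W + W * Z"
      "W * U + 1\<^sub>m 1 * 1\<^sub>m 1 = s + 1\<^sub>m 1"
      using c by (auto simp: WZ WU)
    ultimately show ?thesis by simp
  qed
  have sW: "W * Z = s * W" unfolding UW[symmetric] WU[symmetric]
    using c by (intro assoc_mult_mat[symmetric]) auto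
  have LMR: "?L * ?M * ?R = four_block_mat (1\<^sub>m n) U (0\<^sub>m 1 n) (s + 1\<^sub>m 1)"
  proof -
    have U': "U * (- W) = - Z" using c UW by simp
    have s': "(s + 1\<^sub>m 1) * (- W) = - (s * W) - W"
    proof -
      have "(s + 1\<^sub>m 1) * (- W) = s * (- W) + 1\<^sub>m 1 * (- W)"
        using c by (intro add_mult_distrib_mat) auto
      then show ?thesis using c by simp (rule eq_matI, auto)
    qed
    have "?L * ?M * ?R = four_block_mat ((1\<^sub>m n + Z) * 1\<^sub>m n + U * (- W)) ((1\<^sub>m n + Z) * 0\<^sub>m n 1 + U * 1\<^sub>m 1)
      ((W + W * Z) * 1\<^sub>m n + (s + 1\<^sub>m 1) * (- W)) ((W + W * Z) * 0\<^sub>m n 1 + (s + 1\<^sub>m 1) * 1\<^sub>m 1)"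
      unfolding LM using c by (intro mult_four_block_mat) auto
    moreover have "(1\<^sub>m n + Z) * 1\<^sub>m n + U * (- W) = 1\<^sub>m n" unfolding U'
      using c by simp (rule eq_matI, auto)
    moreover have "(1\<^sub>m n + Z) * 0\<^sub>m n 1 + U * 1\<^sub>m 1 = U" using c by simp
    moreover have "(W + W * Z) * 1\<^sub>m n + (s + 1\<^sub>m 1) * (- W) = 0\<^sub>m 1 n"
    proof -
      define Y where "Y = s * W"
      have "Y \<in> carrier_mat 1 n" unfolding Y_def using c by simp
      then show ?thesis unfolding s' sW Y_def[symmetric]
        using c by simp (rule eq_matI, auto)
    qed
    moreover have "(W + W * Z) * 0\<^sub>m n 1 + (s + 1\<^sub>m 1) * 1\<^sub>m 1 = s + 1\<^sub>m 1" using c by simp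
    ultimately show ?thesis by simp
  qed
  have "det (?L * ?M * ?R) = det (s + 1\<^sub>m 1)"
    unfolding LMR using c by (subst det_four_block_mat_lower_left_zero[of _ n _ 1]) auto
  moreover have "det (?L * ?M * ?R) = det ?L * det ?M * det ?R"
    using cL cM cR by (subst det_mult[of _ "n + 1"], simp, simp) (subst det_mult[of _ "n + 1"], auto)
  moreover have "det ?L = 1" using c by (subst det_four_block_mat_upper_right_zero[of _ n _ 1]) auto
  moreover have "det ?R = 1" using c by (subst det_four_block_mat_upper_right_zero[of _ n _ 1]) auto
  moreover have "det ?M = det (1\<^sub>m n + Z)"
    using c by (subst det_four_block_mat_lower_left_zero[of _ n _ 1]) auto
  moreover have "det (s + 1\<^sub>m 1) = v \<bullet> u + 1"
    using det_single[of "s + 1\<^sub>m 1"] by (simp add: s_def)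
  ultimately show ?thesis unfolding Z_def by simp
qed

lemma gram_positive_definite_det:
  assumes fin: "finite I" and p: "\<And>x. x \<in> I \<Longrightarrow> 0 < p x"
    and f: "\<And>x. x \<in> I \<Longrightarrow> f x \<in> carrier_vec n"
    and sp: "\<And>a. a \<in> carrier_vec n \<Longrightarrow> (\<And>x. x \<in> I \<Longrightarrow> a \<bullet> f x = 0) \<Longrightarrow> a = 0\<^sub>v n"
  shows "det (gram n I p f) \<noteq> 0"
proof
  assume "det (gram n I p f) = 0"
  then obtain v where v: "v \<in> carrier_vec n" "v \<noteq> 0\<^sub>v n" "gram n I p f *\<^sub>v v = 0\<^sub>v n"
    using det_0_iff_vec_prod_zero[of "gram n I p f" n] by auto
  have "gram_form I p f v = 0"
    using gram_quadratic[of v n I f p] v f by simp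
  then have "\<And>x. x \<in> I \<Longrightarrow> p x * (v \<bullet> f x)\<^sup>2 = 0"
    unfolding gram_form_def using p fin less_imp_le[OF p] by (subst (asm) sum_nonneg_eq_0_iff) auto
  then have "\<And>x. x \<in> I \<Longrightarrow> v \<bullet> f x = 0" using p by fastforce
  then show False using sp[OF v(1)] v(2) by blast
qed

text \<open>The coordinates outside \<open>I\<close> are set to zero, so that the simplex is a closed subset of a product
  of compact sets.\<close>

lemma design_simplex_compact:
  assumes "finite I"
  shows "compact {p :: 'i \<Rightarrow> real. (\<forall>i. if i \<in> I then p i \<in> {0..1} else p i = 0) \<and> sum p I = 1}"
proof -
  have "compact (PiE UNIV (\<lambda>i. if i \<in> I then {0..1::real} else {0}))"
    unfolding compactin_euclidean_iff[symmetric] euclidean_product_topology[symmetric] compactin_PiE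
    by auto
  moreover have "closed {p :: 'i \<Rightarrow> real. sum p I = 1}"
    by (intro closed_Collect_eq continuous_intros) auto
  moreover have "{p :: 'i \<Rightarrow> real. (\<forall>i. if i \<in> I then p i \<in> {0..1} else p i = 0) \<and> sum p I = 1}
     = PiE UNIV (\<lambda>i. if i \<in> I then {0..1::real} else {0}) \<inter> {p. sum p I = 1}"
    by (auto simp: PiE_def Pi_def split: if_splits)
  ultimately show ?thesis by (simp add: compact_Int_closed)
qed

text \<open>The assumption is what maximality of a determinant along a segment of designs amounts to. To first
  order at \<open>t = 0\<close> it reads \<open>- n + s \<le> 0\<close>; Bernoulli's inequality replaces the differentiation.\<close>

lemma geometric_slope_bound:
  fixes s :: real and n :: nat
  assumes n: "0 < n" and s: "0 \<le> s"
    and le: "\<And>t. 0 < t \<Longrightarrow> t < 1 \<Longrightarrow> (1 - t) ^ n * (1 + t / (1 - t) * s) \<le> 1"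
  shows "s \<le> n"
proof (rule ccontr)
  assume "\<not> s \<le> n"
  then have sn: "s > n" by simp
  obtain m where m: "n = Suc m" using n by (cases n) auto
  define c where "c = real m * (s - 1)"
  have c: "0 \<le> c" unfolding c_def using sn m by simp
  \<comment> \<open>below, \<open>t\<close> is only required to satisfy \<open>c * t < s - n\<close> and \<open>0 < t < 1\<close>\<close>
  define t where "t = (s - n) / (s - n + c + 1)"
  have t: "0 < t" "t < 1" unfolding t_def using sn c by auto
  have "(1 + (- t)) ^ m \<ge> 1 + real m * (- t)" by (rule Bernoulli_inequality) (use t in simp)
  then have "(1 - real m * t) * (1 - t + t * s) \<le> (1 - t) ^ m * (1 - t + t * s)"
    using t s by (intro mult_right_mono) auto
  also have "\<dots> = (1 - t) ^ n * (1 + t / (1 - t) * s)"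
    using t unfolding m by (simp add: field_simps)
  also have "\<dots> \<le> 1" by (rule le[OF t])
  finally have "t * (s - n) \<le> t * (c * t)" unfolding c_def m by (simp add: algebra_simps)
  then have "s - n \<le> c * t" using t by simp
  also have "c * t < s - n"
  proof -
    have "(s - n) * c < (s - n) * (s - n + c + 1)"
      using sn by (intro mult_strict_left_mono) auto
    then show ?thesis unfolding t_def using sn c by (simp add: pos_divide_less_eq mult.commute)
  qed
  finally show False by simp
qed

lemma continuous_gram_det:
  assumes "finite I"
  shows "continuous_on S (\<lambda>p. det (gram n I p f))"
proof -
  have eq: "det (gram n I p f) = (\<Sum>\<pi> | \<pi> permutes {0..<n}. signof \<pi> *
     (\<Prod>i = 0..<n. \<Sum>x\<in>I. p x * (f x $ i * f x $ \<pi> i)))" for p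
    unfolding det_def gram_def by (auto intro!: sum.cong prod.cong simp: permutes_in_image)
  show ?thesis unfolding eq
    by (intro continuous_intros continuous_on_product_coordinates[THEN continuous_on_subset]) auto
qed

text \<open>The bound holds for a design that maximises \<open>\<bar>det M\<bar>\<close>. Moving a fraction \<open>t\<close> of its mass to \<open>x\<close>
  multiplies the determinant by \<open>(1 - t)^n * (1 + t / (1 - t) * s)\<close>, where \<open>s\<close> is the variance at
  \<open>x\<close>, because the move is a rescaling and a rank one update.\<close>

lemma kiefer_wolfowitz_spanning:
  fixes f :: "'i \<Rightarrow> rvec"
  assumes fin: "finite I" and ne: "I \<noteq> {}" and n: "0 < n"
    and f: "\<And>x. x \<in> I \<Longrightarrow> f x \<in> carrier_vec n"
    and sp: "\<And>a. a \<in> carrier_vec n \<Longrightarrow> (\<And>x. x \<in> I \<Longrightarrow> a \<bullet> f x = 0) \<Longrightarrow> a = 0\<^sub>v n"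
  shows "\<exists>p. (\<forall>x\<in>I. 0 \<le> p x) \<and> sum p I = 1 \<and>
    (\<forall>x\<in>I. \<forall>a\<in>carrier_vec n. (a \<bullet> f x)\<^sup>2 \<le> real n * gram_form I p f a)"
proof -
  define K where "K = {p :: 'i \<Rightarrow> real. (\<forall>i. if i \<in> I then p i \<in> {0..1} else p i = 0) \<and> sum p I = 1}"
  have K: "compact K" unfolding K_def by (rule design_simplex_compact[OF fin])
  \<comment> \<open>the uniform design shows that the maximum is not zero\<close>
  define u where "u = (\<lambda>i. if i \<in> I then 1 / real (card I) else 0)"
  have cI: "0 < card I" using fin ne by (simp add: card_gt_0_iff)
  have u: "u \<in> K" unfolding K_def u_def using cI by (auto simp: field_simps)
  have "continuous_on K (\<lambda>p. \<bar>det (gram n I p f)\<bar>)"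
    by (intro continuous_intros continuous_gram_det fin)
  from continuous_attains_sup[OF K _ this] u obtain p where p: "p \<in> K"
    and max: "\<And>q. q \<in> K \<Longrightarrow> \<bar>det (gram n I q f)\<bar> \<le> \<bar>det (gram n I p f)\<bar>" by blast
  define M where "M = gram n I p f"
  have M: "M \<in> carrier_mat n n" unfolding M_def by simp
  have "det (gram n I u f) \<noteq> 0"
    by (rule gram_positive_definite_det) (use fin f sp cI in \<open>auto simp: u_def\<close>)
  then have detM: "det M \<noteq> 0" using max[OF u] unfolding M_def by auto
  have p0: "0 \<le> p x" if "x \<in> I" for x
    using p that unfolding K_def by (metis (mono_tags, lifting) atLeastAtMost_iff mem_Collect_eq)
  have p1: "sum p I = 1" using p unfolding K_def by blast
  have main: "(a \<bullet> f x)\<^sup>2 \<le> real n * gram_form I p f a" if x: "x \<in> I" and a: "a \<in> carrier_vec n" for x a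
  proof -
    obtain N where N: "N \<in> carrier_mat n n" "M * N = 1\<^sub>m n"
      using det_non_zero_imp_unit[OF M detM] unfolding Units_def ring_mat_def by auto
    define w where "w = N *\<^sub>v f x"
    have w: "w \<in> carrier_vec n" unfolding w_def using N f[OF x] by auto
    have Mw: "M *\<^sub>v w = f x" unfolding w_def
      using assoc_mult_mat_vec[OF M N(1) f[OF x]] N(2) f[OF x] by simp
    define s where "s = f x \<bullet> w"
    have s_eq: "s = gram_form I p f w"
    proof -
      have "s = w \<bullet> f x" unfolding s_def by (rule comm_scalar_prod[OF f[OF x] w])
      also have "\<dots> = w \<bullet> (gram n I p f *\<^sub>v w)" using Mw unfolding M_def by simp
      also have "\<dots> = gram_form I p f w" by (rule gram_quadratic[OF w]) (rule f)
      finally show ?thesis .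
    qed
    have s0: "0 \<le> s" unfolding s_eq gram_form_def using p0 by (intro sum_nonneg) auto
    have "s \<le> real n"
    proof (rule geometric_slope_bound[OF n s0])
      fix t :: real assume t: "0 < t" "t < 1"
      define q where "q = (\<lambda>i. (1 - t) * p i + (if i = x then t else 0))"
      have q1: "sum q I = 1" unfolding q_def using x fin p1
        by (simp add: sum.distrib sum_distrib_left[symmetric] sum.delta)
      have q0: "0 \<le> q i" if "i \<in> I" for i unfolding q_def using t p0[OF that] by auto
      have "q i \<le> 1" if "i \<in> I" for i
        using member_le_sum[of i I q] q0 q1 that fin by auto
      moreover have "q i = 0" if "i \<notin> I" for i
        using p that x unfolding q_def K_def by auto
      ultimately have qK: "q \<in> K" unfolding K_def using q0 q1 by auto
      define Z where "Z = mat n n (\<lambda>(i, j). (t / (1 - t)) * w $ i * f x $ j)"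
      define X where "X = 1\<^sub>m n + Z"
      have Z: "Z \<in> carrier_mat n n" "X \<in> carrier_mat n n" unfolding X_def Z_def by auto
      have MZ: "M * Z = mat n n (\<lambda>(i, j). (t / (1 - t)) * (f x $ i * f x $ j))"
      proof (rule eq_matI)
        fix i j assume "i < dim_row (mat n n (\<lambda>(i, j). (t / (1 - t)) * (f x $ i * f x $ j)))"
          "j < dim_col (mat n n (\<lambda>(i, j). (t / (1 - t)) * (f x $ i * f x $ j)))"
        then have ij: "i < n" "j < n" by auto
        have "(M * Z) $$ (i, j) = (\<Sum>k\<in>{0..<n}. M $$ (i, k) * Z $$ (k, j))"
          using M Z ij by (simp add: scalar_prod_def)
        also have "\<dots> = (t / (1 - t)) * f x $ j * (\<Sum>k\<in>{0..<n}. M $$ (i, k) * w $ k)"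
          unfolding Z_def sum_distrib_left using ij by (intro sum.cong) auto
        also have "(\<Sum>k\<in>{0..<n}. M $$ (i, k) * w $ k) = (M *\<^sub>v w) $ i"
          using M w ij by (simp add: scalar_prod_def)
        finally show "(M * Z) $$ (i, j) = mat n n (\<lambda>(i, j). (t / (1 - t)) * (f x $ i * f x $ j)) $$ (i, j)"
          using ij Mw by simp
      qed (use M Z in auto)
      have "gram n I q f = (1 - t) \<cdot>\<^sub>m (M * X)"
      proof -
        have "M * X = M + M * Z" unfolding X_def using M Z
          by (subst mult_add_distrib_mat[of _ n n _ n]) auto
        then have "(1 - t) \<cdot>\<^sub>m (M * X) = (1 - t) \<cdot>\<^sub>m (M + M * Z)" by simp
        also have "\<dots> = gram n I q f" unfolding MZ
        proof (rule eq_matI)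
          fix i j assume "i < dim_row (gram n I q f)" "j < dim_col (gram n I q f)"
          then have ij: "i < n" "j < n" by auto
          have "gram n I q f $$ (i, j) = (\<Sum>y\<in>I. (1 - t) * (p y * (f y $ i * f y $ j))
              + (if y = x then t * (f y $ i * f y $ j) else 0))"
            unfolding q_def gram_def using ij by (auto intro!: sum.cong simp: algebra_simps)
          also have "\<dots> = (1 - t) * (\<Sum>y\<in>I. p y * (f y $ i * f y $ j)) + t * (f x $ i * f x $ j)"
            using x fin by (simp add: sum.distrib sum_distrib_left[symmetric] sum.delta)
          also have "t * (f x $ i * f x $ j) = (1 - t) * (t / (1 - t) * (f x $ i * f x $ j))"
            using t by simp
          finally show "((1 - t) \<cdot>\<^sub>m (M + mat n n (\<lambda>(i, j). t / (1 - t) * (f x $ i * f x $ j)))) $$ (i, j)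
              = gram n I q f $$ (i, j)"
            using ij unfolding M_def by (simp add: gram_def distrib_left)
        qed (use M in auto)
        finally show ?thesis ..
      qed
      then have "det (gram n I q f) = (1 - t) ^ n * (det M * det X)"
        using M Z by (simp add: det_mult[of M n])
      also have "det X = 1 + t / (1 - t) * s"
      proof -
        have "X = 1\<^sub>m n + mat n n (\<lambda>(i, j). ((t / (1 - t)) \<cdot>\<^sub>v w) $ i * f x $ j)"
          unfolding X_def Z_def using w by (intro arg_cong[where f = "\<lambda>A. 1\<^sub>m n + A"] cong_mat) auto
        then have "det X = 1 + f x \<bullet> ((t / (1 - t)) \<cdot>\<^sub>v w)"
          using rank_one_det[of "(t / (1 - t)) \<cdot>\<^sub>v w" n "f x"] w f[OF x] by simp
        then show ?thesis using w f[OF x] unfolding s_def by simp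
      qed
      finally have "\<bar>det (gram n I q f)\<bar> = ((1 - t) ^ n * (1 + t / (1 - t) * s)) * \<bar>det M\<bar>"
        using t s0 by (simp add: abs_mult)
      with max[OF qK] have "((1 - t) ^ n * (1 + t / (1 - t) * s)) * \<bar>det M\<bar> \<le> 1 * \<bar>det M\<bar>"
        unfolding M_def by simp
      then show "(1 - t) ^ n * (1 + t / (1 - t) * s) \<le> 1"
        using detM by (subst (asm) mult_le_cancel_right) auto
    qed
    have "(a \<bullet> f x)\<^sup>2 = (a \<bullet> (gram n I p f *\<^sub>v w))\<^sup>2" using Mw unfolding M_def by simp
    also have "\<dots> \<le> gram_form I p f a * gram_form I p f w"
      by (rule gram_cauchy_schwarz[OF fin _ w a]) (use p0 f in auto)
    also have "\<dots> \<le> gram_form I p f a * real n"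
      using \<open>s \<le> real n\<close> p0 unfolding s_eq by (intro mult_left_mono) (auto simp: gram_form_def intro!: sum_nonneg)
    finally show ?thesis by (simp add: mult.commute)
  qed
  show ?thesis using p0 p1 main by blast
qed

text \<open>If the vectors do not span the space, small multiples \<open>\<eta> e\<^sub>j\<close> of the unit vectors are added to the
  family. Moving the mass of these vectors to some point of \<open>S\<close> leaves an error of at most \<open>\<eta>\<^sup>2 * (a \<bullet> a)\<close> in
  the quadratic form, and compactness of the simplex of designs allows to let \<open>\<eta>\<close> tend to zero.\<close>

lemma kiefer_wolfowitz:
  fixes f :: "'i \<Rightarrow> rvec"
  assumes fin: "finite S" and ne: "S \<noteq> {}" and n: "0 < n"
    and f: "\<And>x. x \<in> S \<Longrightarrow> f x \<in> carrier_vec n"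
  shows "\<exists>p. (\<forall>x\<in>S. 0 \<le> p x) \<and> sum p S = 1 \<and>
    (\<forall>x\<in>S. \<forall>a\<in>carrier_vec n. (a \<bullet> f x)\<^sup>2 \<le> real n * gram_form S p f a)"
proof -
  define K where "K = {p :: 'i \<Rightarrow> real. (\<forall>i. if i \<in> S then p i \<in> {0..1} else p i = 0) \<and> sum p S = 1}"
  have K: "compact K" unfolding K_def by (rule design_simplex_compact[OF fin])
  define F where "F = (\<lambda>m. {p. \<forall>x\<in>S. \<forall>a\<in>carrier_vec n.
     (a \<bullet> f x)\<^sup>2 \<le> real n * (gram_form S p f a + inverse (real (Suc m)) * (a \<bullet> a))})"
  have closed: "closed (F m)" for m
    unfolding F_def gram_form_def Ball_def
    by (intro closed_Collect_all closed_Collect_imp open_Collect_const closed_Collect_le continuous_intros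
        continuous_on_product_coordinates)
  have mono: "F m' \<subseteq> F m" if "m \<le> m'" for m m'
  proof
    fix p assume p: "p \<in> F m'"
    have "(a \<bullet> f x)\<^sup>2 \<le> real n * (gram_form S p f a + inverse (real (Suc m)) * (a \<bullet> a))"
      if "x \<in> S" "a \<in> carrier_vec n" for x a
    proof -
      have "(a \<bullet> f x)\<^sup>2 \<le> real n * (gram_form S p f a + inverse (real (Suc m')) * (a \<bullet> a))"
        using p that unfolding F_def by blast
      also have "\<dots> \<le> real n * (gram_form S p f a + inverse (real (Suc m)) * (a \<bullet> a))"
        using \<open>m \<le> m'\<close> by (intro mult_left_mono add_left_mono mult_right_mono) (auto simp: scalar_prod_def intro!: sum_nonneg)
      finally show ?thesis .
    qed
    then show "p \<in> F m" unfolding F_def by blast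
  qed
  have nonempty: "K \<inter> F m \<noteq> {}" for m
  proof -
    define \<eta> where "\<eta> = sqrt (inverse (real (Suc m)))"
    have \<eta>: "\<eta>\<^sup>2 = inverse (real (Suc m))" "\<eta> \<noteq> 0" unfolding \<eta>_def by auto
    define J where "J = Inl ` S \<union> Inr ` {..<n}"
    define g where "g = (\<lambda>i. case i of Inl x \<Rightarrow> f x | Inr j \<Rightarrow> \<eta> \<cdot>\<^sub>v unit_vec n j)"
    have gdot: "a \<bullet> g (Inr j) = \<eta> * a $ j" if "a \<in> carrier_vec n" "j < n" for a j
      unfolding g_def using that by simp
    have "\<exists>p. (\<forall>i\<in>J. 0 \<le> p i) \<and> sum p J = 1 \<and>
      (\<forall>i\<in>J. \<forall>a\<in>carrier_vec n. (a \<bullet> g i)\<^sup>2 \<le> real n * gram_form J p g a)"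
    proof (rule kiefer_wolfowitz_spanning[OF _ _ n])
      show "finite J" "J \<noteq> {}" unfolding J_def using fin ne by auto
      show "g i \<in> carrier_vec n" if "i \<in> J" for i
        using that f unfolding J_def g_def by auto
      fix a :: rvec assume a: "a \<in> carrier_vec n" and z: "\<And>i. i \<in> J \<Longrightarrow> a \<bullet> g i = 0"
      show "a = 0\<^sub>v n"
      proof (rule eq_vecI)
        fix j assume "j < dim_vec (0\<^sub>v n :: rvec)"
        then have j: "j < n" by simp
        then have "\<eta> * a $ j = 0" using z[of "Inr j"] gdot[OF a j] unfolding J_def by auto
        then show "a $ j = 0\<^sub>v n $ j" using \<eta> j by simp
      qed (use a in simp)
    qed
    then obtain p where p0: "\<And>i. i \<in> J \<Longrightarrow> 0 \<le> p i" and p1: "sum p J = 1"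
      and pb: "\<And>i a. i \<in> J \<Longrightarrow> a \<in> carrier_vec n \<Longrightarrow> (a \<bullet> g i)\<^sup>2 \<le> real n * gram_form J p g a" by blast
    have sumJ: "sum h J = (\<Sum>x\<in>S. h (Inl x)) + (\<Sum>j<n. h (Inr j))" for h :: "'i + nat \<Rightarrow> real"
      unfolding J_def using fin by (subst sum.union_disjoint) (auto simp: sum.reindex)
    have pr1: "p (Inr j) \<le> 1" if "j < n" for j
    proof -
      have "p (Inr j) \<le> sum p J"
        using p0 that fin by (intro member_le_sum) (auto simp: J_def)
      then show ?thesis using p1 by simp
    qed
    \<comment> \<open>the mass of the auxiliary vectors is moved to an arbitrary point of \<open>S\<close>\<close>
    obtain x0 where x0: "x0 \<in> S" using ne by blast
    define r where "r = (\<Sum>j<n. p (Inr j))"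
    have r: "0 \<le> r" unfolding r_def by (intro sum_nonneg) (auto intro!: p0 simp: J_def)
    define q where "q = (\<lambda>x. if x \<in> S then p (Inl x) + (if x = x0 then r else 0) else 0)"
    have q_ge: "p (Inl x) \<le> q x" if "x \<in> S" for x unfolding q_def using that r by auto
    have q0: "0 \<le> q x" if "x \<in> S" for x
      using q_ge[OF that] p0[of "Inl x"] that unfolding J_def by auto
    have q1: "sum q S = 1"
    proof -
      have "sum q S = (\<Sum>x\<in>S. p (Inl x) + (if x = x0 then r else 0))" unfolding q_def by (intro sum.cong) auto
      also have "\<dots> = sum p J" unfolding sumJ r_def using x0 fin by (simp add: sum.distrib sum.delta)
      finally show ?thesis using p1 by simp
    qed
    have "q x \<le> 1" if "x \<in> S" for x
      using member_le_sum[of x S q] q0 q1 that fin by auto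
    then have "q \<in> K" unfolding K_def using q0 q1 by (auto simp: q_def)
    moreover have "q \<in> F m"
    proof -
      have "(a \<bullet> f x)\<^sup>2 \<le> real n * (gram_form S q f a + inverse (real (Suc m)) * (a \<bullet> a))"
        if x: "x \<in> S" and a: "a \<in> carrier_vec n" for x a
      proof -
        have "(a \<bullet> f x)\<^sup>2 \<le> real n * gram_form J p g a"
          using pb[of "Inl x" a] x a unfolding J_def g_def by auto
        also have "gram_form J p g a = (\<Sum>x\<in>S. p (Inl x) * (a \<bullet> f x)\<^sup>2) + (\<Sum>j<n. p (Inr j) * (a \<bullet> g (Inr j))\<^sup>2)"
          unfolding gram_form_def sumJ by (simp add: g_def)
        also have "(\<Sum>j<n. p (Inr j) * (a \<bullet> g (Inr j))\<^sup>2) \<le> (\<Sum>j<n. 1 * (\<eta> * a $ j)\<^sup>2)"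
          using pr1 a by (intro sum_mono mult_mono) (auto simp: gdot)
        also have "(\<Sum>j<n. 1 * (\<eta> * a $ j)\<^sup>2) = inverse (real (Suc m)) * (a \<bullet> a)"
        proof -
          have "1 * (\<eta> * a $ j)\<^sup>2 = inverse (real (Suc m)) * (a $ j * a $ j)" for j
            by (simp only: power_mult_distrib \<eta> power2_eq_square[of "a $ j"] mult_1)
          then show ?thesis using a by (simp add: scalar_prod_def sum_distrib_left atLeast0LessThan)
        qed
        also have "(\<Sum>x\<in>S. p (Inl x) * (a \<bullet> f x)\<^sup>2) \<le> gram_form S q f a"
          unfolding gram_form_def by (intro sum_mono mult_right_mono q_ge) auto
        finally show ?thesis using n by simp
      qed
      then show ?thesis unfolding F_def by blast
    qed
    ultimately show ?thesis by blast
  qed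
  have "K \<inter> (\<Inter>m\<in>UNIV. F m) \<noteq> {}"
  proof (rule compact_imp_fip_image[OF K closed])
    fix I' :: "nat set" assume "finite I'"
    then have "F (Max (insert 0 I')) \<subseteq> (\<Inter>i\<in>I'. F i)"
      by (intro INT_greatest mono) auto
    then show "K \<inter> (\<Inter>i\<in>I'. F i) \<noteq> {}" using nonempty[of "Max (insert 0 I')"] by blast
  qed
  then obtain p where p: "p \<in> K" "\<And>m. p \<in> F m" by blast
  have "(a \<bullet> f x)\<^sup>2 \<le> real n * gram_form S p f a" if "x \<in> S" "a \<in> carrier_vec n" for x a
  proof (rule LIMSEQ_le_const)
    have "(\<lambda>m. real n * (gram_form S p f a + inverse (real (Suc m)) * (a \<bullet> a)))
      \<longlonglongrightarrow> real n * (gram_form S p f a + 0 * (a \<bullet> a))"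
      by (intro tendsto_intros LIMSEQ_inverse_real_of_nat)
    then show "(\<lambda>m. real n * (gram_form S p f a + inverse (real (Suc m)) * (a \<bullet> a)))
      \<longlonglongrightarrow> real n * gram_form S p f a" by simp
    show "\<exists>N. \<forall>m\<ge>N. (a \<bullet> f x)\<^sup>2 \<le> real n * (gram_form S p f a + inverse (real (Suc m)) * (a \<bullet> a))"
      using p(2) that unfolding F_def by blast
  qed
  moreover have "0 \<le> p x" if "x \<in> S" for x
    using p(1) that unfolding K_def by (metis (mono_tags, lifting) atLeastAtMost_iff mem_Collect_eq)
  moreover have "sum p S = 1" using p(1) unfolding K_def by blast
  ultimately show ?thesis by blast
qed

section \<open>Designs and least squares in the bandit model\<close>

lemma V_gram: "V B S \<mu> = gram (dimn B + 1) S \<mu> (feat B)"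
  unfolding V_def gram_def ..

lemma feat_carrier: "x \<in> carrier_vec (dimn B) \<Longrightarrow> feat B x \<in> carrier_vec (dimn B + 1)"
  unfolding feat_def by (intro append_carrier_vec) auto

lemma e_last_carrier: "e_last B \<in> carrier_vec (dimn B + 1)"
  unfolding e_last_def by simp

lemmas feature_carriers [simp] = feat_carrier e_last_carrier
  feat_carrier[unfolded Suc_eq_plus1[symmetric]] e_last_carrier[unfolded Suc_eq_plus1[symmetric]]

lemma gram_form_nonneg: "(\<And>x. x \<in> S \<Longrightarrow> 0 \<le> p x) \<Longrightarrow> 0 \<le> gram_form S p f a"
  unfolding gram_form_def by (intro sum_nonneg) auto

lemma range_var_form_iff:
  assumes "finite S" "S \<subseteq> carrier_vec (dimn B)" "\<And>x. x \<in> S \<Longrightarrow> 0 \<le> \<mu> x"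
    and "u \<in> carrier_vec (dimn B + 1)"
  shows "u \<in> mat_range (V B S \<mu>) \<and> var_form B S \<mu> u \<le> c \<longleftrightarrow>
    0 \<le> c \<and> (\<forall>a\<in>carrier_vec (dimn B + 1). (a \<bullet> u)\<^sup>2 \<le> c * gram_form S \<mu> (feat B) a)"
  unfolding var_form_def V_gram
  by (rule gram_range_iff) (use assms in auto)

text \<open>A G-optimal design is at least as good as the one of the Kiefer--Wolfowitz theorem.\<close>

lemma G_optimal_bound:
  assumes opt: "G_optimal B S \<pi>" and fin: "finite S" and ne: "S \<noteq> {}"
    and S: "S \<subseteq> carrier_vec (dimn B)"
    and x: "x \<in> S" and a: "a \<in> carrier_vec (dimn B + 1)"
  shows "(a \<bullet> feat B x)\<^sup>2 \<le> (real (dimn B) + 1) * gram_form S \<pi> (feat B) a"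
proof -
  define n where "n = dimn B + 1"
  have fc: "\<And>x. x \<in> S \<Longrightarrow> feat B x \<in> carrier_vec n" using S unfolding n_def by auto
  obtain p where p: "\<forall>x\<in>S. 0 \<le> p x" "sum p S = 1"
    "\<And>x a. x \<in> S \<Longrightarrow> a \<in> carrier_vec n \<Longrightarrow> (a \<bullet> feat B x)\<^sup>2 \<le> real n * gram_form S p (feat B) a"
    using kiefer_wolfowitz[OF fin ne, of n "feat B"] fc unfolding n_def by auto
  have pv: "feat B x \<in> mat_range (V B S p) \<and> var_form B S p (feat B x) \<le> real n" if "x \<in> S" for x
    using range_var_form_iff[OF fin S, of p "feat B x" "real n"] p fc that unfolding n_def by auto
  have "p \<in> G_feasible B S" unfolding G_feasible_def prob_on_def using p pv by auto
  then have "(MAX x\<in>S. var_form B S \<pi> (feat B x)) \<le> (MAX x\<in>S. var_form B S p (feat B x))"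
    using opt unfolding G_optimal_def by blast
  also have "\<dots> \<le> real n" using fin ne pv by (subst Max_le_iff) auto
  finally have "var_form B S \<pi> (feat B x) \<le> real n"
    using fin x by (subst (asm) Max_le_iff) auto
  moreover have "\<pi> \<in> G_feasible B S" using opt unfolding G_optimal_def by blast
  ultimately show ?thesis
    using range_var_form_iff[OF fin S, of \<pi> "feat B x" "real n"] x a fc
    unfolding G_feasible_def prob_on_def n_def by (auto simp: add.commute)
qed

lemma sum_nth_count_list:
  fixes g :: "'a \<Rightarrow> real"
  assumes "finite S" "set zs \<subseteq> S"
  shows "(\<Sum>j<length zs. g (zs ! j)) = (\<Sum>x\<in>S. real (count_list zs x) * g x)"
proof -
  have "(\<Sum>j<length zs. g (zs ! j)) = sum_list (map g zs)"
    by (simp add: sum_list_sum_nth atLeast0LessThan)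
  also have "\<dots> = (\<Sum>x\<in>S. real (count_list zs x) * g x)"
    using assms(2)
  proof (induction zs)
    case (Cons z zs)
    have "(\<Sum>x\<in>S. real (count_list (z # zs) x) * g x)
      = (\<Sum>x\<in>S. real (count_list zs x) * g x + (if x = z then g x else 0))"
      by (intro sum.cong) (auto simp: algebra_simps)
    then show ?case using Cons assms(1) by (simp add: sum.distrib sum.delta)
  qed simp
  finally show ?thesis .
qed

text \<open>Let \<open>M\<close> be the matrix of the block and \<open>u = M *\<^sub>v \<alpha>\<close>. The estimation error at \<open>u\<close> is the linear form
  in the noise with weights \<open>\<alpha> \<bullet> a\<close> for the successive features \<open>a\<close>, and the sum of the squared weights
  is \<open>\<alpha> \<bullet> (M *\<^sub>v \<alpha>)\<close>, which is the variance at \<open>u\<close>. The weights do not depend on the parameter or on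
  the noise.\<close>

lemma least_squares_error:
  assumes fin: "finite S" and S: "S \<subseteq> carrier_vec (dimn B)" and zs: "set zs \<subseteq> S"
    and \<mu>: "\<And>x. x \<in> S \<Longrightarrow> \<mu> x = count_list zs x"
    and u: "u \<in> carrier_vec (dimn B + 1)" and c: "0 \<le> c"
    and var: "\<And>a. a \<in> carrier_vec (dimn B + 1) \<Longrightarrow>
      (a \<bullet> u)\<^sup>2 \<le> c * gram_form S (\<lambda>x. real (\<mu> x)) (feat B) a"
  shows "\<exists>w :: nat \<Rightarrow> real. (\<Sum>j<length zs. (w j)\<^sup>2) \<le> c \<and>
    (\<forall>\<theta>\<in>carrier_vec (dimn B + 1). \<forall>\<eta>.
       u \<bullet> least_squares B S \<mu> (map (\<lambda>j. (zs ! j, feat B (zs ! j) \<bullet> \<theta> + \<eta> j)) [0..<length zs])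
       = u \<bullet> \<theta> + (\<Sum>j<length zs. w j * \<eta> j))"
proof -
  define n where "n = dimn B + 1"
  define p where "p = (\<lambda>x. real (\<mu> x))"
  define M where "M = V B S p"
  define G where "G = ginv M"
  define A where "A = (\<lambda>j. feat B (zs ! j))"
  define m where "m = length zs"
  have fc: "\<And>x. x \<in> S \<Longrightarrow> feat B x \<in> carrier_vec n" using S unfolding n_def by auto
  have A: "A j \<in> carrier_vec n" if "j < m" for j
  proof -
    have "zs ! j \<in> S" using that zs nth_mem[of j zs] unfolding m_def by blast
    then show ?thesis unfolding A_def by (rule fc)
  qed
  have M: "M \<in> carrier_mat n n" "M = gram n S p (feat B)" unfolding M_def V_gram n_def by auto
  have G: "G \<in> carrier_mat n n" using ginv[OF M(1)] unfolding G_def by simp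
  note iff = range_var_form_iff[OF fin S, of p, unfolded n_def[symmetric] M_def[symmetric]]
  have "u \<in> mat_range M \<and> var_form B S p u \<le> c"
    using iff[of u c] u c var unfolding p_def n_def by auto
  then obtain \<alpha> where \<alpha>: "\<alpha> \<in> carrier_vec n" "u = M *\<^sub>v \<alpha>"
    using M(1) unfolding mat_range_def by auto
  \<comment> \<open>a sampled feature lies in the range of \<open>M\<close>, where the generalized inverse has a definite value\<close>
  have "A j \<in> mat_range M" if j: "j < m" for j
  proof -
    have zj: "zs ! j \<in> S" "zs ! j \<in> set zs" using j zs unfolding m_def by auto
    then have "count_list zs (zs ! j) \<noteq> 0" by (simp add: count_list_0_iff)
    then have pz: "1 \<le> p (zs ! j)" unfolding p_def using \<mu>[OF zj(1)] by simp
    have "(a \<bullet> A j)\<^sup>2 \<le> 1 * gram_form S p (feat B) a" for a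
    proof -
      have "(a \<bullet> A j)\<^sup>2 \<le> p (zs ! j) * (a \<bullet> feat B (zs ! j))\<^sup>2"
        unfolding A_def using pz mult_right_mono[OF pz, of "(a \<bullet> feat B (zs ! j))\<^sup>2"] by simp
      also have "\<dots> \<le> gram_form S p (feat B) a"
        unfolding gram_form_def using fin zj by (intro member_le_sum) (auto simp: p_def)
      finally show ?thesis by simp
    qed
    then show ?thesis using iff[of "A j" 1] A[OF j] unfolding p_def by auto
  qed
  then have "\<forall>j<m. \<exists>b. b \<in> carrier_vec n \<and> A j = M *\<^sub>v b"
    using M(1) unfolding mat_range_def by auto
  then obtain \<beta> where \<beta>: "\<And>j. j < m \<Longrightarrow> \<beta> j \<in> carrier_vec n \<and> A j = M *\<^sub>v \<beta> j" by metis
  have uGA: "u \<bullet> (G *\<^sub>v A j) = \<alpha> \<bullet> A j" if j: "j < m" for j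
  proof -
    have "(M *\<^sub>v \<alpha>) \<bullet> (ginv M *\<^sub>v (M *\<^sub>v \<beta> j)) = \<alpha> \<bullet> (M *\<^sub>v \<beta> j)"
      unfolding M(2) by (rule gram_range_value) (use \<alpha> \<beta>[OF j] fc in auto)
    then show ?thesis using \<alpha> \<beta>[OF j] unfolding G_def by simp
  qed
  define w where "w = (\<lambda>j. \<alpha> \<bullet> A j)"
  have lin: "u \<bullet> (G *\<^sub>v vec n (\<lambda>i. \<Sum>j<m. y j * A j $ i)) = (\<Sum>j<m. y j * w j)" for y
  proof -
    define R where "R = vec n (\<lambda>i. \<Sum>j<m. y j * A j $ i)"
    define v where "v = transpose_mat G *\<^sub>v u"
    have v: "v \<in> carrier_vec n" unfolding v_def using G u by (auto simp: n_def)
    have vt: "v \<bullet> t = u \<bullet> (G *\<^sub>v t)" if t: "t \<in> carrier_vec n" for t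
      unfolding v_def using transpose_vec_mult_scalar[OF G t, of u] u t G
      by (metis comm_scalar_prod mult_mat_vec_carrier n_def transpose_carrier_mat)
    have "u \<bullet> (G *\<^sub>v R) = v \<bullet> R" unfolding R_def by (rule vt[symmetric]) simp
    also have "\<dots> = (\<Sum>i\<in>{0..<n}. v $ i * (\<Sum>j<m. y j * A j $ i))"
      unfolding R_def by (simp add: scalar_prod_def)
    also have "\<dots> = (\<Sum>j<m. \<Sum>i\<in>{0..<n}. v $ i * (y j * A j $ i))"
      unfolding sum_distrib_left by (rule sum.swap)
    also have "\<dots> = (\<Sum>j<m. y j * (v \<bullet> A j))"
      using A by (intro sum.cong refl) (auto simp: scalar_prod_def sum_distrib_left mult_ac dest!: carrier_vecD)
    also have "\<dots> = (\<Sum>j<m. y j * w j)"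
      using vt A uGA unfolding w_def by (intro sum.cong) auto
    finally show ?thesis unfolding R_def .
  qed
  have cnt: "(\<Sum>j<m. g (zs ! j)) = (\<Sum>x\<in>S. p x * g x)" for g
    unfolding m_def using sum_nth_count_list[OF fin zs, of g] \<mu> unfolding p_def by simp
  have "(\<Sum>j<m. (w j)\<^sup>2) \<le> c"
  proof -
    have e: "(\<Sum>j<m. (w j)\<^sup>2) = gram_form S p (feat B) \<alpha>"
      unfolding w_def A_def gram_form_def by (rule cnt)
    have "gram_form S p (feat B) \<alpha> = \<alpha> \<bullet> u"
      unfolding \<alpha>(2) M(2) by (rule gram_quadratic[symmetric]) (use \<alpha> fc in auto)
    then have "(gram_form S p (feat B) \<alpha>)\<^sup>2 \<le> c * gram_form S p (feat B) \<alpha>"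
      using var[of \<alpha>] \<alpha>(1) unfolding n_def p_def by simp
    moreover have "0 \<le> gram_form S p (feat B) \<alpha>" by (rule gram_form_nonneg) (simp add: p_def)
    ultimately show ?thesis unfolding e using c
      by (cases "gram_form S p (feat B) \<alpha> = 0") (simp_all add: power2_eq_square)
  qed
  moreover have "u \<bullet> least_squares B S \<mu> (map (\<lambda>j. (zs ! j, feat B (zs ! j) \<bullet> \<theta> + \<eta> j)) [0..<length zs])
       = u \<bullet> \<theta> + (\<Sum>j<length zs. w j * \<eta> j)" if \<theta>: "\<theta> \<in> carrier_vec n" for \<theta> \<eta>
  proof -
    define y where "y = (\<lambda>j. A j \<bullet> \<theta> + \<eta> j)"
    have "least_squares B S \<mu> (map (\<lambda>j. (zs ! j, feat B (zs ! j) \<bullet> \<theta> + \<eta> j)) [0..<length zs])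
      = G *\<^sub>v vec n (\<lambda>i. \<Sum>j<m. y j * A j $ i)"
      unfolding least_squares_def G_def M_def p_def n_def m_def y_def A_def
      by (simp add: sum_list_sum_nth atLeast0LessThan comp_def case_prod_beta)
    then have "u \<bullet> least_squares B S \<mu> (map (\<lambda>j. (zs ! j, feat B (zs ! j) \<bullet> \<theta> + \<eta> j)) [0..<length zs])
      = (\<Sum>j<m. y j * w j)"
      by (simp only: lin)
    also have "\<dots> = (\<Sum>j<m. (A j \<bullet> \<theta>) * w j) + (\<Sum>j<m. w j * \<eta> j)"
      unfolding y_def by (simp add: distrib_right sum.distrib mult.commute[of "\<eta> _"])
    also have "(\<Sum>j<m. (A j \<bullet> \<theta>) * w j) = (\<Sum>x\<in>S. p x * ((feat B x \<bullet> \<theta>) * (\<alpha> \<bullet> feat B x)))"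
      unfolding w_def A_def by (rule cnt[of "\<lambda>x. (feat B x \<bullet> \<theta>) * (\<alpha> \<bullet> feat B x)"])
    also have "\<dots> = (\<Sum>x\<in>S. p x * (\<alpha> \<bullet> feat B x) * (\<theta> \<bullet> feat B x))"
      using fc \<theta> by (intro sum.cong refl) (simp add: comm_scalar_prod[of _ n \<theta>])
    also have "\<dots> = \<theta> \<bullet> (M *\<^sub>v \<alpha>)"
      unfolding M(2) by (rule gram_bilinear[symmetric]) (use \<alpha> \<theta> fc in auto)
    also have "\<dots> = u \<bullet> \<theta>" using \<alpha> \<theta> u by (simp add: comm_scalar_prod[of \<theta> n] n_def)
    finally show ?thesis unfolding m_def .
  qed
  ultimately show ?thesis unfolding m_def n_def by blast
qed

lemma kappa_gap_optimal:
  assumes "gap_optimal B D \<mu>"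
  shows "kappa B D = (\<Sum>x\<in>acts B. \<mu> x * D x)"
  unfolding kappa_def by (rule cInf_eq_minimum) (use assms in \<open>auto simp: gap_optimal_def\<close>)

lemma kappa_nonneg:
  assumes "unit_variance_measures B \<noteq> {}" and "\<And>x. x \<in> acts B \<Longrightarrow> 0 \<le> D x"
  shows "0 \<le> kappa B D"
  unfolding kappa_def
  by (rule cINF_greatest) 
    (use assms in \<open>auto simp: unit_variance_measures_def bias_measures_def intro!: sum_nonneg mult_nonneg_nonneg\<close>)

lemma kappa_le_scale:
  assumes ne: "unit_variance_measures B \<noteq> {}" and r: "0 < r"
    and D: "\<And>x. x \<in> acts B \<Longrightarrow> 0 \<le> D x" and le: "\<And>x. x \<in> acts B \<Longrightarrow> D x \<le> r * D' x"
  shows "kappa B D \<le> r * kappa B D'"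
proof -
  have nn: "0 \<le> \<mu> x" if "\<mu> \<in> unit_variance_measures B" "x \<in> acts B" for \<mu> x
    using that unfolding unit_variance_measures_def bias_measures_def by auto
  have "kappa B D / r \<le> kappa B D'"
    unfolding kappa_def[of B D']
  proof (rule cINF_greatest[OF ne])
    fix \<mu> assume \<mu>: "\<mu> \<in> unit_variance_measures B"
    have "kappa B D \<le> (\<Sum>x\<in>acts B. \<mu> x * D x)" unfolding kappa_def
      by (rule cINF_lower[OF _ \<mu>]) (auto intro!: bdd_belowI[of _ 0] sum_nonneg mult_nonneg_nonneg dest: nn D)
    also have "\<dots> \<le> (\<Sum>x\<in>acts B. \<mu> x * (r * D' x))"
      by (intro sum_mono mult_left_mono le nn[OF \<mu>])
    also have "\<dots> = r * (\<Sum>x\<in>acts B. \<mu> x * D' x)" by (simp add: sum_distrib_left mult_ac)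
    finally show "kappa B D / r \<le> (\<Sum>x\<in>acts B. \<mu> x * D' x)" using r by (simp add: field_simps)
  qed
  then show ?thesis using r by (simp add: field_simps)
qed

lemma unit_variance_bound:
  assumes "\<mu> \<in> unit_variance_measures B" "finite (acts B)" "acts B \<subseteq> carrier_vec (dimn B)"
    and "a \<in> carrier_vec (dimn B + 1)"
  shows "(a \<bullet> e_last B)\<^sup>2 \<le> gram_form (acts B) \<mu> (feat B) a"
  using assms range_var_form_iff[of "acts B" B \<mu> "e_last B" 1]
  unfolding unit_variance_measures_def bias_measures_def by auto

section \<open>Gaussian noise and stopped blocks\<close>

interpretation gaussian: sequence_space "density lborel std_normal_density"
proof -
  interpret prob_space "density lborel std_normal_density" by (rule prob_space_normal_density) simp
  show "sequence_space (density lborel std_normal_density)" ..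
qed

lemma space_noise [simp]: "space noise = UNIV"
  by (simp add: noise_def space_PiM)

lemma noise_coordinate [measurable]: "(\<lambda>\<xi>. \<xi> t) \<in> borel_measurable noise"
proof -
  have "(\<lambda>\<xi>. \<xi> t) \<in> measurable noise (density lborel std_normal_density)"
    unfolding noise_def by (rule measurable_component_singleton) simp
  then show ?thesis by simp
qed

interpretation noise: prob_space noise
  unfolding noise_def by (rule gaussian.prob_space_axioms)

lemma std_normal_mgf:
  "(\<integral>\<^sup>+x. ennreal (exp (s * x)) \<partial>density lborel std_normal_density) = ennreal (exp (s\<^sup>2 / 2))"
proof -
  have eq: "std_normal_density x * exp (s * x) = exp (s\<^sup>2 / 2) * normal_density s 1 x" for x
  proof -
    have "- x\<^sup>2 / 2 + s * x = s\<^sup>2 / 2 + - (x - s)\<^sup>2 / 2"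
      by (simp add: power2_eq_square algebra_simps add_divide_distrib diff_divide_distrib)
    then have "exp (- x\<^sup>2 / 2) * exp (s * x) = exp (s\<^sup>2 / 2) * exp (- (x - s)\<^sup>2 / 2)"
      unfolding exp_add[symmetric] by simp
    then show ?thesis unfolding normal_density_def by simp
  qed
  have "(\<integral>\<^sup>+x. ennreal (exp (s * x)) \<partial>density lborel std_normal_density)
    = (\<integral>\<^sup>+x. ennreal (std_normal_density x) * ennreal (exp (s * x)) \<partial>lborel)"
    by (subst nn_integral_density) auto
  also have "\<dots> = (\<integral>\<^sup>+x. ennreal (exp (s\<^sup>2 / 2)) * ennreal (normal_density s 1 x) \<partial>lborel)"
    by (intro nn_integral_cong) (simp add: ennreal_mult[symmetric] eq)
  also have "\<dots> = ennreal (exp (s\<^sup>2 / 2)) * (\<integral>\<^sup>+x. ennreal (normal_density s 1 x) \<partial>lborel)"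
    by (rule nn_integral_cmult) simp
  also have "(\<integral>\<^sup>+x. ennreal (normal_density s 1 x) \<partial>lborel) = 1"
    by (subst nn_integral_eq_integral) auto
  finally show ?thesis by simp
qed

lemma noise_mgf:
  "(\<integral>\<^sup>+\<xi>. ennreal (exp (\<Sum>j<m. w j * \<xi> j)) \<partial>noise) = ennreal (exp ((\<Sum>j<m. (w j)\<^sup>2) / 2))"
proof -
  let ?N = "density lborel std_normal_density"
  define F where "F = (\<lambda>x :: nat \<Rightarrow> real. \<Prod>j\<in>{..<m}. ennreal (exp (w j * x j)))"
  have F: "F \<in> borel_measurable (\<Pi>\<^sub>M i\<in>{..<m}. ?N)"
  proof -
    have "(\<lambda>x. x j) \<in> borel_measurable (\<Pi>\<^sub>M i\<in>{..<m}. ?N)" if "j < m" for j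
      using measurable_component_singleton[of j "{..<m}" "\<lambda>_. ?N"] that by simp
    then show ?thesis unfolding F_def by (intro borel_measurable_prod_ennreal) auto
  qed
  have "(\<integral>\<^sup>+\<xi>. ennreal (exp (\<Sum>j<m. w j * \<xi> j)) \<partial>noise) = (\<integral>\<^sup>+\<xi>. F (restrict \<xi> {..<m}) \<partial>noise)"
    unfolding F_def by (intro nn_integral_cong) (simp add: exp_sum prod_ennreal)
  also have "\<dots> = (\<integral>\<^sup>+x. F x \<partial>distr noise (\<Pi>\<^sub>M i\<in>{..<m}. ?N) (\<lambda>\<xi>. restrict \<xi> {..<m}))"
    using F by (subst nn_integral_distr) (auto simp: noise_def)
  also have "\<dots> = (\<integral>\<^sup>+x. F x \<partial>(\<Pi>\<^sub>M i\<in>{..<m}. ?N))"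
    unfolding noise_def using gaussian.distr_PiM_restrict_finite[of "{..<m}"] by simp
  also have "\<dots> = (\<Prod>j\<in>{..<m}. \<integral>\<^sup>+x. ennreal (exp (w j * x)) \<partial>?N)"
    unfolding F_def by (rule gaussian.product_nn_integral_prod) auto
  also have "\<dots> = ennreal (exp ((\<Sum>j<m. (w j)\<^sup>2) / 2))"
    by (simp add: std_normal_mgf prod_ennreal exp_sum[symmetric] sum_divide_distrib)
  finally show ?thesis .
qed

text \<open>Chernoff's bound with the exponent \<open>s = 2 * L / \<epsilon>\<close>, which is nearly optimal in the only case of
  interest, \<open>c * (2 * L) = \<epsilon>\<^sup>2\<close>, and avoids a division by the variance.\<close>

lemma noise_upper_tail:
  assumes c: "(\<Sum>j<m. (w j)\<^sup>2) \<le> c" and \<epsilon>: "0 < \<epsilon>" and L: "0 \<le> L" and cL: "c * (2 * L) \<le> \<epsilon>\<^sup>2"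
  shows "noise.prob {\<xi>. (\<Sum>j<m. w j * \<xi> j) > \<epsilon>} \<le> exp (- L)"
proof -
  define s where "s = 2 * L / \<epsilon>"
  have s: "0 \<le> s" unfolding s_def using \<epsilon> L by simp
  have mg: "(\<lambda>\<xi>. ennreal (exp (\<Sum>j<m. (s * w j) * \<xi> j))) \<in> borel_measurable noise"
    by measurable
  have ms: "{\<xi>\<in>space noise. 1 \<le> ennreal (exp (- (s * \<epsilon>))) * ennreal (exp (\<Sum>j<m. (s * w j) * \<xi> j))} \<in> sets noise"
    by (intro borel_measurable_le borel_measurable_const borel_measurable_times_ennreal mg)
  have "emeasure noise {\<xi>. (\<Sum>j<m. w j * \<xi> j) > \<epsilon>}
    \<le> emeasure noise {\<xi>\<in>space noise. 1 \<le> ennreal (exp (- (s * \<epsilon>))) * ennreal (exp (\<Sum>j<m. (s * w j) * \<xi> j))}"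
  proof (rule emeasure_mono)
    show "{\<xi>. (\<Sum>j<m. w j * \<xi> j) > \<epsilon>} \<subseteq> {\<xi>\<in>space noise. 1 \<le> ennreal (exp (- (s * \<epsilon>))) * ennreal (exp (\<Sum>j<m. (s * w j) * \<xi> j))}"
    proof safe
      fix \<xi> :: "nat \<Rightarrow> real" assume "\<epsilon> < (\<Sum>j<m. w j * \<xi> j)"
      then have "s * \<epsilon> \<le> s * (\<Sum>j<m. w j * \<xi> j)" using s by (intro mult_left_mono) auto
      then have "1 \<le> exp (- (s * \<epsilon>) + (\<Sum>j<m. (s * w j) * \<xi> j))"
        by (simp add: sum_distrib_left mult.assoc)
      then show "1 \<le> ennreal (exp (- (s * \<epsilon>))) * ennreal (exp (\<Sum>j<m. (s * w j) * \<xi> j))"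
        by (simp add: ennreal_mult[symmetric] exp_add[symmetric])
    qed simp
  qed (rule ms)
  also have "\<dots> \<le> ennreal (exp (- (s * \<epsilon>))) * (\<integral>\<^sup>+\<xi>. ennreal (exp (\<Sum>j<m. (s * w j) * \<xi> j)) * indicator (space noise) \<xi> \<partial>noise)"
    by (rule nn_integral_Markov_inequality) (use mg in \<open>auto simp del: space_noise intro!: borel_measurable_times_ennreal\<close>)
  also have "\<dots> = ennreal (exp (- (s * \<epsilon>))) * ennreal (exp ((\<Sum>j<m. (s * w j)\<^sup>2) / 2))"
    by (simp add: noise_mgf)
  also have "\<dots> = ennreal (exp (- (s * \<epsilon>) + (\<Sum>j<m. (s * w j)\<^sup>2) / 2))"
    by (simp add: ennreal_mult[symmetric] exp_add[symmetric])
  also have "\<dots> \<le> ennreal (exp (- L))"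
  proof -
    have "(\<Sum>j<m. (s * w j)\<^sup>2) = s\<^sup>2 * (\<Sum>j<m. (w j)\<^sup>2)"
      by (simp add: power_mult_distrib sum_distrib_left)
    also have "\<dots> \<le> s\<^sup>2 * c" using c by (intro mult_left_mono) auto
    also have "\<dots> = (c * (2 * L)) * (2 * L / \<epsilon>\<^sup>2)" unfolding s_def by (simp add: power2_eq_square)
    also have "\<dots> \<le> \<epsilon>\<^sup>2 * (2 * L / \<epsilon>\<^sup>2)" using cL L by (intro mult_right_mono) auto
    also have "\<dots> = 2 * L" using \<epsilon> by simp
    finally have "- (s * \<epsilon>) + (\<Sum>j<m. (s * w j)\<^sup>2) / 2 \<le> - L" unfolding s_def using \<epsilon> by simp
    then show ?thesis by (simp add: ennreal_leI)
  qed
  finally show ?thesis by (simp add: noise.emeasure_eq_measure)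
qed

lemma noise_tail:
  assumes c: "(\<Sum>j<m. (w j)\<^sup>2) \<le> c" and \<epsilon>: "0 < \<epsilon>" and L: "0 \<le> L" and cL: "c * (2 * L) \<le> \<epsilon>\<^sup>2"
  shows "noise.prob {\<xi>. \<bar>\<Sum>j<m. w j * \<xi> j\<bar> > \<epsilon>} \<le> 2 * exp (- L)"
proof -
  let ?A = "{\<xi>. (\<Sum>j<m. w j * \<xi> j) > \<epsilon>}" and ?B = "{\<xi>. (\<Sum>j<m. (- w j) * \<xi> j) > \<epsilon>}"
  have m: "{\<xi>\<in>space noise. (\<Sum>j<m. v j * \<xi> j) > \<epsilon>} \<in> sets noise" for v :: "nat \<Rightarrow> real"
    by measurable
  have "{\<xi>. \<bar>\<Sum>j<m. w j * \<xi> j\<bar> > \<epsilon>} = ?A \<union> ?B" by (auto simp: sum_negf abs_if)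
  then have "noise.prob {\<xi>. \<bar>\<Sum>j<m. w j * \<xi> j\<bar> > \<epsilon>} \<le> noise.prob ?A + noise.prob ?B"
    using measure_Un_le[OF m[of w] m[of "\<lambda>j. - w j"]] by simp
  also have "\<dots> \<le> exp (- L) + exp (- L)"
    by (intro add_mono noise_upper_tail[OF _ \<epsilon> L cL]) (use c in auto)
  finally show ?thesis by simp
qed

definition future :: "nat \<Rightarrow> (nat \<Rightarrow> real) \<Rightarrow> nat \<Rightarrow> real" where
  "future t \<xi> = (\<lambda>j. \<xi> (t + j))"

lemma measurable_future: "future t \<in> measurable noise noise"
  unfolding noise_def future_def
proof (rule measurable_PiM_single')
  fix j :: nat
  show "(\<lambda>\<xi>. \<xi> (t + j)) \<in> measurable (\<Pi>\<^sub>M t\<in>UNIV. density lborel std_normal_density) (density lborel std_normal_density)"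
    by (rule measurable_component_singleton) simp
qed (auto simp: space_PiM)

text \<open>Two independent noise sequences, the second one put after the first \<open>t\<close> terms of the first one, form
  again a noise sequence. It belongs to \<open>A\<close> if and only if the first one does, and its future is the second one.\<close>

lemma past_future_independent:
  assumes A: "A \<in> sets noise" and D: "D \<in> sets noise"
    and loc: "\<And>\<xi> \<xi>'. \<xi> \<in> A \<Longrightarrow> (\<And>j. j < t \<Longrightarrow> \<xi> j = \<xi>' j) \<Longrightarrow> \<xi>' \<in> A"
  shows "noise.prob {\<xi>\<in>A. future t \<xi> \<in> D} = noise.prob A * noise.prob D"
proof -
  let ?E = "{\<xi>\<in>A. future t \<xi> \<in> D}"
  have E: "?E \<in> sets noise"
  proof -
    have "?E = A \<inter> (future t -` D \<inter> space noise)" by auto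
    then show ?thesis using A measurable_sets[OF measurable_future D] by auto
  qed
  have comb: "(\<lambda>(\<omega>, \<omega>'). comb_seq t \<omega> \<omega>') \<in> measurable (noise \<Otimes>\<^sub>M noise) noise"
    unfolding noise_def by (rule measurable_comb_seq)
  have distr: "distr (noise \<Otimes>\<^sub>M noise) noise (\<lambda>(\<omega>, \<omega>'). comb_seq t \<omega> \<omega>') = noise"
    unfolding noise_def by (rule gaussian.PiM_comb_seq)
  have inA: "comb_seq t \<omega> \<omega>' \<in> A \<longleftrightarrow> \<omega> \<in> A" for \<omega> \<omega>'
    using loc[of "comb_seq t \<omega> \<omega>'" \<omega>] loc[of \<omega> "comb_seq t \<omega> \<omega>'"] by (auto simp: comb_seq_less)
  have sh: "future t (comb_seq t \<omega> \<omega>') = \<omega>'" for \<omega> \<omega>' :: "nat \<Rightarrow> real"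
    unfolding future_def comb_seq_def by auto
  have "emeasure noise ?E = emeasure (distr (noise \<Otimes>\<^sub>M noise) noise (\<lambda>(\<omega>, \<omega>'). comb_seq t \<omega> \<omega>')) ?E"
    by (simp only: distr)
  also have "\<dots> = emeasure (noise \<Otimes>\<^sub>M noise) ((\<lambda>(\<omega>, \<omega>'). comb_seq t \<omega> \<omega>') -` ?E \<inter> space (noise \<Otimes>\<^sub>M noise))"
    by (rule emeasure_distr[OF comb E])
  also have "(\<lambda>(\<omega>, \<omega>'). comb_seq t \<omega> \<omega>') -` ?E \<inter> space (noise \<Otimes>\<^sub>M noise) = A \<times> D"
    by (auto simp: inA sh space_pair_measure)
  also have "emeasure (noise \<Otimes>\<^sub>M noise) (A \<times> D) = emeasure noise A * emeasure noise D"
    using noise.emeasure_pair_measure_Times[OF A D] .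
  finally show ?thesis by (simp add: noise.emeasure_eq_measure ennreal_mult[symmetric])
qed

text \<open>The value \<open>i\<close> of \<open>g\<close> contains what is known when a block begins, in particular its first round \<open>t i\<close>,
  which makes \<open>t (g \<xi>)\<close> a stopping time. Given \<open>g \<xi> = i\<close>, the block is a fixed
  one and its noise is independent of the past, so a bound on the probability of a bad block that is
  uniform in \<open>i\<close> survives.\<close>

lemma stopped_block_bound:
  fixes g :: "(nat \<Rightarrow> real) \<Rightarrow> 'i"
  assumes fin: "finite I"
    and meas: "\<And>i. i \<in> I \<Longrightarrow> {\<xi>. g \<xi> = i} \<in> sets noise"
    and loc: "\<And>i \<xi> \<xi>'. i \<in> I \<Longrightarrow> g \<xi> = i \<Longrightarrow> (\<And>j. j < t i \<Longrightarrow> \<xi> j = \<xi>' j) \<Longrightarrow> g \<xi>' = i"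
    and D: "\<And>i. i \<in> I \<Longrightarrow> D i \<in> sets noise" and p: "\<And>i. i \<in> I \<Longrightarrow> noise.prob (D i) \<le> p"
    and p0: "0 \<le> p"
  shows "{\<xi>. g \<xi> \<in> I \<and> future (t (g \<xi>)) \<xi> \<in> D (g \<xi>)} \<in> sets noise \<and>
    noise.prob {\<xi>. g \<xi> \<in> I \<and> future (t (g \<xi>)) \<xi> \<in> D (g \<xi>)} \<le> p"
proof -
  let ?A = "\<lambda>i. {\<xi>. g \<xi> = i}"
  let ?E = "\<lambda>i. {\<xi> \<in> ?A i. future (t i) \<xi> \<in> D i}"
  have E: "?E i \<in> sets noise" if "i \<in> I" for i
  proof -
    have "?E i = ?A i \<inter> (future (t i) -` D i \<inter> space noise)" by auto
    then show ?thesis using meas[OF that] measurable_sets[OF measurable_future D[OF that]] by auto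
  qed
  have eq: "{\<xi>. g \<xi> \<in> I \<and> future (t (g \<xi>)) \<xi> \<in> D (g \<xi>)} = (\<Union>i\<in>I. ?E i)" by auto
  have "noise.prob (\<Union>i\<in>I. ?E i) \<le> (\<Sum>i\<in>I. noise.prob (?E i))"
    by (rule noise.finite_measure_subadditive_finite[OF fin]) (use E in auto)
  also have "\<dots> = (\<Sum>i\<in>I. noise.prob (?A i) * noise.prob (D i))"
  proof (intro sum.cong refl past_future_independent meas D)
    fix i \<xi> \<xi>' assume "i \<in> I" "\<xi> \<in> ?A i" "\<And>j. j < t i \<Longrightarrow> \<xi> j = \<xi>' j"
    then show "\<xi>' \<in> ?A i" using loc[of i \<xi> \<xi>'] by blast
  qed
  also have "\<dots> \<le> (\<Sum>i\<in>I. noise.prob (?A i) * p)"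
    by (intro sum_mono mult_left_mono p) auto
  also have "\<dots> = noise.prob (\<Union>i\<in>I. ?A i) * p"
    by (subst noise.finite_measure_finite_Union[OF fin])
      (use meas in \<open>auto simp: disjoint_family_on_def sum_distrib_right\<close>)
  also have "\<dots> \<le> 1 * p" by (intro mult_right_mono p0) auto
  finally have "noise.prob (\<Union>i\<in>I. ?E i) \<le> p" by simp
  moreover have "(\<Union>i\<in>I. ?E i) \<in> sets noise" using E fin by (intro sets.finite_UN) auto
  ultimately show ?thesis unfolding eq by simp
qed

section \<open>Invariants and locality of the states\<close>

text \<open>The sample sizes, updates and tests of the two steps of a phase, extracted from the nested
  definitions of the algorithm.\<close>

definition group_count :: "arm_set \<Rightarrow> choices \<Rightarrow> real \<Rightarrow> nat \<Rightarrow> rvec set \<Rightarrow> rvec \<Rightarrow> nat" where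
  "group_count B c \<delta> l S = (\<lambda>x. if x \<in> S
     then nat \<lceil>2 * (real (dimn B) + 1) * g_design c l S x / (eps l)\<^sup>2
                * ln (real (card (acts B)) * real l * (real l + 1) / \<delta>)\<rceil>
     else 0)"

definition bias_count :: "arm_set \<Rightarrow> choices \<Rightarrow> real \<Rightarrow> nat \<Rightarrow> (rvec \<Rightarrow> real) \<Rightarrow> rvec \<Rightarrow> nat" where
  "bias_count B c \<delta> l D = (\<lambda>x. if x \<in> acts B
     then nat \<lceil>2 * gap_design c l D x / (eps l)\<^sup>2 * ln (real l * (real l + 1) / \<delta>)\<rceil>
     else 0)"

definition group_update :: "arm_set \<Rightarrow> nat \<Rightarrow> int \<Rightarrow> rvec set \<Rightarrow> rvec \<Rightarrow> history \<Rightarrow> fpe_state \<Rightarrow> fpe_state" where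
  "group_update B l z S \<theta> h s = s\<lparr>hist := h,
     cand := (cand s)(z := {x \<in> S. (MAX x'\<in>S. (feat B x' - feat B x) \<bullet> \<theta>) \<le> 3 * eps l}),
     est := (est s)(z := \<theta>)\<rparr>"

definition bias_estimate :: "arm_set \<Rightarrow> (int \<Rightarrow> rvec) \<Rightarrow> real \<Rightarrow> rvec \<Rightarrow> real" where
  "bias_estimate B E w x = feat B x \<bullet> E (grp B x) - of_int (grp B x) * w"

definition group_wins :: "nat \<Rightarrow> (int \<Rightarrow> rvec set) \<Rightarrow> (rvec \<Rightarrow> real) \<Rightarrow> int \<Rightarrow> bool" where
  "group_wins l C m z \<longleftrightarrow> (MAX x\<in>C z. m x) - 2 * eps l \<ge> (MAX x\<in>C (- z). m x) + 2 * eps l"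

definition bias_update :: "nat \<Rightarrow> (rvec \<Rightarrow> real) \<Rightarrow> history \<Rightarrow> fpe_state \<Rightarrow> fpe_state" where
  "bias_update l m h s = s\<lparr>hist := h,
     best_grp := (if group_wins l (cand s) m 1 then 1 else if group_wins l (cand s) m (-1) then -1 else 0),
     est_gap := (\<lambda>x. if x \<in> cand s (-1) \<union> cand s 1
        then min 2 ((MAX x'\<in>cand s (-1) \<union> cand s 1. m x') - m x + 4 * eps l) else est_gap s x)\<rparr>"

lemma group_step_unfold:
  "group_step B c \<delta> T obs l z s =
    (if z = - best_grp s then s
     else if length (hist s) + sum (group_count B c \<delta> l (cand s z)) (cand s z) \<le> T then
       (let blk = play obs (hist s) (schedule c l (group_count B c \<delta> l (cand s z)))
        in group_update B l z (cand s z)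
             (least_squares B (cand s z) (group_count B c \<delta> l (cand s z)) blk) (hist s @ blk) s)
     else exhaust c T obs (cand s z) s)"
  unfolding group_step_def group_update_def Let_def group_count_def by simp

definition recovers :: "arm_set \<Rightarrow> nat \<Rightarrow> nat \<Rightarrow> (rvec \<Rightarrow> real) \<Rightarrow> bool" where
  "recovers B T l D \<longleftrightarrow> eps l \<le> root 3 (kappa B D * ln (real T) / real T)"

lemma bias_step_unfold:
  "bias_step B c \<delta> T obs l s =
    (if best_grp s \<noteq> 0 then s
     else if recovers B T l (est_gap s) \<or>
        T < length (hist s) + sum (bias_count B c \<delta> l (est_gap s)) (acts B)
       then exhaust c T obs (cand s (-1) \<union> cand s 1) s
     else
       (let blk = play obs (hist s) (schedule c l (bias_count B c \<delta> l (est_gap s)));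
            w = e_last B \<bullet> least_squares B (acts B) (bias_count B c \<delta> l (est_gap s)) blk
        in bias_update l (bias_estimate B (est s) w) (hist s @ blk) s))"
  unfolding bias_step_def bias_update_def Let_def bias_count_def recovers_def
    bias_estimate_def group_wins_def by simp

lemma length_play [simp]: "length (play obs h zs) = length zs"
  by (simp add: play_def)

lemma map_fst_play [simp]: "map fst (play obs h zs) = zs"
  by (simp add: play_def map_nth comp_def)

lemma play_append: "length h' = length h + length ys \<Longrightarrow> play obs h (ys @ zs) = play obs h ys @ play obs h' zs"
  by (rule nth_equalityI) (auto simp: play_def nth_append)

lemma play_Nil [simp]: "play obs h [] = []"
  by (simp add: play_def)

lemma play_cong:
  assumes "length h = length h'"
    and "\<And>t x. length h \<le> t \<Longrightarrow> t < length h + length zs \<Longrightarrow> obs t x = obs' t x"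
  shows "play obs h zs = play obs' h' zs"
  unfolding play_def using assms by auto

lemma eps_pos [simp]: "0 < eps l"
  unfolding eps_def by simp

lemma eps_nonzero [simp]: "eps l \<noteq> 0"
  using eps_pos[of l] by linarith

lemma hist_exhaust [simp]: "hist (exhaust c T obs S s) = hist s @
     play obs (hist s) (replicate (T - length (hist s)) (emp_best c (hist s) S))"
  by (simp add: exhaust_def)

lemma exhaust_select [simp]: "cand (exhaust c T obs S s) = cand s" "est (exhaust c T obs S s) = est s"
  "best_grp (exhaust c T obs S s) = best_grp s" "est_gap (exhaust c T obs S s) = est_gap s"
  by (simp_all add: exhaust_def)

lemma group_update_select [simp]:
  "hist (group_update B l z S \<theta> h s) = h" "est (group_update B l z S \<theta> h s) = (est s)(z := \<theta>)"
  "best_grp (group_update B l z S \<theta> h s) = best_grp s" "est_gap (group_update B l z S \<theta> h s) = est_gap s"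
  "cand (group_update B l z S \<theta> h s) =
     (cand s)(z := {x \<in> S. (MAX x'\<in>S. (feat B x' - feat B x) \<bullet> \<theta>) \<le> 3 * eps l})"
  by (simp_all add: group_update_def)

lemma bias_update_select [simp]:
  "hist (bias_update l m h s) = h" "est (bias_update l m h s) = est s" "cand (bias_update l m h s) = cand s"
  "best_grp (bias_update l m h s) =
    (if group_wins l (cand s) m 1 then 1 else if group_wins l (cand s) m (-1) then -1 else 0)"
  "est_gap (bias_update l m h s) = (\<lambda>x. if x \<in> cand s (-1) \<union> cand s 1
        then min 2 ((MAX x'\<in>cand s (-1) \<union> cand s 1. m x') - m x + 4 * eps l) else est_gap s x)"
  by (simp_all add: bias_update_def)

lemma least_squares_carrier: "least_squares B S \<mu> h \<in> carrier_vec (dimn B + 1)"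
proof -
  have "ginv (V B S (\<lambda>x. real (\<mu> x))) \<in> carrier_mat (dimn B + 1) (dimn B + 1)"
    by (rule ginv(1)) (simp add: V_gram)
  then show ?thesis unfolding least_squares_def by (auto intro!: mult_mat_vec_carrier)
qed

locale bandit_run =
  fixes B :: arm_set and \<gamma> :: rvec and \<omega> :: real and c :: choices and T :: nat
  assumes bandit: "biased_bandit B \<gamma>" and choices: "valid_choices B c" and T_pos: "1 \<le> T"
begin

abbreviation "n \<equiv> dimn B + 1"
abbreviation "\<delta> \<equiv> 1 / real T"
abbreviation "obs \<equiv> observe B \<gamma> \<omega>"
abbreviation "gstep \<equiv> \<lambda>\<xi> l z s. group_step B c \<delta> T (obs \<xi>) l z s"
abbreviation "bstep \<equiv> \<lambda>\<xi> l s. bias_step B c \<delta> T (obs \<xi>) l s"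
abbreviation "gcount \<equiv> group_count B c \<delta>"
abbreviation "bcount \<equiv> bias_count B c \<delta>"

lemma finite_acts [simp]: "finite (acts B)" and acts_carrier: "acts B \<subseteq> carrier_vec (dimn B)"
  and grp_values: "x \<in> acts B \<Longrightarrow> grp B x = -1 \<or> grp B x = 1"
  and group_nonempty: "z \<in> {-1, 1} \<Longrightarrow> {x \<in> acts B. grp B x = z} \<noteq> {}"
  and \<gamma>_carrier: "\<gamma> \<in> carrier_vec (dimn B)"
  using bandit unfolding biased_bandit_def by auto

lemma acts_nonempty: "acts B \<noteq> {}"
  using group_nonempty[of 1] by auto

lemma card_acts: "2 \<le> card (acts B)"
proof -
  obtain x y where "x \<in> acts B" "grp B x = 1" "y \<in> acts B" "grp B y = -1"
    using group_nonempty[of 1] group_nonempty[of "-1"] by auto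
  then have "x \<noteq> y" "{x, y} \<subseteq> acts B" by auto
  then show ?thesis using card_mono[of "acts B" "{x, y}"] by simp
qed

lemma group_log_pos:
  assumes "1 \<le> l" shows "0 < ln (real (card (acts B)) * real l * (real l + 1) / \<delta>)"
    and "0 < ln (real l * (real l + 1) / \<delta>)"
proof -
  have 1: "2 \<le> real l * (real l + 1)" using assms mult_mono[of 1 "real l" 2 "real l + 1"] by simp
  then have 2: "2 \<le> real l * (real l + 1) * real T"
    using T_pos mult_mono[of 2 "real l * (real l + 1)" 1 "real T"] by simp
  then show "0 < ln (real l * (real l + 1) / \<delta>)" by simp
  have "2 * 2 \<le> real (card (acts B)) * (real l * (real l + 1) * real T)"
    using 2 card_acts by (intro mult_mono) auto
  then show "0 < ln (real (card (acts B)) * real l * (real l + 1) / \<delta>)" by (simp add: mult.assoc)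
qed

lemmas choices_rest = choices[unfolded valid_choices_def, THEN conjunct2]

lemma group_order_values: "group_order c l = [-1, 1] \<or> group_order c l = [1, -1]"
  using choices[unfolded valid_choices_def, THEN conjunct1] by blast

lemma g_design_optimal: "S \<noteq> {} \<Longrightarrow> S \<subseteq> acts B \<Longrightarrow> G_optimal B S (g_design c l S)"
  and g_design_support: "S \<noteq> {} \<Longrightarrow> S \<subseteq> acts B \<Longrightarrow>
    real (card {x \<in> S. g_design c l S x \<noteq> 0}) \<le> (real (dimn B) + 1) * (real (dimn B) + 2) / 2"
  using choices_rest[THEN conjunct1] by blast+

lemma gap_design_optimal: "(\<And>x. x \<in> acts B \<Longrightarrow> 0 < D x) \<Longrightarrow> gap_optimal B D (gap_design c l D)"
  and gap_design_support: "(\<And>x. x \<in> acts B \<Longrightarrow> 0 < D x) \<Longrightarrow>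
    card {x \<in> acts B. gap_design c l D x \<noteq> 0} \<le> dimn B + 1"
  using choices_rest[THEN conjunct2, THEN conjunct1] by blast+

lemma gap_design_measurable: "x \<in> acts B \<Longrightarrow>
    (\<lambda>D. gap_design c l D x) \<in> borel_measurable (\<Pi>\<^sub>M x\<in>acts B. (borel :: real measure))"
  using choices_rest[THEN conjunct2, THEN conjunct2, THEN conjunct1] by blast

lemma schedule_count: "{x. \<mu> x \<noteq> 0} \<subseteq> acts B \<Longrightarrow> count_list (schedule c l \<mu>) x = \<mu> x"
  using choices_rest[THEN conjunct2, THEN conjunct2, THEN conjunct2, THEN conjunct1] by blast

lemma emp_best_in: "S \<noteq> {} \<Longrightarrow> S \<subseteq> acts B \<Longrightarrow> emp_best c h S \<in> S"
  using choices_rest[THEN conjunct2, THEN conjunct2, THEN conjunct2, THEN conjunct2, THEN conjunct1] by blast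

lemma emp_best_measurable: "S \<noteq> {} \<Longrightarrow> S \<subseteq> acts B \<Longrightarrow> set ys \<subseteq> acts B \<Longrightarrow>
    (\<lambda>y. emp_best c (map (\<lambda>i. (ys ! i, y i)) [0..<length ys]) S)
      \<in> measurable (\<Pi>\<^sub>M i\<in>{..<length ys}. (borel :: real measure)) (count_space UNIV)"
  using choices_rest[THEN conjunct2, THEN conjunct2, THEN conjunct2, THEN conjunct2, THEN conjunct2] by blast

lemma schedule_facts:
  assumes S: "S \<subseteq> acts B" and \<mu>: "{x. \<mu> x \<noteq> 0} \<subseteq> S"
  shows "set (schedule c l \<mu>) \<subseteq> S" "length (schedule c l \<mu>) = sum \<mu> S"
proof -
  note cnt = schedule_count[of \<mu> l]
  have \<mu>': "{x. \<mu> x \<noteq> 0} \<subseteq> acts B" using \<mu> S by blast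
  show 1: "set (schedule c l \<mu>) \<subseteq> S"
  proof
    fix x assume "x \<in> set (schedule c l \<mu>)"
    then have "count_list (schedule c l \<mu>) x \<noteq> 0" by (simp add: count_list_0_iff)
    then show "x \<in> S" using cnt[OF \<mu>'] \<mu> by auto
  qed
  have "(\<Sum>j<length (schedule c l \<mu>). 1 :: real) = (\<Sum>x\<in>S. real (count_list (schedule c l \<mu>) x) * 1)"
    by (rule sum_nth_count_list) (use 1 S finite_subset[OF S] in auto)
  then have "real (length (schedule c l \<mu>)) = real (sum \<mu> S)" by (simp add: cnt[OF \<mu>'])
  then show "length (schedule c l \<mu>) = sum \<mu> S" by (simp only: of_nat_eq_iff)
qed

lemma gcount_support: "{x. gcount l S x \<noteq> 0} \<subseteq> S"
  unfolding group_count_def by auto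

lemma bcount_support: "{x. bcount l D x \<noteq> 0} \<subseteq> acts B"
  unfolding bias_count_def by auto

lemma gcount_ge:
  "x \<in> S \<Longrightarrow> 2 * real n * g_design c l S x / (eps l)\<^sup>2
     * ln (real (card (acts B)) * real l * (real l + 1) / \<delta>) \<le> real (gcount l S x)"
  unfolding group_count_def by (simp add: add.commute) (rule real_nat_ceiling_ge)

lemma bcount_ge:
  "x \<in> acts B \<Longrightarrow> 2 * gap_design c l D x / (eps l)\<^sup>2 * ln (real l * (real l + 1) / \<delta>)
     \<le> real (bcount l D x)"
  unfolding bias_count_def by simp (rule real_nat_ceiling_ge)

lemma unit_variance_nonempty: "unit_variance_measures B \<noteq> {}"
  using gap_design_optimal[of "\<lambda>_. 1"] unfolding gap_optimal_def by auto

text \<open>Positive sample sizes ensure that no step samples once the horizon is reached.\<close>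

lemma gcount_sum_pos:
  assumes "1 \<le> l" "S \<noteq> {}" "S \<subseteq> acts B" shows "0 < sum (gcount l S) S"
proof -
  have fin: "finite S" using finite_subset[OF assms(3)] by simp
  have p: "prob_on S (g_design c l S)"
    using g_design_optimal[OF assms(2,3)] unfolding G_optimal_def G_feasible_def by blast
  then obtain x where x: "x \<in> S" "g_design c l S x \<noteq> 0" unfolding prob_on_def
    by (metis sum.neutral zero_neq_one)
  then have "0 < g_design c l S x" using p unfolding prob_on_def by (simp add: order_less_le)
  then have "0 < 2 * real n * g_design c l S x / (eps l)\<^sup>2
     * ln (real (card (acts B)) * real l * (real l + 1) / \<delta>)"
    using group_log_pos(1)[OF assms(1)] by (intro mult_pos_pos divide_pos_pos) auto
  then have "0 < real (gcount l S x)" using gcount_ge[OF x(1), of l] by linarith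
  then have "0 < gcount l S x" by simp
  also have "\<dots> \<le> sum (gcount l S) S" by (rule member_le_sum) (use x fin in auto)
  finally show ?thesis .
qed

lemma bcount_sum_pos:
  assumes "1 \<le> l" "\<And>x. x \<in> acts B \<Longrightarrow> 0 < D x" shows "0 < sum (bcount l D) (acts B)"
proof -
  have uv: "gap_design c l D \<in> unit_variance_measures B"
    using gap_design_optimal[of D l] assms(2) unfolding gap_optimal_def by blast
  then have nn: "\<And>x. x \<in> acts B \<Longrightarrow> 0 \<le> gap_design c l D x"
    unfolding unit_variance_measures_def bias_measures_def by auto
  have "\<exists>x\<in>acts B. gap_design c l D x \<noteq> 0"
  proof (rule ccontr)
    assume z: "\<not> (\<exists>x\<in>acts B. gap_design c l D x \<noteq> 0)"
    have "(e_last B \<bullet> e_last B)\<^sup>2 \<le> gram_form (acts B) (gap_design c l D) (feat B) (e_last B)"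
      by (rule unit_variance_bound[OF uv]) (use acts_carrier in auto)
    also have "\<dots> = 0" unfolding gram_form_def using z by (intro sum.neutral) auto
    finally show False by (simp add: e_last_def)
  qed
  then obtain x where x: "x \<in> acts B" "gap_design c l D x \<noteq> 0" by blast
  then have "0 < gap_design c l D x" using nn by (simp add: order_less_le)
  then have "0 < 2 * gap_design c l D x / (eps l)\<^sup>2 * ln (real l * (real l + 1) / \<delta>)"
    using group_log_pos(2)[OF assms(1)] by (intro mult_pos_pos divide_pos_pos) auto
  then have "0 < real (bcount l D x)" using bcount_ge[OF x(1), of l D] by linarith
  then have "0 < bcount l D x" by simp
  also have "\<dots> \<le> sum (bcount l D) (acts B)" by (rule member_le_sum) (use x in auto)
  finally show ?thesis .
qed

text \<open>The observations are a function of the actions and the noise. This reduces the measurability of the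
  history to that of the list of actions.\<close>

definition consistent :: "(nat \<Rightarrow> real) \<Rightarrow> history \<Rightarrow> bool" where
  "consistent \<xi> h \<longleftrightarrow> h = play (obs \<xi>) [] (map fst h)"

definition valid_state :: "(nat \<Rightarrow> real) \<Rightarrow> fpe_state \<Rightarrow> bool" where
  "valid_state \<xi> s \<longleftrightarrow>
     (\<forall>z\<in>{-1, 1}. cand s z \<noteq> {} \<and> cand s z \<subseteq> {x \<in> acts B. grp B x = z}) \<and>
     consistent \<xi> (hist s) \<and>
     set (map fst (hist s)) \<subseteq> acts B \<and> length (hist s) \<le> T \<and> best_grp s \<in> {-1, 0, 1} \<and>
     (\<forall>x\<in>acts B. 0 < est_gap s x) \<and> est_gap s \<in> extensional (acts B) \<and>
     (\<forall>z\<in>{-1, 1}. est s z \<in> carrier_vec n)"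

lemma valid_init: "valid_state \<xi> (fpe_init B)"
  unfolding valid_state_def fpe_init_def consistent_def using group_nonempty by auto

lemma valid_append:
  assumes "valid_state \<xi> s" and "set zs \<subseteq> acts B" and "length (hist s) + length zs \<le> T"
    and "hist s' = hist s @ play (obs \<xi>) (hist s) zs"
  shows "consistent \<xi> (hist s') \<and> set (map fst (hist s')) \<subseteq> acts B \<and> length (hist s') \<le> T"
proof -
  have "play (obs \<xi>) [] (map fst (hist s) @ zs) = play (obs \<xi>) [] (map fst (hist s)) @ play (obs \<xi>) (hist s) zs"
    by (rule play_append) simp
  then have "consistent \<xi> (hist s')"
    using assms(1,4) unfolding valid_state_def consistent_def by (metis map_append map_fst_play)
  then show ?thesis using assms unfolding valid_state_def by auto
qed

lemma valid_exhaust: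
  assumes v: "valid_state \<xi> s" and S: "S \<noteq> {}" "S \<subseteq> acts B"
  shows "valid_state \<xi> (exhaust c T (obs \<xi>) S s)"
proof -
  have "set (replicate (T - length (hist s)) (emp_best c (hist s) S)) \<subseteq> acts B"
    using emp_best_in[OF S] S by (auto simp: set_replicate_conv_if)
  from valid_append[OF v this _ hist_exhaust] v show ?thesis unfolding valid_state_def by auto
qed

lemma cand_update_nonempty:
  assumes S: "finite S" "S \<noteq> {}" "S \<subseteq> acts B" and \<theta>: "\<theta> \<in> carrier_vec n"
  shows "{x \<in> S. (MAX x'\<in>S. (feat B x' - feat B x) \<bullet> \<theta>) \<le> 3 * eps l} \<noteq> {}"
proof -
  have "Max ((\<lambda>x. feat B x \<bullet> \<theta>) ` S) \<in> (\<lambda>x. feat B x \<bullet> \<theta>) ` S"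
    using S by (intro Max_in) auto
  then obtain x where x0: "x \<in> S" "feat B x \<bullet> \<theta> = Max ((\<lambda>x. feat B x \<bullet> \<theta>) ` S)" by auto
  have x: "x \<in> S" "\<And>x'. x' \<in> S \<Longrightarrow> feat B x' \<bullet> \<theta> \<le> feat B x \<bullet> \<theta>"
    using x0 S by auto
  have "(feat B x' - feat B x) \<bullet> \<theta> \<le> 3 * eps l" if "x' \<in> S" for x'
  proof -
    have "feat B x' \<in> carrier_vec n" "feat B x \<in> carrier_vec n" using that x S acts_carrier by auto
    then have "(feat B x' - feat B x) \<bullet> \<theta> = feat B x' \<bullet> \<theta> - feat B x \<bullet> \<theta>"
      using \<theta> by (rule minus_scalar_prod_distrib)
    then show ?thesis using x(2)[OF that] eps_pos[of l] by linarith
  qed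
  then have "(MAX x'\<in>S. (feat B x' - feat B x) \<bullet> \<theta>) \<le> 3 * eps l"
    using S by (subst Max_le_iff) auto
  then show ?thesis using x(1) by blast
qed

lemma valid_group_step:
  assumes v: "valid_state \<xi> s" and z: "z \<in> {-1, 1}"
  shows "valid_state \<xi> (gstep \<xi> l z s)"
proof -
  define S where "S = cand s z"
  have S: "S \<noteq> {}" "S \<subseteq> acts B" "S \<subseteq> {x \<in> acts B. grp B x = z}" "finite S"
    using v z finite_subset[of S "acts B"] unfolding valid_state_def S_def by auto
  have ex: "valid_state \<xi> (exhaust c T (obs \<xi>) S s)" by (rule valid_exhaust[OF v S(1,2)])
  note sched = schedule_facts[OF S(2) gcount_support[of l S], of l]
  have up: "valid_state \<xi> (group_update B l z S \<theta> (hist s @ play (obs \<xi>) (hist s) (schedule c l (gcount l S))) s)"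
    if le: "length (hist s) + sum (gcount l S) S \<le> T" and \<theta>: "\<theta> \<in> carrier_vec n" for \<theta>
  proof -
    let ?s = "group_update B l z S \<theta> (hist s @ play (obs \<xi>) (hist s) (schedule c l (gcount l S))) s"
    have "set (schedule c l (gcount l S)) \<subseteq> acts B" using sched(1) S(2) by (rule subset_trans)
    then have h: "consistent \<xi> (hist ?s) \<and> set (map fst (hist ?s)) \<subseteq> acts B \<and> length (hist ?s) \<le> T"
    proof (rule valid_append[OF v])
      show "length (hist s) + length (schedule c l (gcount l S)) \<le> T"
        using le sched(2) by linarith
    qed (simp only: group_update_select)
    have "cand ?s z' \<noteq> {} \<and> cand ?s z' \<subseteq> {x \<in> acts B. grp B x = z'}" if "z' \<in> {-1, 1}" for z'
    proof (cases "z' = z")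
      case True
      then show ?thesis using cand_update_nonempty[OF S(4,1,2) \<theta>, of l] S(3)
        unfolding group_update_select by auto
    next
      case False
      have "cand s z' \<noteq> {} \<and> cand s z' \<subseteq> {x \<in> acts B. grp B x = z'}"
        using v that unfolding valid_state_def by blast
      then show ?thesis using False unfolding group_update_select by simp
    qed
    moreover have "est ?s z' \<in> carrier_vec n" if "z' \<in> {-1, 1}" for z'
      using v that \<theta> unfolding group_update_select valid_state_def by auto
    ultimately show ?thesis using h v unfolding valid_state_def
      by (simp only: group_update_select) blast
  qed
  show ?thesis
    unfolding group_step_unfold S_def[symmetric] Let_def
    using v ex up[OF _ least_squares_carrier] by simp
qed

lemma valid_bias_step:
  assumes v: "valid_state \<xi> s"
  shows "valid_state \<xi> (bstep \<xi> l s)"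
proof -
  define A where "A = cand s (-1) \<union> cand s 1"
  have A: "A \<noteq> {}" "A \<subseteq> acts B" "finite A"
    using v finite_subset[of A "acts B"] unfolding valid_state_def A_def by auto
  have ex: "valid_state \<xi> (exhaust c T (obs \<xi>) A s)" by (rule valid_exhaust[OF v A(1,2)])
  note sched = schedule_facts[OF subset_refl bcount_support[of l "est_gap s"], of l]
  have up: "valid_state \<xi> (bias_update l m (hist s @ play (obs \<xi>) (hist s) (schedule c l (bcount l (est_gap s)))) s)"
    if le: "\<not> T < length (hist s) + sum (bcount l (est_gap s)) (acts B)" for m
  proof -
    let ?s = "bias_update l m (hist s @ play (obs \<xi>) (hist s) (schedule c l (bcount l (est_gap s)))) s"
    have h: "consistent \<xi> (hist ?s) \<and> set (map fst (hist ?s)) \<subseteq> acts B \<and> length (hist ?s) \<le> T"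
    proof (rule valid_append[OF v sched(1)])
      show "length (hist s) + length (schedule c l (bcount l (est_gap s))) \<le> T"
        using le sched(2) by linarith
    qed (simp only: bias_update_select)
    have pos: "0 < est_gap ?s x" if x: "x \<in> acts B" for x
    proof (cases "x \<in> A")
      case True
      then have "m x \<le> (MAX x'\<in>A. m x')" using A by (intro Max_ge) auto
      then have "0 < (MAX x'\<in>A. m x') - m x + 4 * eps l" using eps_pos[of l] by linarith
      then have "0 < min 2 ((MAX x'\<in>A. m x') - m x + 4 * eps l)" by simp
      moreover have "est_gap ?s x = min 2 ((MAX x'\<in>A. m x') - m x + 4 * eps l)"
        using True by (simp add: A_def)
      ultimately show ?thesis by (simp only:)
    next
      case False
      then have "est_gap ?s x = est_gap s x" by (simp add: A_def)
      then show ?thesis using v x unfolding valid_state_def by simp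
    qed
    have ext: "est_gap ?s \<in> extensional (acts B)"
      using v A unfolding valid_state_def bias_update_select A_def[symmetric] by (auto simp: extensional_def)
    show ?thesis unfolding valid_state_def
      using h pos ext v by (simp add: valid_state_def del: map_append)
  qed
  show ?thesis
    unfolding bias_step_unfold A_def[symmetric] Let_def
    using v ex up by auto
qed

lemma validD:
  assumes "valid_state \<xi> s"
  shows "z \<in> {-1, 1} \<Longrightarrow> cand s z \<noteq> {}" "z \<in> {-1, 1} \<Longrightarrow> cand s z \<subseteq> {x \<in> acts B. grp B x = z}"
    "z \<in> {-1, 1} \<Longrightarrow> cand s z \<subseteq> acts B" "z \<in> {-1, 1} \<Longrightarrow> finite (cand s z)"
    "hist s = play (obs \<xi>) [] (map fst (hist s))" "set (map fst (hist s)) \<subseteq> acts B"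
    "length (hist s) \<le> T" "best_grp s \<in> {-1, 0, 1}" "x \<in> acts B \<Longrightarrow> 0 < est_gap s x"
    "est_gap s \<in> extensional (acts B)" "z \<in> {-1, 1} \<Longrightarrow> est s z \<in> carrier_vec n"
proof -
  note v = assms[unfolded valid_state_def]
  show "z \<in> {-1, 1} \<Longrightarrow> cand s z \<noteq> {}" "z \<in> {-1, 1} \<Longrightarrow> cand s z \<subseteq> {x \<in> acts B. grp B x = z}"
    using v by blast+
  then show "z \<in> {-1, 1} \<Longrightarrow> cand s z \<subseteq> acts B" by blast
  then show "z \<in> {-1, 1} \<Longrightarrow> finite (cand s z)" using finite_subset[OF _ finite_acts] by blast
  show "hist s = play (obs \<xi>) [] (map fst (hist s))" using v unfolding consistent_def by blast
qed (use assms[unfolded valid_state_def] in blast)+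

lemma exhaust_full: "length (hist s) = T \<Longrightarrow> exhaust c T obs' S s = s"
  by (simp add: exhaust_def)

text \<open>With the next lemma: a phase that begins at the horizon changes nothing, so a run is a plain
  iteration of phases.\<close>

lemma group_step_full:
  assumes "valid_state \<xi> s" "length (hist s) = T" "z \<in> {-1, 1}" "1 \<le> l"
  shows "gstep \<xi> l z s = s"
  using gcount_sum_pos[OF assms(4) validD(1)[OF assms(1,3)] validD(3)[OF assms(1,3)]] assms(2)
  unfolding group_step_unfold Let_def by (simp add: exhaust_full)

lemma bias_step_full:
  assumes "valid_state \<xi> s" "length (hist s) = T" "1 \<le> l"
  shows "bstep \<xi> l s = s"
  using bcount_sum_pos[OF assms(3), of "est_gap s"] validD(9)[OF assms(1)] assms(2)
  unfolding bias_step_unfold Let_def by (simp add: exhaust_full)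

text \<open>A step reads the observation table only at the rounds that it plays.\<close>

definition extends :: "((nat \<Rightarrow> rvec \<Rightarrow> real) \<Rightarrow> fpe_state \<Rightarrow> fpe_state) \<Rightarrow> fpe_state \<Rightarrow> bool" where
  "extends F s \<longleftrightarrow> (\<forall>o1. length (hist s) \<le> length (hist (F o1 s)) \<and>
     (\<forall>o2. (\<forall>t x. length (hist s) \<le> t \<longrightarrow> t < length (hist (F o1 s)) \<longrightarrow> o1 t x = o2 t x) \<longrightarrow> F o2 s = F o1 s))"

lemma exhaust_cong:
  assumes "\<And>t x. length (hist s) \<le> t \<Longrightarrow> t < length (hist (exhaust c T o1 S s)) \<Longrightarrow> o1 t x = o2 t x"
  shows "exhaust c T o2 S s = exhaust c T o1 S s"
proof -
  have "play o2 (hist s) (replicate (T - length (hist s)) (emp_best c (hist s) S))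
    = play o1 (hist s) (replicate (T - length (hist s)) (emp_best c (hist s) S))"
    by (rule play_cong[OF refl]) (use assms in auto)
  then show ?thesis unfolding exhaust_def by simp
qed

lemma extends_group_step: "extends (\<lambda>ob. group_step B c \<delta> T ob l z) s"
  unfolding extends_def
proof (intro allI conjI impI)
  fix o1 :: "nat \<Rightarrow> rvec \<Rightarrow> real"
  show "length (hist s) \<le> length (hist (group_step B c \<delta> T o1 l z s))"
    unfolding group_step_unfold Let_def by simp
  fix o2 :: "nat \<Rightarrow> rvec \<Rightarrow> real"
  assume eq: "\<forall>t x. length (hist s) \<le> t \<longrightarrow> t < length (hist (group_step B c \<delta> T o1 l z s)) \<longrightarrow> o1 t x = o2 t x"
  consider "z = - best_grp s"
    | "z \<noteq> - best_grp s" "length (hist s) + sum (gcount l (cand s z)) (cand s z) \<le> T"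
    | "z \<noteq> - best_grp s" "\<not> length (hist s) + sum (gcount l (cand s z)) (cand s z) \<le> T" by blast
  then show "group_step B c \<delta> T o2 l z s = group_step B c \<delta> T o1 l z s"
  proof cases
    case 1
    then show ?thesis unfolding group_step_unfold by simp
  next
    case 2
    have "play o2 (hist s) (schedule c l (gcount l (cand s z))) = play o1 (hist s) (schedule c l (gcount l (cand s z)))"
      by (rule play_cong[OF refl]) (use eq 2 in \<open>auto simp: group_step_unfold Let_def\<close>)
    then show ?thesis using 2 unfolding group_step_unfold Let_def by simp
  next
    case 3
    then show ?thesis using exhaust_cong[of s o1 "cand s z" o2] eq unfolding group_step_unfold by simp
  qed
qed

lemma extends_bias_step: "extends (\<lambda>ob. bias_step B c \<delta> T ob l) s"
  unfolding extends_def
proof (intro allI conjI impI)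
  fix o1 :: "nat \<Rightarrow> rvec \<Rightarrow> real"
  show "length (hist s) \<le> length (hist (bias_step B c \<delta> T o1 l s))"
    unfolding bias_step_unfold Let_def by simp
  fix o2 :: "nat \<Rightarrow> rvec \<Rightarrow> real"
  assume eq: "\<forall>t x. length (hist s) \<le> t \<longrightarrow> t < length (hist (bias_step B c \<delta> T o1 l s)) \<longrightarrow> o1 t x = o2 t x"
  let ?E = "recovers B T l (est_gap s) \<or> T < length (hist s) + sum (bcount l (est_gap s)) (acts B)"
  consider "best_grp s \<noteq> 0" | "best_grp s = 0" ?E | "best_grp s = 0" "\<not> ?E" by blast
  then show "bias_step B c \<delta> T o2 l s = bias_step B c \<delta> T o1 l s"
  proof cases
    case 1
    then show ?thesis unfolding bias_step_unfold by simp
  next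
    case 2
    then have "bias_step B c \<delta> T ob l s = exhaust c T ob (cand s (-1) \<union> cand s 1) s" for ob
      unfolding bias_step_unfold by simp
    then show ?thesis using exhaust_cong[of s o1 "cand s (-1) \<union> cand s 1" o2] eq by simp
  next
    case 3
    have "play o2 (hist s) (schedule c l (bcount l (est_gap s))) = play o1 (hist s) (schedule c l (bcount l (est_gap s)))"
      by (rule play_cong[OF refl]) (use eq 3 in \<open>auto simp: bias_step_unfold Let_def\<close>)
    then show ?thesis using 3 unfolding bias_step_unfold Let_def by simp
  qed
qed

text \<open>The length of the history is a stopping time, and the state is determined by the noise before it.\<close>

definition local_process :: "((nat \<Rightarrow> real) \<Rightarrow> fpe_state) \<Rightarrow> bool" where
  "local_process s \<longleftrightarrow> (\<forall>\<xi> \<xi>'. (\<forall>j<length (hist (s \<xi>)). \<xi> j = \<xi>' j) \<longrightarrow> s \<xi>' = s \<xi>)"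

lemma local_process_step:
  assumes s: "local_process s" and F: "\<And>s. extends F s"
  shows "local_process (\<lambda>\<xi>. F (obs \<xi>) (s \<xi>))"
  unfolding local_process_def
proof (intro allI impI)
  fix \<xi> \<xi>' :: "nat \<Rightarrow> real"
  assume eq: "\<forall>j<length (hist (F (obs \<xi>) (s \<xi>))). \<xi> j = \<xi>' j"
  note f = F[of "s \<xi>", unfolded extends_def, rule_format]
  have "s \<xi>' = s \<xi>"
    using s eq f[of "obs \<xi>", THEN conjunct1] unfolding local_process_def by (meson order_less_le_trans)
  moreover have "F (obs \<xi>') (s \<xi>) = F (obs \<xi>) (s \<xi>)"
    using f[of "obs \<xi>", THEN conjunct2, rule_format, of "obs \<xi>'"] eq by (simp add: observe_def)
  ultimately show "F (obs \<xi>') (s \<xi>') = F (obs \<xi>) (s \<xi>)" by simp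
qed

end

section \<open>Measurability of the states\<close>

lemma measurable_into_subset:
  assumes "f \<in> measurable M (count_space UNIV)" "\<And>x. x \<in> space M \<Longrightarrow> f x \<in> A"
  shows "f \<in> measurable M (count_space A)"
  using assms by (auto simp: measurable_def)

lemma measurable_pair_count_space:
  assumes "f \<in> measurable M (count_space A)" "g \<in> measurable M (count_space B)"
    and "countable A" "countable B"
  shows "(\<lambda>x. (f x, g x)) \<in> measurable M (count_space (A \<times> B))"
  using measurable_Pair[OF assms(1,2)] pair_measure_countable[OF assms(3,4)] by simp

lemma measurable_piecewise:
  assumes g: "g \<in> measurable M (count_space I)" and I: "countable I"
    and ex: "\<And>i. i \<in> I \<Longrightarrow> \<exists>h. h \<in> measurable M N \<and> (\<forall>x\<in>space M. g x = i \<longrightarrow> f x = h x)"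
  shows "f \<in> measurable M N"
proof -
  obtain h where h: "\<And>i. i \<in> I \<Longrightarrow> h i \<in> measurable M N"
    "\<And>i x. i \<in> I \<Longrightarrow> x \<in> space M \<Longrightarrow> g x = i \<Longrightarrow> f x = h i x"
    using ex by metis
  have "(\<lambda>x. h (g x) x) \<in> measurable M N"
    by (rule measurable_compose_countable'[OF _ g I]) (use h in auto)
  moreover have "f x = h (g x) x" if "x \<in> space M" for x
    using h(2)[OF _ that refl] measurable_space[OF g that] by simp
  ultimately show ?thesis by (simp cong: measurable_cong)
qed

lemma measurable_filter_set:
  assumes fin: "finite A" and S: "S \<subseteq> A" and P: "\<And>x. x \<in> S \<Longrightarrow> {\<xi> \<in> space M. P x \<xi>} \<in> sets M"
  shows "(\<lambda>\<xi>. {x \<in> S. P x \<xi>}) \<in> measurable M (count_space (Pow A))"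
proof (subst measurable_count_space_eq2)
  show "finite (Pow A)" using fin by simp
  have finS: "finite S" using S fin finite_subset by blast
  have "(\<lambda>\<xi>. {x \<in> S. P x \<xi>}) -` {X} \<inter> space M \<in> sets M" if "X \<subseteq> A" for X
  proof -
    have "(\<lambda>\<xi>. {x \<in> S. P x \<xi>}) -` {X} \<inter> space M
      = (if X \<subseteq> S then {\<xi> \<in> space M. \<forall>x\<in>S. P x \<xi> \<longleftrightarrow> x \<in> X} else {})" by auto
    moreover have "{\<xi> \<in> space M. \<forall>x\<in>S. P x \<xi> \<longleftrightarrow> x \<in> X} \<in> sets M"
    proof (rule sets.sets_Collect_finite_All[OF _ finS])
      fix x assume x: "x \<in> S"
      have "{\<xi> \<in> space M. P x \<xi> \<longleftrightarrow> x \<in> X} = (if x \<in> X then {\<xi> \<in> space M. P x \<xi>} else space M - {\<xi> \<in> space M. P x \<xi>})"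
        by auto
      then show "{\<xi> \<in> space M. P x \<xi> = (x \<in> X)} \<in> sets M" using P[OF x] by auto
    qed
    ultimately show ?thesis by simp
  qed
  then show "(\<lambda>\<xi>. {x \<in> S. P x \<xi>}) \<in> space M \<rightarrow> Pow A \<and>
      (\<forall>a\<in>Pow A. (\<lambda>\<xi>. {x \<in> S. P x \<xi>}) -` {a} \<inter> space M \<in> sets M)" using S by auto
qed

context bandit_run
begin

text \<open>The observations in the history are left out, since they are determined by the actions and the noise.\<close>

definition measurable_process :: "((nat \<Rightarrow> real) \<Rightarrow> fpe_state) \<Rightarrow> bool" where
  "measurable_process s \<longleftrightarrow>
     (\<lambda>\<xi>. map fst (hist (s \<xi>))) \<in> measurable noise (count_space (lists (acts B))) \<and>
     (\<forall>z\<in>{-1, 1}. (\<lambda>\<xi>. cand (s \<xi>) z) \<in> measurable noise (count_space (Pow (acts B)))) \<and>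
     (\<lambda>\<xi>. best_grp (s \<xi>)) \<in> measurable noise (count_space UNIV) \<and>
     (\<forall>z\<in>{-1, 1}. \<forall>i<n. (\<lambda>\<xi>. est (s \<xi>) z $ i) \<in> borel_measurable noise) \<and>
     (\<forall>x\<in>acts B. (\<lambda>\<xi>. est_gap (s \<xi>) x) \<in> borel_measurable noise)"

lemma countable_lists_acts: "countable (lists (acts B))"
  by (intro countable_lists countable_finite finite_acts)

text \<open>The branch that a step takes and the number of samples depend on countably many possible values of
  data \<open>g\<close> known before the step. For a fixed value of \<open>g\<close> the step is an explicit formula, for which
  measurability can be read off.\<close>

lemma measurable_process_piecewise:
  assumes g: "g \<in> measurable noise (count_space I)" and I: "countable I"
    and ex: "\<And>i. i \<in> I \<Longrightarrow> \<exists>s'. measurable_process s' \<and> (\<forall>\<xi>. g \<xi> = i \<longrightarrow> s \<xi> = s' \<xi>)"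
  shows "measurable_process s"
proof -
  have component: "(\<lambda>\<xi>. F (s \<xi>)) \<in> measurable noise N"
    if F: "\<And>s'. measurable_process s' \<Longrightarrow> (\<lambda>\<xi>. F (s' \<xi>)) \<in> measurable noise N"
    for F :: "fpe_state \<Rightarrow> 'b" and N
  proof (rule measurable_piecewise[OF g I])
    fix i assume "i \<in> I"
    from ex[OF this] obtain s' where s': "measurable_process s'" "\<And>\<xi>. g \<xi> = i \<Longrightarrow> s \<xi> = s' \<xi>" by blast
    show "\<exists>h. h \<in> measurable noise N \<and> (\<forall>x\<in>space noise. g x = i \<longrightarrow> F (s x) = h x)"
      by (rule exI[of _ "\<lambda>\<xi>. F (s' \<xi>)"]) (use F[OF s'(1)] s'(2) in simp)
  qed
  show ?thesis
    unfolding measurable_process_def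
    by (intro conjI ballI allI impI; rule component; unfold measurable_process_def; blast)
qed

lemma measurable_observe [measurable]: "(\<lambda>\<xi>. obs \<xi> t x) \<in> borel_measurable noise"
  unfolding observe_def by measurable

lemma measurable_least_squares:
  assumes i: "i < n"
  shows "(\<lambda>\<xi>. least_squares B S \<mu> (play (obs \<xi>) h zs) $ i) \<in> borel_measurable noise"
proof -
  define G where "G = ginv (V B S (\<lambda>x. real (\<mu> x)))"
  have G: "G \<in> carrier_mat n n" unfolding G_def by (rule ginv(1)) (simp add: V_gram)
  have "least_squares B S \<mu> (play (obs \<xi>) h zs) $ i
    = (\<Sum>k\<in>{0..<n}. G $$ (i, k) * (\<Sum>j\<in>{0..<length zs}. obs \<xi> (length h + j) (zs ! j) * feat B (zs ! j) $ k))" for \<xi>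
    unfolding least_squares_def G_def[symmetric] play_def using G i
    by (simp add: scalar_prod_def sum_list_sum_nth case_prod_beta comp_def)
  then show ?thesis by simp
qed

lemma measurable_scalar_prod:
  fixes v :: rvec and \<theta> :: "'a \<Rightarrow> rvec"
  assumes "v \<in> carrier_vec n" "\<And>\<xi>. \<theta> \<xi> \<in> carrier_vec n" "\<And>i. i < n \<Longrightarrow> (\<lambda>\<xi>. \<theta> \<xi> $ i) \<in> borel_measurable M"
  shows "(\<lambda>\<xi>. v \<bullet> \<theta> \<xi>) \<in> borel_measurable M"
proof -
  have e: "v \<bullet> \<theta> \<xi> = (\<Sum>i\<in>{0..<n}. v $ i * \<theta> \<xi> $ i)" for \<xi>
    using assms(2)[of \<xi>] by (simp add: scalar_prod_def)
  show ?thesis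
    unfolding e by (intro borel_measurable_sum borel_measurable_times borel_measurable_const assms(3)) simp
qed

lemma measurable_exhaust_hist:
  assumes S: "S \<noteq> {}" "S \<subseteq> acts B" and ys: "set ys \<subseteq> acts B"
  shows "(\<lambda>\<xi>. ys @ replicate k (emp_best c (play (obs \<xi>) [] ys) S)) \<in> measurable noise (count_space (lists (acts B)))"
proof -
  have "(\<lambda>\<xi>. \<lambda>i\<in>{..<length ys}. obs \<xi> i (ys ! i)) \<in> measurable noise (\<Pi>\<^sub>M i\<in>{..<length ys}. borel)"
    by (intro measurable_restrict) measurable
  from measurable_compose[OF this emp_best_measurable[OF S ys]]
  have "(\<lambda>\<xi>. emp_best c (map (\<lambda>i. (ys ! i, (\<lambda>i\<in>{..<length ys}. obs \<xi> i (ys ! i)) i)) [0..<length ys]) S)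
    \<in> measurable noise (count_space UNIV)" .
  moreover have "map (\<lambda>i. (ys ! i, (\<lambda>i\<in>{..<length ys}. obs \<xi> i (ys ! i)) i)) [0..<length ys] = play (obs \<xi>) [] ys" for \<xi>
    unfolding play_def by auto
  ultimately have e: "(\<lambda>\<xi>. emp_best c (play (obs \<xi>) [] ys) S) \<in> measurable noise (count_space UNIV)" by simp
  have "(\<lambda>\<xi>. ys @ replicate k (emp_best c (play (obs \<xi>) [] ys) S)) \<in> measurable noise (count_space UNIV)"
    by (rule measurable_compose[OF e]) simp
  then show ?thesis
  proof (rule measurable_into_subset)
    fix \<xi> show "ys @ replicate k (emp_best c (play (obs \<xi>) [] ys) S) \<in> lists (acts B)"
      using ys emp_best_in[OF S] S(2) by (auto simp: in_lists_conv_set)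
  qed
qed

lemma measurable_process_exhaust:
  assumes m: "measurable_process s" and S: "S \<noteq> {}" "S \<subseteq> acts B" and ys: "set ys \<subseteq> acts B"
  shows "measurable_process (\<lambda>\<xi>. (s \<xi>)\<lparr>hist := play (obs \<xi>) []
    (ys @ replicate k (emp_best c (play (obs \<xi>) [] ys) S))\<rparr>)"
  using m measurable_exhaust_hist[OF S ys] unfolding measurable_process_def by simp

lemma exhaust_eq:
  assumes "valid_state \<xi> s" and "map fst (hist s) = ys"
  shows "exhaust c T (obs \<xi>) S s = s\<lparr>hist := play (obs \<xi>) []
    (ys @ replicate (T - length ys) (emp_best c (play (obs \<xi>) [] ys) S))\<rparr>"
proof -
  have h: "hist s = play (obs \<xi>) [] ys" using validD(5)[OF assms(1)] assms(2) by simp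
  have "play (obs \<xi>) [] (ys @ zs) = play (obs \<xi>) [] ys @ play (obs \<xi>) (hist s) zs" for zs
    by (rule play_append) (simp add: h)
  then show ?thesis unfolding exhaust_def h by simp
qed

lemma measurable_group_step:
  assumes v: "\<And>\<xi>. valid_state \<xi> (s \<xi>)" and m: "measurable_process s" and z: "z \<in> {-1, 1}"
  shows "measurable_process (\<lambda>\<xi>. gstep \<xi> l z (s \<xi>))"
proof (rule measurable_process_piecewise)
  let ?g = "\<lambda>\<xi>. (best_grp (s \<xi>), map fst (hist (s \<xi>)), cand (s \<xi>) z)"
  let ?I = "UNIV \<times> (lists (acts B) \<times> Pow (acts B)) :: (int \<times> rvec list \<times> rvec set) set"
  show "?g \<in> measurable noise (count_space ?I)"
    by (intro measurable_pair_count_space)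
      (use m z countable_lists_acts in \<open>auto simp: measurable_process_def countable_finite\<close>)
  show "countable ?I" using countable_lists_acts by (intro countable_SIGMA) (auto intro: countable_finite)
  fix i assume "i \<in> ?I"
  show "\<exists>s'. measurable_process s' \<and> (\<forall>\<xi>. ?g \<xi> = i \<longrightarrow> gstep \<xi> l z (s \<xi>) = s' \<xi>)"
  proof (cases "\<exists>\<xi>. ?g \<xi> = i")
    case False
    then show ?thesis using m by (intro exI[of _ s]) simp
  next
    case True
    then obtain \<xi>0 where \<xi>0: "?g \<xi>0 = i" by blast
    obtain b ys S where i: "i = (b, ys, S)" by (cases i)
    have S: "S \<noteq> {}" "S \<subseteq> acts B" "finite S" and ys: "set ys \<subseteq> acts B"
      using \<xi>0 validD(1,3,4)[OF v[of \<xi>0] z] validD(6)[OF v[of \<xi>0]] unfolding i by auto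
    have len: "length (hist (s \<xi>)) = length ys" if "?g \<xi> = i" for \<xi>
    proof -
      have "map fst (hist (s \<xi>)) = ys" using that unfolding i by simp
      then show ?thesis by (metis length_map)
    qed
    consider "b = - z" | "b \<noteq> - z" "length ys + sum (gcount l S) S \<le> T"
      | "b \<noteq> - z" "\<not> length ys + sum (gcount l S) S \<le> T" by blast
    then show ?thesis
    proof cases
      case 1
      then show ?thesis using m unfolding i by (intro exI[of _ s]) (auto simp: group_step_unfold)
    next
      case 3
      then show ?thesis using measurable_process_exhaust[OF m S(1,2) ys, of "T - length ys"]
        len exhaust_eq[OF v, of _ ys S] unfolding i
        by (intro exI[of _ "\<lambda>\<xi>. (s \<xi>)\<lparr>hist := play (obs \<xi>) []
          (ys @ replicate (T - length ys) (emp_best c (play (obs \<xi>) [] ys) S))\<rparr>"]) (auto simp: group_step_unfold)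
    next
      case 2
      define \<mu> where "\<mu> = gcount l S"
      define zs where "zs = schedule c l \<mu>"
      define \<theta> where "\<theta> = (\<lambda>\<xi>. least_squares B S \<mu> (play (obs \<xi>) (hist (s \<xi>0)) zs))"
      define s' where "s' = (\<lambda>\<xi>. group_update B l z S (\<theta> \<xi>) (play (obs \<xi>) [] (ys @ zs)) (s \<xi>))"
      have zs: "set zs \<subseteq> acts B"
        using schedule_facts(1)[OF S(2) gcount_support[of l S], of l] S(2) unfolding zs_def \<mu>_def by blast
      have \<theta>: "\<theta> \<xi> \<in> carrier_vec n" "k < n \<Longrightarrow> (\<lambda>\<xi>. \<theta> \<xi> $ k) \<in> borel_measurable noise" for \<xi> k
        unfolding \<theta>_def by (rule least_squares_carrier, rule measurable_least_squares)
      have fc: "feat B x \<in> carrier_vec n" if "x \<in> S" for x using that S acts_carrier by auto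
      have "gstep \<xi> l z (s \<xi>) = s' \<xi>" if g: "?g \<xi> = i" for \<xi>
      proof -
        have e: "best_grp (s \<xi>) = b" "map fst (hist (s \<xi>)) = ys" "cand (s \<xi>) z = S" using g unfolding i by auto
        have h: "hist (s \<xi>) = play (obs \<xi>) [] ys" using validD(5)[OF v[of \<xi>]] e(2) by simp
        have "play (obs \<xi>) [] (ys @ zs) = play (obs \<xi>) [] ys @ play (obs \<xi>) (hist (s \<xi>)) zs"
          by (rule play_append) (simp add: h)
        moreover have "play (obs \<xi>) (hist (s \<xi>)) zs = play (obs \<xi>) (hist (s \<xi>0)) zs"
          by (rule play_cong) (use len[OF g] len[OF \<xi>0] in auto)
        ultimately show ?thesis unfolding s'_def \<theta>_def group_step_unfold Let_def e
          using 2 len[OF g] h by (simp add: \<mu>_def zs_def)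
      qed
      moreover have "measurable_process s'"
      proof -
        have "{\<xi> \<in> space noise. (MAX x'\<in>S. (feat B x' - feat B x) \<bullet> \<theta> \<xi>) \<le> 3 * eps l} \<in> sets noise"
          if x: "x \<in> S" for x
        proof -
          have "(\<lambda>\<xi>. (feat B x' - feat B x) \<bullet> \<theta> \<xi>) \<in> borel_measurable noise" if "x' \<in> S" for x'
            by (rule measurable_scalar_prod) (use fc x that \<theta> in auto)
          then have "{\<xi> \<in> space noise. \<forall>x'\<in>S. (feat B x' - feat B x) \<bullet> \<theta> \<xi> \<le> 3 * eps l} \<in> sets noise"
            by (intro sets.sets_Collect_finite_All S borel_measurable_le borel_measurable_const) auto
          moreover have "(MAX x'\<in>S. (feat B x' - feat B x) \<bullet> \<theta> \<xi>) \<le> 3 * eps l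
            \<longleftrightarrow> (\<forall>x'\<in>S. (feat B x' - feat B x) \<bullet> \<theta> \<xi> \<le> 3 * eps l)" for \<xi>
            using S by (subst Max_le_iff) auto
          ultimately show ?thesis by simp
        qed
        then have "(\<lambda>\<xi>. {x \<in> S. (MAX x'\<in>S. (feat B x' - feat B x) \<bullet> \<theta> \<xi>) \<le> 3 * eps l})
          \<in> measurable noise (count_space (Pow (acts B)))"
          by (intro measurable_filter_set finite_acts S)
        moreover have "(\<lambda>\<xi>. ys @ zs) \<in> measurable noise (count_space (lists (acts B)))"
          using ys zs by (intro measurable_const) auto
        moreover have "\<forall>k<n. (\<lambda>\<xi>. \<theta> \<xi> $ k) \<in> borel_measurable noise" using \<theta>(2) by blast
        ultimately show ?thesis using m z unfolding measurable_process_def s'_def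
          by (cases "z = 1") (simp_all add: fun_upd_def)
      qed
      ultimately show ?thesis by blast
    qed
  qed
qed

text \<open>\<open>kappa\<close> is an infimum over uncountably many measures, but it is attained at a measurable choice.\<close>

lemma measurable_kappa:
  assumes "\<And>\<xi>. D \<xi> \<in> extensional (acts B)" "\<And>\<xi> x. x \<in> acts B \<Longrightarrow> 0 < D \<xi> x"
    and "\<And>x. x \<in> acts B \<Longrightarrow> (\<lambda>\<xi>. D \<xi> x) \<in> borel_measurable noise"
  shows "x \<in> acts B \<Longrightarrow> (\<lambda>\<xi>. gap_design c l (D \<xi>) x) \<in> borel_measurable noise"
    and "(\<lambda>\<xi>. kappa B (D \<xi>)) \<in> borel_measurable noise"
proof -
  have "(\<lambda>\<xi>. \<lambda>x\<in>acts B. D \<xi> x) \<in> measurable noise (\<Pi>\<^sub>M x\<in>acts B. borel)"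
    by (intro measurable_restrict assms(3))
  then have D: "D \<in> measurable noise (\<Pi>\<^sub>M x\<in>acts B. borel)"
    by (simp add: extensional_restrict[OF assms(1)])
  have g: "(\<lambda>\<xi>. gap_design c l (D \<xi>) x) \<in> borel_measurable noise" if "x \<in> acts B" for x l
    by (rule measurable_compose[OF D gap_design_measurable[OF that]])
  then show "x \<in> acts B \<Longrightarrow> (\<lambda>\<xi>. gap_design c l (D \<xi>) x) \<in> borel_measurable noise" by blast
  have "kappa B (D \<xi>) = (\<Sum>x\<in>acts B. gap_design c 0 (D \<xi>) x * D \<xi> x)" for \<xi>
    by (rule kappa_gap_optimal[OF gap_design_optimal]) (use assms(2) in auto)
  then show "(\<lambda>\<xi>. kappa B (D \<xi>)) \<in> borel_measurable noise"
    using g assms(3) by simp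
qed

text \<open>All that determines which branch the bias step takes and how often it samples. The sample sizes are
  restricted to the actions in order to have countably many values.\<close>

definition bias_index :: "nat \<Rightarrow> fpe_state \<Rightarrow> int \<times> rvec list \<times> rvec set \<times> rvec set \<times> bool \<times> (rvec \<Rightarrow> nat)" where
  "bias_index l s = (best_grp s, map fst (hist s), cand s (-1), cand s 1, recovers B T l (est_gap s),
     restrict (bcount l (est_gap s)) (acts B))"

definition bias_indices :: "(int \<times> rvec list \<times> rvec set \<times> rvec set \<times> bool \<times> (rvec \<Rightarrow> nat)) set" where
  "bias_indices = UNIV \<times> lists (acts B) \<times> Pow (acts B) \<times> Pow (acts B) \<times> UNIV \<times> (acts B \<rightarrow>\<^sub>E UNIV)"

lemma countable_bias_indices: "countable bias_indices"
proof -
  have "countable (acts B \<rightarrow>\<^sub>E (UNIV :: nat set))" by (intro countable_PiE) auto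
  then show ?thesis unfolding bias_indices_def
    using countable_lists_acts by (intro countable_SIGMA) (auto intro: countable_finite)
qed

lemma measurable_bias_index:
  assumes v: "\<And>\<xi>. valid_state \<xi> (s \<xi>)" and m: "measurable_process s"
  shows "(\<lambda>\<xi>. bias_index l (s \<xi>)) \<in> measurable noise (count_space
    bias_indices)"
proof -
  let ?D = "\<lambda>\<xi>. est_gap (s \<xi>)"
  let ?\<mu> = "\<lambda>\<xi>. restrict (bcount l (?D \<xi>)) (acts B)"
  have Dm: "x \<in> acts B \<Longrightarrow> (\<lambda>\<xi>. ?D \<xi> x) \<in> borel_measurable noise" for x
    using m unfolding measurable_process_def by blast
  have ext: "?D \<xi> \<in> extensional (acts B)" and pos: "x \<in> acts B \<Longrightarrow> 0 < ?D \<xi> x" for \<xi> x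
    by (rule validD[OF v])+
  have kap1: "(\<lambda>\<xi>. gap_design c l (?D \<xi>) x) \<in> borel_measurable noise" if "x \<in> acts B" for x
    using that by (intro measurable_kappa(1) ext pos Dm)
  have kap2: "(\<lambda>\<xi>. kappa B (?D \<xi>)) \<in> borel_measurable noise"
    by (intro measurable_kappa(2) ext pos Dm)
  have ctble: "countable (acts B \<rightarrow>\<^sub>E (UNIV :: nat set))" by (intro countable_PiE) auto
  have \<mu>m: "?\<mu> \<in> measurable noise (count_space (acts B \<rightarrow>\<^sub>E UNIV))"
  proof (subst measurable_count_space_eq_countable[OF ctble], intro conjI ballI)
    show "?\<mu> \<in> space noise \<rightarrow> acts B \<rightarrow>\<^sub>E UNIV" by auto
    fix a :: "rvec \<Rightarrow> nat" assume a: "a \<in> acts B \<rightarrow>\<^sub>E UNIV"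
    have "?\<mu> -` {a} \<inter> space noise = {\<xi> \<in> space noise. \<forall>x\<in>acts B. bcount l (?D \<xi>) x = a x}"
      using a by (auto simp: fun_eq_iff restrict_def PiE_iff extensional_def)
    also have "\<dots> \<in> sets noise"
    proof (rule sets.sets_Collect_finite_All)
      fix x assume x: "x \<in> acts B"
      have [measurable]: "(\<lambda>\<xi>. gap_design c l (?D \<xi>) x) \<in> borel_measurable noise" by (rule kap1[OF x])
      have "(\<lambda>\<xi>. nat \<lceil>2 * gap_design c l (?D \<xi>) x / (eps l)\<^sup>2 * ln (real l * (real l + 1) / \<delta>)\<rceil>)
        \<in> measurable noise (count_space UNIV)" by measurable
      from measurable_sets[OF this, of "{a x}"]
      show "{\<xi> \<in> space noise. bcount l (?D \<xi>) x = a x} \<in> sets noise"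
        using x unfolding bias_count_def by (simp add: vimage_def)
    qed simp
    finally show "?\<mu> -` {a} \<inter> space noise \<in> sets noise" .
  qed
  have rm: "(\<lambda>\<xi>. recovers B T l (?D \<xi>)) \<in> measurable noise (count_space UNIV)"
  proof -
    have [measurable]: "(\<lambda>\<xi>. kappa B (?D \<xi>)) \<in> borel_measurable noise" by (rule kap2)
    have "root 3 \<in> borel_measurable (borel :: real measure)"
      by (intro borel_measurable_continuous_onI continuous_on_real_root continuous_on_id)
    then have "(\<lambda>\<xi>. root 3 (kappa B (?D \<xi>) * ln (real T) / real T)) \<in> borel_measurable noise"
      by (rule measurable_compose[rotated]) measurable
    then show ?thesis unfolding recovers_def by measurable
  qed
  show "(\<lambda>\<xi>. bias_index l (s \<xi>)) \<in> measurable noise (count_space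
    bias_indices)"
    unfolding bias_index_def bias_indices_def by (intro measurable_pair_count_space)
      (use m countable_lists_acts rm \<mu>m ctble in \<open>auto simp: measurable_process_def countable_finite intro!: countable_SIGMA\<close>)
qed

lemma measurable_bias_step:
  assumes v: "\<And>\<xi>. valid_state \<xi> (s \<xi>)" and m: "measurable_process s"
  shows "measurable_process (\<lambda>\<xi>. bstep \<xi> l (s \<xi>))"
proof (rule measurable_process_piecewise[OF measurable_bias_index[OF v m, of l] countable_bias_indices])
  let ?D = "\<lambda>\<xi>. est_gap (s \<xi>)"
  let ?\<mu> = "\<lambda>\<xi>. restrict (bcount l (?D \<xi>)) (acts B)"
  let ?g = "\<lambda>\<xi>. bias_index l (s \<xi>)"
  have Dm: "x \<in> acts B \<Longrightarrow> (\<lambda>\<xi>. ?D \<xi> x) \<in> borel_measurable noise" for x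
    using m unfolding measurable_process_def by blast
  fix i
  show "\<exists>s'. measurable_process s' \<and> (\<forall>\<xi>. ?g \<xi> = i \<longrightarrow> bstep \<xi> l (s \<xi>) = s' \<xi>)"
  proof (cases "\<exists>\<xi>. ?g \<xi> = i")
    case False
    then show ?thesis using m by (intro exI[of _ s]) simp
  next
    case True
    then obtain \<xi>0 where \<xi>0: "?g \<xi>0 = i" by blast
    obtain b ys C1 C2 r \<nu> where i: "i = (b, ys, C1, C2, r, \<nu>)" by (cases i)
    define \<mu> where "\<mu> = bcount l (?D \<xi>0)"
    define C where "C = (\<lambda>z :: int. if z = 1 then C2 else C1)"
    define A where "A = C1 \<union> C2"
    have C: "C1 \<noteq> {}" "C2 \<noteq> {}" "C1 \<subseteq> acts B" "C2 \<subseteq> acts B" "finite C1" "finite C2"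
      and ys: "set ys \<subseteq> acts B"
      using \<xi>0 validD(1,3,4)[OF v[of \<xi>0], of 1] validD(1,3,4)[OF v[of \<xi>0], of "-1"] validD(6)[OF v[of \<xi>0]]
      unfolding i bias_index_def by auto
    have A: "A \<noteq> {}" "A \<subseteq> acts B" "finite A" using C unfolding A_def by auto
    have g: "best_grp (s \<xi>) = b" "map fst (hist (s \<xi>)) = ys" "cand (s \<xi>) (-1) = C1" "cand (s \<xi>) 1 = C2"
      "recovers B T l (?D \<xi>) = r" "length (hist (s \<xi>)) = length ys" "bcount l (?D \<xi>) = \<mu>"
      if "?g \<xi> = i" for \<xi>
    proof -
      show "best_grp (s \<xi>) = b" "cand (s \<xi>) (-1) = C1" "cand (s \<xi>) 1 = C2"
        "recovers B T l (?D \<xi>) = r" using that unfolding i bias_index_def by auto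
      show "map fst (hist (s \<xi>)) = ys" using that unfolding i bias_index_def by simp
      then show "length (hist (s \<xi>)) = length ys" by (metis length_map)
      have r: "?\<mu> \<xi> = ?\<mu> \<xi>0" using that \<xi>0 unfolding i bias_index_def by simp
      show "bcount l (?D \<xi>) = \<mu>"
      proof
        fix x
        show "bcount l (?D \<xi>) x = \<mu> x"
        proof (cases "x \<in> acts B")
          case True
          then show ?thesis using fun_cong[OF r, of x] unfolding \<mu>_def by simp
        next
          case False
          then show ?thesis unfolding \<mu>_def bias_count_def by simp
        qed
      qed
    qed
    consider "b \<noteq> 0" | "b = 0" "r \<or> T < length ys + sum \<mu> (acts B)"
      | "b = 0" "\<not> (r \<or> T < length ys + sum \<mu> (acts B))" by blast
    then show ?thesis
    proof cases
      case 1
      have "bstep \<xi> l (s \<xi>) = s \<xi>" if "?g \<xi> = i" for \<xi>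
        using 1 g(1)[OF that] by (simp add: bias_step_unfold)
      then show ?thesis using m by blast
    next
      case 2
      have "bstep \<xi> l (s \<xi>) = (s \<xi>)\<lparr>hist := play (obs \<xi>) []
          (ys @ replicate (T - length ys) (emp_best c (play (obs \<xi>) [] ys) A))\<rparr>" if gi: "?g \<xi> = i" for \<xi>
        using 2 exhaust_eq[OF v g(2)[OF gi], of A] unfolding bias_step_unfold g[OF gi] A_def by simp
      then show ?thesis using measurable_process_exhaust[OF m A(1,2) ys, of "T - length ys"] by blast
    next
      case 3
      define zs where "zs = schedule c l \<mu>"
      define w where "w = (\<lambda>\<xi>. e_last B \<bullet> least_squares B (acts B) \<mu> (play (obs \<xi>) (hist (s \<xi>0)) zs))"
      define e where "e = (\<lambda>\<xi>. bias_estimate B (est (s \<xi>)) (w \<xi>))"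
      define s' where "s' = (\<lambda>\<xi>. (s \<xi>)\<lparr>hist := play (obs \<xi>) [] (ys @ zs),
        best_grp := (if group_wins l C (e \<xi>) 1 then 1 else if group_wins l C (e \<xi>) (-1) then -1 else 0),
        est_gap := (\<lambda>x. if x \<in> A then min 2 ((MAX x'\<in>A. e \<xi> x') - e \<xi> x + 4 * eps l) else ?D \<xi> x)\<rparr>)"
      have zs: "set zs \<subseteq> acts B"
        using schedule_facts(1)[OF subset_refl bcount_support[of l "?D \<xi>0"], of l] unfolding zs_def \<mu>_def .
      have "bstep \<xi> l (s \<xi>) = s' \<xi>" if gi: "?g \<xi> = i" for \<xi>
      proof -
        have h: "hist (s \<xi>) = play (obs \<xi>) [] ys" using validD(5)[OF v[of \<xi>]] g(2)[OF gi] by simp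
        have 1: "play (obs \<xi>) [] (ys @ zs) = play (obs \<xi>) [] ys @ play (obs \<xi>) (hist (s \<xi>)) zs"
          by (rule play_append) (simp add: h)
        have 2: "play (obs \<xi>) (hist (s \<xi>)) zs = play (obs \<xi>) (hist (s \<xi>0)) zs"
          by (rule play_cong) (use g(6)[OF gi] g(6)[OF \<xi>0] in auto)
        have 4: "group_wins l (cand (s \<xi>)) m' z = group_wins l C m' z" if "z \<in> {-1, 1}" for m' z
          using that g(3,4)[OF gi] unfolding group_wins_def C_def by auto
        have "bstep \<xi> l (s \<xi>) = bias_update l (e \<xi>) (play (obs \<xi>) [] (ys @ zs)) (s \<xi>)"
          unfolding bias_step_unfold Let_def g[OF gi] 1 e_def w_def
          using 3 2 h by (simp add: zs_def)
        then show ?thesis unfolding bias_update_def s'_def g(3,4)[OF gi] A_def using 4 by simp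
      qed
      moreover have "measurable_process s'"
      proof -
        have wm: "w \<in> borel_measurable noise" unfolding w_def
          by (rule measurable_scalar_prod[OF e_last_carrier least_squares_carrier measurable_least_squares])
        have em: "(\<lambda>\<xi>. e \<xi> x) \<in> borel_measurable noise" if x: "x \<in> acts B" for x
        proof -
          have gx: "grp B x \<in> {-1, 1}" using grp_values[OF x] by auto
          have "(\<lambda>\<xi>. feat B x \<bullet> est (s \<xi>) (grp B x)) \<in> borel_measurable noise"
          proof (rule measurable_scalar_prod)
            show "feat B x \<in> carrier_vec n" using x acts_carrier by auto
            show "est (s \<xi>) (grp B x) \<in> carrier_vec n" for \<xi> by (rule validD(11)[OF v gx])
            show "(\<lambda>\<xi>. est (s \<xi>) (grp B x) $ k) \<in> borel_measurable noise" if "k < n" for k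
              using m gx that unfolding measurable_process_def by blast
          qed
          then show ?thesis unfolding e_def bias_estimate_def
            by (intro borel_measurable_diff borel_measurable_times borel_measurable_const wm)
        qed
        have Mm: "(\<lambda>\<xi>. MAX x\<in>S. e \<xi> x) \<in> borel_measurable noise" if "S \<subseteq> acts B" "finite S" for S
          by (rule borel_measurable_Max) (use that em in auto)
        have gw: "{\<xi> \<in> space noise. group_wins l C (e \<xi>) z} \<in> sets noise" for z
          unfolding group_wins_def
          by (intro borel_measurable_le borel_measurable_add borel_measurable_diff borel_measurable_const Mm)
            (use C in \<open>auto simp: C_def\<close>)
        have "(\<lambda>\<xi>. (if group_wins l C (e \<xi>) 1 then 1 else if group_wins l C (e \<xi>) (-1) then -1 else 0) :: int)
          \<in> measurable noise (count_space UNIV)"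
          by (intro measurable_If gw measurable_const) auto
        moreover have "(\<lambda>\<xi>. if x \<in> A then min 2 ((MAX x'\<in>A. e \<xi> x') - e \<xi> x + 4 * eps l) else ?D \<xi> x)
          \<in> borel_measurable noise" if x: "x \<in> acts B" for x
          using Mm[OF A(2,3)] em[OF x] Dm[OF x]
          by (cases "x \<in> A") (simp_all add: borel_measurable_min borel_measurable_add borel_measurable_diff)
        moreover have "(\<lambda>\<xi>. ys @ zs) \<in> measurable noise (count_space (lists (acts B)))"
          using ys zs by (intro measurable_const) auto
        ultimately show ?thesis using m unfolding measurable_process_def s'_def by simp
      qed
      ultimately show ?thesis by blast
    qed
  qed
qed

end

section \<open>Deviations of the estimators\<close>

text \<open>\<open>stopped_block_bound\<close> for an event that is described by a condition on the whole sequence.\<close>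

lemma stopped_event_bound:
  fixes g :: "(nat \<Rightarrow> real) \<Rightarrow> 'i" and bad :: "(nat \<Rightarrow> real) \<Rightarrow> bool"
  assumes fin: "finite I"
    and meas: "\<And>i. i \<in> I \<Longrightarrow> {\<xi>. g \<xi> = i} \<in> sets noise"
    and loc: "\<And>i \<xi> \<xi>'. i \<in> I \<Longrightarrow> g \<xi> = i \<Longrightarrow> (\<And>j. j < t i \<Longrightarrow> \<xi> j = \<xi>' j) \<Longrightarrow> g \<xi>' = i"
    and ex: "\<And>i. i \<in> I \<Longrightarrow> \<exists>D. D \<in> sets noise \<and> noise.prob D \<le> p \<and>
      (\<forall>\<xi>. g \<xi> = i \<longrightarrow> (bad \<xi> \<longleftrightarrow> future (t i) \<xi> \<in> D))"
    and outside: "\<And>\<xi>. g \<xi> \<notin> I \<Longrightarrow> \<not> bad \<xi>"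
    and p0: "0 \<le> p"
  shows "{\<xi>. bad \<xi>} \<in> sets noise \<and> noise.prob {\<xi>. bad \<xi>} \<le> p"
proof -
  obtain D where D: "\<And>i. i \<in> I \<Longrightarrow> D i \<in> sets noise" "\<And>i. i \<in> I \<Longrightarrow> noise.prob (D i) \<le> p"
    "\<And>i \<xi>. i \<in> I \<Longrightarrow> g \<xi> = i \<Longrightarrow> bad \<xi> \<longleftrightarrow> future (t i) \<xi> \<in> D i"
    using ex by metis
  have "{\<xi>. bad \<xi>} = {\<xi>. g \<xi> \<in> I \<and> future (t (g \<xi>)) \<xi> \<in> D (g \<xi>)}"
    using D(3) outside by blast
  moreover have "{\<xi>. g \<xi> \<in> I \<and> future (t (g \<xi>)) \<xi> \<in> D (g \<xi>)} \<in> sets noise \<and>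
    noise.prob {\<xi>. g \<xi> \<in> I \<and> future (t (g \<xi>)) \<xi> \<in> D (g \<xi>)} \<le> p"
  proof (rule stopped_block_bound[OF fin])
    show "{\<xi>. g \<xi> = i} \<in> sets noise" if "i \<in> I" for i by (rule meas[OF that])
    show "g \<xi>' = i" if "i \<in> I" "g \<xi> = i" "\<And>j. j < t i \<Longrightarrow> \<xi> j = \<xi>' j" for i \<xi> \<xi>'
      by (rule loc[OF that])
    show "D i \<in> sets noise" "noise.prob (D i) \<le> p" if "i \<in> I" for i by (rule D[OF that])+
  qed (rule p0)
  ultimately show ?thesis by simp
qed

context bandit_run
begin

definition \<theta>s :: rvec where "\<theta>s = \<gamma> @\<^sub>v vec 1 (\<lambda>_. \<omega>)"

lemma \<theta>s_carrier: "\<theta>s \<in> carrier_vec n"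
  unfolding \<theta>s_def using \<gamma>_carrier by (intro append_carrier_vec) auto

lemma feat_\<theta>s:
  assumes "x \<in> carrier_vec (dimn B)"
  shows "feat B x \<bullet> \<theta>s = x \<bullet> \<gamma> + of_int (grp B x) * \<omega>"
  unfolding feat_def \<theta>s_def
  by (subst scalar_prod_append[OF assms _ \<gamma>_carrier, of _ 1]) (auto simp: scalar_prod_def)

lemma e_last_\<theta>s: "e_last B \<bullet> \<theta>s = \<omega>"
  using \<theta>s_carrier \<gamma>_carrier unfolding e_last_def \<theta>s_def by simp

lemma play_obs:
  assumes "set zs \<subseteq> acts B"
  shows "play (obs \<xi>) h zs
    = map (\<lambda>j. (zs ! j, feat B (zs ! j) \<bullet> \<theta>s + \<xi> (length h + j))) [0..<length zs]"
proof -
  have "obs \<xi> t (zs ! j) = feat B (zs ! j) \<bullet> \<theta>s + \<xi> t" if "j < length zs" for j t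
  proof -
    have "zs ! j \<in> carrier_vec (dimn B)" using assms that acts_carrier nth_mem by blast
    then show ?thesis by (simp add: observe_def feat_\<theta>s)
  qed
  then show ?thesis unfolding play_def by simp
qed

text \<open>Holds trivially if the step does not sample, so that the exceptional events below only concern
  blocks that are completed.\<close>

definition group_good :: "nat \<Rightarrow> int \<Rightarrow> (nat \<Rightarrow> real) \<Rightarrow> fpe_state \<Rightarrow> bool" where
  "group_good l z \<xi> s \<longleftrightarrow> (z \<noteq> - best_grp s \<longrightarrow>
     length (hist s) + sum (gcount l (cand s z)) (cand s z) \<le> T \<longrightarrow>
     (\<forall>x\<in>cand s z. \<bar>feat B x \<bullet> least_squares B (cand s z) (gcount l (cand s z))
        (play (obs \<xi>) (hist s) (schedule c l (gcount l (cand s z)))) - feat B x \<bullet> \<theta>s\<bar> \<le> eps l))"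

definition bias_good :: "nat \<Rightarrow> (nat \<Rightarrow> real) \<Rightarrow> fpe_state \<Rightarrow> bool" where
  "bias_good l \<xi> s \<longleftrightarrow> (best_grp s = 0 \<longrightarrow> \<not> recovers B T l (est_gap s) \<longrightarrow>
     \<not> T < length (hist s) + sum (bcount l (est_gap s)) (acts B) \<longrightarrow>
     \<bar>e_last B \<bullet> least_squares B (acts B) (bcount l (est_gap s))
        (play (obs \<xi>) (hist s) (schedule c l (bcount l (est_gap s)))) - \<omega>\<bar> \<le> eps l)"

text \<open>The sample sizes exceed the design \<open>p\<close> by the factor \<open>2 * r * L / (eps l)\<^sup>2\<close>. This divides the
  variance \<open>r\<close> of the design by the same factor and leaves \<open>(eps l)\<^sup>2 / (2 * L)\<close>, the largest variance
  for which a deviation of \<open>eps l\<close> has probability at most \<open>2 * exp (- L)\<close>.\<close>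

lemma estimation_error:
  assumes S: "S \<subseteq> acts B" and \<mu>: "{x. \<mu> x \<noteq> 0} \<subseteq> S"
    and u: "u \<in> carrier_vec n" and L: "0 < L" and r: "0 < r"
    and q: "\<And>a. a \<in> carrier_vec n \<Longrightarrow> (a \<bullet> u)\<^sup>2 \<le> r * gram_form S p (feat B) a"
    and ge: "\<And>x. x \<in> S \<Longrightarrow> 2 * r * p x / (eps l)\<^sup>2 * L \<le> real (\<mu> x)"
  shows "\<exists>w. (\<Sum>j<length (schedule c l \<mu>). (w j)\<^sup>2) * (2 * L) \<le> (eps l)\<^sup>2 \<and>
    (\<forall>\<xi> h. u \<bullet> least_squares B S \<mu> (play (obs \<xi>) h (schedule c l \<mu>)) - u \<bullet> \<theta>s
       = (\<Sum>j<length (schedule c l \<mu>). w j * \<xi> (length h + j)))"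
proof -
  define zs where "zs = schedule c l \<mu>"
  have zs: "set zs \<subseteq> S" unfolding zs_def by (rule schedule_facts(1)[OF S \<mu>])
  have cnt: "\<mu> x = count_list zs x" for x
    unfolding zs_def by (rule schedule_count[symmetric]) (use \<mu> S in blast)
  define k where "k = (eps l)\<^sup>2 / (2 * L)"
  have k: "0 < k" unfolding k_def using L by simp
  have var: "(a \<bullet> u)\<^sup>2 \<le> k * gram_form S (\<lambda>x. real (\<mu> x)) (feat B) a" if a: "a \<in> carrier_vec n" for a
  proof -
    have "r * gram_form S p (feat B) a = (\<Sum>x\<in>S. k * (2 * r * p x / (eps l)\<^sup>2 * L) * (a \<bullet> feat B x)\<^sup>2)"
      unfolding gram_form_def sum_distrib_left using L by (intro sum.cong) (auto simp: k_def)
    also have "\<dots> \<le> (\<Sum>x\<in>S. k * real (\<mu> x) * (a \<bullet> feat B x)\<^sup>2)"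
      using ge k by (intro sum_mono mult_right_mono mult_left_mono) auto
    also have "\<dots> = k * gram_form S (\<lambda>x. real (\<mu> x)) (feat B) a"
      unfolding gram_form_def sum_distrib_left by (simp add: mult.assoc)
    finally show ?thesis using q[OF a] by linarith
  qed
  have "finite S" using S finite_subset[OF _ finite_acts] by blast
  moreover have "S \<subseteq> carrier_vec (dimn B)" using S acts_carrier by blast
  ultimately have "\<exists>w :: nat \<Rightarrow> real. (\<Sum>j<length zs. (w j)\<^sup>2) \<le> k \<and>
    (\<forall>\<theta>\<in>carrier_vec n. \<forall>\<eta>.
       u \<bullet> least_squares B S \<mu> (map (\<lambda>j. (zs ! j, feat B (zs ! j) \<bullet> \<theta> + \<eta> j)) [0..<length zs])
       = u \<bullet> \<theta> + (\<Sum>j<length zs. w j * \<eta> j))"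
    by (intro least_squares_error zs cnt u less_imp_le[OF k] var)
  then obtain w :: "nat \<Rightarrow> real" where w: "(\<Sum>j<length zs. (w j)\<^sup>2) \<le> k"
    "\<And>\<theta> \<eta>. \<theta> \<in> carrier_vec n \<Longrightarrow>
       u \<bullet> least_squares B S \<mu> (map (\<lambda>j. (zs ! j, feat B (zs ! j) \<bullet> \<theta> + \<eta> j)) [0..<length zs])
       = u \<bullet> \<theta> + (\<Sum>j<length zs. w j * \<eta> j)" by blast
  have "u \<bullet> least_squares B S \<mu> (play (obs \<xi>) h zs) - u \<bullet> \<theta>s = (\<Sum>j<length zs. w j * \<xi> (length h + j))" for \<xi> h
    using w(2)[OF \<theta>s_carrier, of "\<lambda>j. \<xi> (length h + j)"] play_obs[of zs \<xi> h] zs S by auto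
  moreover have "(\<Sum>j<length zs. (w j)\<^sup>2) * (2 * L) \<le> (eps l)\<^sup>2"
    using mult_right_mono[OF w(1), of "2 * L"] L unfolding k_def by simp
  ultimately show ?thesis unfolding zs_def by blast
qed

lemma block_deviation:
  assumes "(\<Sum>j<m. (w j)\<^sup>2) * (2 * L) \<le> (eps l)\<^sup>2" "0 < L"
  shows "{\<eta>. \<bar>\<Sum>j<m. w j * \<eta> j\<bar> > eps l} \<in> sets noise"
    "noise.prob {\<eta>. \<bar>\<Sum>j<m. w j * \<eta> j\<bar> > eps l} \<le> 2 * exp (- L)"
proof -
  have "{\<eta> \<in> space noise. \<bar>\<Sum>j<m. w j * \<eta> j\<bar> > eps l} \<in> sets noise" by measurable
  then show "{\<eta>. \<bar>\<Sum>j<m. w j * \<eta> j\<bar> > eps l} \<in> sets noise" by simp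
  show "noise.prob {\<eta>. \<bar>\<Sum>j<m. w j * \<eta> j\<bar> > eps l} \<le> 2 * exp (- L)"
    by (rule noise_tail[OF order_refl]) (use assms in auto)
qed

definition adapted :: "((nat \<Rightarrow> real) \<Rightarrow> fpe_state) \<Rightarrow> bool" where
  "adapted s \<longleftrightarrow> (\<forall>\<xi>. valid_state \<xi> (s \<xi>)) \<and> local_process s \<and> measurable_process s"

lemma adapted_group_step:
  assumes "adapted s" "z \<in> {-1, 1}" shows "adapted (\<lambda>\<xi>. gstep \<xi> l z (s \<xi>))"
  using assms valid_group_step measurable_group_step local_process_step[OF _ extends_group_step]
  unfolding adapted_def by blast

lemma adapted_bias_step:
  assumes "adapted s" shows "adapted (\<lambda>\<xi>. bstep \<xi> l (s \<xi>))"
  using assms valid_bias_step measurable_bias_step local_process_step[OF _ extends_bias_step]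
  unfolding adapted_def by blast

lemma adapted_init: "adapted (\<lambda>_. fpe_init B)"
proof -
  have "measurable_process (\<lambda>_. fpe_init B)"
    unfolding measurable_process_def fpe_init_def by auto
  then show ?thesis using valid_init unfolding adapted_def local_process_def by auto
qed

lemma level_set_measurable:
  assumes "g \<in> measurable noise (count_space I)" "i \<in> I"
  shows "{\<xi>. g \<xi> = i} \<in> sets noise"
proof -
  have "{\<xi>. g \<xi> = i} = g -` {i} \<inter> space noise" by auto
  then show ?thesis using measurable_sets[OF assms(1), of "{i}"] assms(2) by simp
qed

text \<open>Here \<open>L = log (k l (l + 1) / \<delta>)\<close>, and the union bound over the at most \<open>k\<close> actions of the group turns
  \<open>2 * exp (- L)\<close> into \<open>2 * \<delta> / (l (l + 1))\<close>.\<close>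

lemma group_bad_prob:
  assumes ad: "adapted s" and z: "z \<in> {-1, 1}" and l: "1 \<le> l"
  shows "{\<xi>. \<not> group_good l z \<xi> (s \<xi>)} \<in> sets noise \<and>
    noise.prob {\<xi>. \<not> group_good l z \<xi> (s \<xi>)} \<le> 2 * \<delta> / (real l * (real l + 1))"
proof (rule stopped_event_bound)
  have v: "valid_state \<xi> (s \<xi>)" for \<xi> using ad unfolding adapted_def by blast
  have m: "measurable_process s" using ad unfolding adapted_def by blast
  let ?g = "\<lambda>\<xi>. (best_grp (s \<xi>), map fst (hist (s \<xi>)), cand (s \<xi>) z)"
  let ?I = "{-1, 0, 1 :: int} \<times> ({ys. set ys \<subseteq> acts B \<and> length ys \<le> T} \<times> Pow (acts B))"
  let ?J = "UNIV \<times> (lists (acts B) \<times> Pow (acts B)) :: (int \<times> rvec list \<times> rvec set) set"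
  let ?t = "\<lambda>i :: int \<times> rvec list \<times> rvec set. length (fst (snd i))"
  let ?p = "2 * \<delta> / (real l * (real l + 1))"
  show "finite ?I" using finite_lists_length_le[OF finite_acts, of T] by auto
  have gm: "?g \<in> measurable noise (count_space ?J)"
    by (intro measurable_pair_count_space)
      (use m z countable_lists_acts in \<open>auto simp: measurable_process_def countable_finite\<close>)
  show "{\<xi>. ?g \<xi> = i} \<in> sets noise" if "i \<in> ?I" for i
    by (rule level_set_measurable[OF gm]) (use that in auto)
  have gI: "?g \<xi> \<in> ?I" for \<xi>
    using validD(6,7,8)[OF v[of \<xi>]] validD(3)[OF v[of \<xi>] z] by auto
  then show "\<not> \<not> group_good l z \<xi> (s \<xi>)" if "?g \<xi> \<notin> ?I" for \<xi> using that by blast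
  show "0 \<le> ?p" by simp
  have len: "length (hist (s \<xi>)) = ?t i" if "?g \<xi> = i" for \<xi> i using that by auto
  show "?g \<xi>' = i" if "?g \<xi> = i" "\<And>j. j < ?t i \<Longrightarrow> \<xi> j = \<xi>' j" for i \<xi> \<xi>'
  proof -
    have "s \<xi>' = s \<xi>" using ad that(2) len[OF that(1)] unfolding adapted_def local_process_def by auto
    then show ?thesis using that(1) by simp
  qed
  fix i assume i: "i \<in> ?I"
  show "\<exists>D. D \<in> sets noise \<and> noise.prob D \<le> ?p \<and>
      (\<forall>\<xi>. ?g \<xi> = i \<longrightarrow> (\<not> group_good l z \<xi> (s \<xi>) \<longleftrightarrow> future (?t i) \<xi> \<in> D))"
  proof (cases "\<exists>\<xi>. ?g \<xi> = i \<and> \<not> group_good l z \<xi> (s \<xi>)")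
    case False
    then show ?thesis by (intro exI[of _ "{}"]) auto
  next
    case True
    then obtain \<xi>0 where \<xi>0: "?g \<xi>0 = i" "\<not> group_good l z \<xi>0 (s \<xi>0)" by blast
    obtain b ys S where ib: "i = (b, ys, S)" by (cases i)
    have S: "S \<noteq> {}" "S \<subseteq> acts B" "finite S"
      using \<xi>0 validD(1,3,4)[OF v[of \<xi>0] z] unfolding ib by auto
    have ex: "z \<noteq> - b" "length ys + sum (gcount l S) S \<le> T"
      using \<xi>0 len[OF \<xi>0(1)] unfolding ib group_good_def by auto
    define L where "L = ln (real (card (acts B)) * real l * (real l + 1) / \<delta>)"
    have L: "0 < L" unfolding L_def by (rule group_log_pos(1)[OF l])
    define zs where "zs = schedule c l (gcount l S)"
    have "\<exists>w. (\<Sum>j<length zs. (w j)\<^sup>2) * (2 * L) \<le> (eps l)\<^sup>2 \<and>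
      (\<forall>\<xi> h. feat B x \<bullet> least_squares B S (gcount l S) (play (obs \<xi>) h zs) - feat B x \<bullet> \<theta>s
       = (\<Sum>j<length zs. w j * \<xi> (length h + j)))" if x: "x \<in> S" for x
      unfolding zs_def
    proof (rule estimation_error[where p = "g_design c l S" and r = "real n"])
      show "(a \<bullet> feat B x)\<^sup>2 \<le> real n * gram_form S (g_design c l S) (feat B) a" if "a \<in> carrier_vec n" for a
        using G_optimal_bound[OF g_design_optimal[OF S(1,2)] S(3,1) _ x that] S(2) acts_carrier
        by (simp add: add.commute)
      show "2 * real n * g_design c l S y / (eps l)\<^sup>2 * L \<le> real (gcount l S y)" if "y \<in> S" for y
        unfolding L_def by (rule gcount_ge[OF that])
      show "feat B x \<in> carrier_vec n" using x S acts_carrier by auto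
    qed (use S L gcount_support in auto)
    then have "\<forall>x\<in>S. \<exists>w. (\<Sum>j<length zs. (w j)\<^sup>2) * (2 * L) \<le> (eps l)\<^sup>2 \<and>
      (\<forall>\<xi> h. feat B x \<bullet> least_squares B S (gcount l S) (play (obs \<xi>) h zs) - feat B x \<bullet> \<theta>s
       = (\<Sum>j<length zs. w j * \<xi> (length h + j)))" by blast
    from bchoice[OF this]
    obtain w where w: "\<And>x. x \<in> S \<Longrightarrow> (\<Sum>j<length zs. (w x j)\<^sup>2) * (2 * L) \<le> (eps l)\<^sup>2"
      "\<And>x \<xi> h. x \<in> S \<Longrightarrow> feat B x \<bullet> least_squares B S (gcount l S) (play (obs \<xi>) h zs) - feat B x \<bullet> \<theta>s
       = (\<Sum>j<length zs. w x j * \<xi> (length h + j))" by blast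
    define D where "D = (\<lambda>x. {\<eta>. \<bar>\<Sum>j<length zs. w x j * \<eta> j\<bar> > eps l})"
    have D: "D x \<in> sets noise" "noise.prob (D x) \<le> 2 * exp (- L)" if "x \<in> S" for x
      unfolding D_def by (rule block_deviation[OF w(1)[OF that] L])+
    have "noise.prob (\<Union>x\<in>S. D x) \<le> (\<Sum>x\<in>S. noise.prob (D x))"
      by (rule noise.finite_measure_subadditive_finite[OF S(3)]) (use D in auto)
    also have "\<dots> \<le> (\<Sum>x\<in>S. 2 * exp (- L))" by (intro sum_mono D)
    also have "\<dots> = real (card S) * (2 * exp (- L))" by simp
    also have "\<dots> \<le> real (card (acts B)) * (2 * exp (- L))"
      using card_mono[OF finite_acts S(2)] by (intro mult_right_mono) auto
    also have "\<dots> = ?p"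
    proof -
      have "exp L = real (card (acts B)) * real l * (real l + 1) / \<delta>"
        unfolding L_def using card_acts l T_pos by (intro exp_ln) (auto intro!: mult_pos_pos)
      then have "exp L = real (card (acts B)) * (real l * (real l + 1) / \<delta>)" by simp
      moreover have "real (card (acts B)) * (2 * inverse (real (card (acts B)) * M)) = 2 / M" for M
        using acts_nonempty by (simp add: field_simps)
      moreover have "?p = 2 / (real l * (real l + 1) / \<delta>)" by simp
      ultimately show ?thesis by (simp only: exp_minus)
    qed
    finally have pD: "noise.prob (\<Union>x\<in>S. D x) \<le> ?p" .
    have "\<not> group_good l z \<xi> (s \<xi>) \<longleftrightarrow> future (?t i) \<xi> \<in> (\<Union>x\<in>S. D x)" if g: "?g \<xi> = i" for \<xi>
    proof -
      have e: "best_grp (s \<xi>) = b" "cand (s \<xi>) z = S" "length (hist (s \<xi>)) = length ys"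
        using g len[OF g] unfolding ib by auto
      have "group_good l z \<xi> (s \<xi>) \<longleftrightarrow> (\<forall>x\<in>S. \<bar>\<Sum>j<length zs. w x j * \<xi> (length ys + j)\<bar> \<le> eps l)"
        unfolding group_good_def e zs_def[symmetric] using ex w(2) e(3) by simp
      then show ?thesis unfolding D_def ib by (auto simp: future_def not_le)
    qed
    moreover have "(\<Union>x\<in>S. D x) \<in> sets noise" using D S(3) by (intro sets.finite_UN) auto
    ultimately show ?thesis using pD by blast
  qed
qed

lemma bias_bad_prob:
  assumes ad: "adapted s" and l: "1 \<le> l"
  shows "{\<xi>. \<not> bias_good l \<xi> (s \<xi>)} \<in> sets noise \<and>
    noise.prob {\<xi>. \<not> bias_good l \<xi> (s \<xi>)} \<le> 2 * \<delta> / (real l * (real l + 1))"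
proof (rule stopped_event_bound)
  have v: "valid_state \<xi> (s \<xi>)" for \<xi> using ad unfolding adapted_def by blast
  have m: "measurable_process s" using ad unfolding adapted_def by blast
  let ?g = "\<lambda>\<xi>. bias_index l (s \<xi>)"
  let ?I = "{-1, 0, 1 :: int} \<times> {ys. set ys \<subseteq> acts B \<and> length ys \<le> T} \<times> Pow (acts B) \<times> Pow (acts B) \<times>
    (UNIV :: bool set) \<times> (acts B \<rightarrow>\<^sub>E {..T})"
  let ?t = "\<lambda>i :: int \<times> rvec list \<times> rvec set \<times> rvec set \<times> bool \<times> (rvec \<Rightarrow> nat). length (fst (snd i))"
  let ?p = "2 * \<delta> / (real l * (real l + 1))"
  show "finite ?I" using finite_lists_length_le[OF finite_acts, of T] by (intro finite_cartesian_product finite_PiE) auto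
  show "{\<xi>. ?g \<xi> = i} \<in> sets noise" if "i \<in> ?I" for i
    by (rule level_set_measurable[OF measurable_bias_index[OF v m]])
      (use that in \<open>auto simp: bias_indices_def PiE_iff\<close>)
  show "\<not> \<not> bias_good l \<xi> (s \<xi>)" if "?g \<xi> \<notin> ?I" for \<xi>
  proof
    assume "\<not> bias_good l \<xi> (s \<xi>)"
    then have le: "sum (bcount l (est_gap (s \<xi>))) (acts B) \<le> T" unfolding bias_good_def by auto
    have "bcount l (est_gap (s \<xi>)) x \<le> T" if "x \<in> acts B" for x
      using member_le_sum[of x "acts B" "bcount l (est_gap (s \<xi>))"] that le by simp
    then have "?g \<xi> \<in> ?I"
      using validD(6,7,8)[OF v[of \<xi>]] validD(3)[OF v[of \<xi>], of 1] validD(3)[OF v[of \<xi>], of "-1"]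
      unfolding bias_index_def by auto
    then show False using that by blast
  qed
  show "0 \<le> ?p" by simp
  have len: "length (hist (s \<xi>)) = ?t i" if "?g \<xi> = i" for \<xi> i using that unfolding bias_index_def by auto
  show "?g \<xi>' = i" if "?g \<xi> = i" "\<And>j. j < ?t i \<Longrightarrow> \<xi> j = \<xi>' j" for i \<xi> \<xi>'
  proof -
    have "s \<xi>' = s \<xi>" using ad that(2) len[OF that(1)] unfolding adapted_def local_process_def by auto
    then show ?thesis using that(1) by simp
  qed
  fix i assume i: "i \<in> ?I"
  show "\<exists>D. D \<in> sets noise \<and> noise.prob D \<le> ?p \<and>
      (\<forall>\<xi>. ?g \<xi> = i \<longrightarrow> (\<not> bias_good l \<xi> (s \<xi>) \<longleftrightarrow> future (?t i) \<xi> \<in> D))"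
  proof (cases "\<exists>\<xi>. ?g \<xi> = i \<and> \<not> bias_good l \<xi> (s \<xi>)")
    case False
    then show ?thesis by (intro exI[of _ "{}"]) auto
  next
    case True
    then obtain \<xi>0 where \<xi>0: "?g \<xi>0 = i" "\<not> bias_good l \<xi>0 (s \<xi>0)" by blast
    obtain b ys C1 C2 r \<nu> where ib: "i = (b, ys, C1, C2, r, \<nu>)" by (cases i)
    define D0 where "D0 = est_gap (s \<xi>0)"
    define \<mu> where "\<mu> = bcount l D0"
    have ex: "b = 0" "\<not> r" "\<not> T < length ys + sum \<mu> (acts B)"
      using \<xi>0 len[OF \<xi>0(1)] unfolding ib bias_good_def bias_index_def \<mu>_def D0_def by auto
    define L where "L = ln (real l * (real l + 1) / \<delta>)"
    have L: "0 < L" unfolding L_def by (rule group_log_pos(2)[OF l])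
    define zs where "zs = schedule c l \<mu>"
    have uv: "gap_design c l D0 \<in> unit_variance_measures B"
      using gap_design_optimal[of D0 l] validD(9)[OF v[of \<xi>0]] unfolding gap_optimal_def D0_def by blast
    have "\<exists>w. (\<Sum>j<length zs. (w j)\<^sup>2) * (2 * L) \<le> (eps l)\<^sup>2 \<and>
      (\<forall>\<xi> h. e_last B \<bullet> least_squares B (acts B) \<mu> (play (obs \<xi>) h zs) - e_last B \<bullet> \<theta>s
       = (\<Sum>j<length zs. w j * \<xi> (length h + j)))"
      unfolding zs_def
    proof (rule estimation_error[where p = "gap_design c l D0" and r = 1])
      show "(a \<bullet> e_last B)\<^sup>2 \<le> 1 * gram_form (acts B) (gap_design c l D0) (feat B) a" if "a \<in> carrier_vec n" for a
        using unit_variance_bound[OF uv finite_acts acts_carrier that] by simp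
      show "2 * 1 * gap_design c l D0 y / (eps l)\<^sup>2 * L \<le> real (\<mu> y)" if "y \<in> acts B" for y
        unfolding L_def \<mu>_def using bcount_ge[OF that, of l D0] by simp
    qed (use L bcount_support in \<open>auto simp: \<mu>_def\<close>)
    then obtain w where w: "(\<Sum>j<length zs. (w j)\<^sup>2) * (2 * L) \<le> (eps l)\<^sup>2"
      "\<And>\<xi> h. e_last B \<bullet> least_squares B (acts B) \<mu> (play (obs \<xi>) h zs) - \<omega>
       = (\<Sum>j<length zs. w j * \<xi> (length h + j))" unfolding e_last_\<theta>s by blast
    define D where "D = {\<eta>. \<bar>\<Sum>j<length zs. w j * \<eta> j\<bar> > eps l}"
    have D: "D \<in> sets noise" "noise.prob D \<le> 2 * exp (- L)"
      unfolding D_def by (rule block_deviation[OF w(1) L])+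
    have "2 * exp (- L) = ?p"
    proof -
      have "exp L = real l * (real l + 1) / \<delta>"
        unfolding L_def using l T_pos by (intro exp_ln) (auto intro!: mult_pos_pos)
      then show ?thesis using l T_pos by (simp add: exp_minus field_simps)
    qed
    then have pD: "noise.prob D \<le> ?p" using D(2) by (simp only:)
    have "\<not> bias_good l \<xi> (s \<xi>) \<longleftrightarrow> future (?t i) \<xi> \<in> D" if g: "?g \<xi> = i" for \<xi>
    proof -
      have "restrict (bcount l (est_gap (s \<xi>))) (acts B) = restrict \<mu> (acts B)"
        using g \<xi>0(1) unfolding \<mu>_def D0_def bias_index_def by auto
      from fun_cong[OF this] have "x \<in> acts B \<Longrightarrow> bcount l (est_gap (s \<xi>)) x = \<mu> x" for x
        by (metis restrict_apply')
      moreover have "x \<notin> acts B \<Longrightarrow> bcount l (est_gap (s \<xi>)) x = \<mu> x" for x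
        by (simp add: \<mu>_def bias_count_def)
      ultimately have "bcount l (est_gap (s \<xi>)) = \<mu>" by (intro ext) blast
      moreover have "best_grp (s \<xi>) = b" "recovers B T l (est_gap (s \<xi>)) = r" "length (hist (s \<xi>)) = length ys"
        using g len[OF g] unfolding ib bias_index_def by auto
      ultimately have "bias_good l \<xi> (s \<xi>) \<longleftrightarrow> \<bar>\<Sum>j<length zs. w j * \<xi> (length ys + j)\<bar> \<le> eps l"
        unfolding bias_good_def using ex w(2) by (simp add: zs_def)
      then show ?thesis unfolding D_def ib by (auto simp: future_def not_le)
    qed
    then show ?thesis using pD D by blast
  qed
qed

end

section \<open>Gaps and the elimination step\<close>

lemma eps_Suc: "eps (Suc l) = eps l / 2"
proof -
  have "eps (Suc l) = 2 powi ((2 - int l) + (- 1))" unfolding eps_def by simp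
  also have "\<dots> = 2 powi (2 - int l) * 2 powi (- 1)" by (rule power_int_add) simp
  finally show ?thesis unfolding eps_def by (simp add: power_int_minus)
qed

lemma eps_1: "eps 1 = 2" unfolding eps_def by simp

lemma eps_le_2: "1 \<le> l \<Longrightarrow> eps l \<le> 2"
proof (induction l rule: nat_induct_at_least)
  case base
  show ?case using eps_1 by simp
next
  case (Suc l)
  then show ?case using eps_pos[of l] by (simp add: eps_Suc)
qed

definition cum_gap :: "rvec \<Rightarrow> rvec \<Rightarrow> history \<Rightarrow> real" where
  "cum_gap \<gamma> xs h = (\<Sum>(x, y)\<leftarrow>h. gap \<gamma> xs x)"

lemma cum_gap_append: "cum_gap \<gamma> xs (h @ h') = cum_gap \<gamma> xs h + cum_gap \<gamma> xs h'"
  unfolding cum_gap_def by simp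

lemma cum_gap_play: "cum_gap \<gamma> xs (play ob h zs) = sum_list (map (gap \<gamma> xs) zs)"
proof -
  have "cum_gap \<gamma> xs h = sum_list (map (gap \<gamma> xs) (map fst h))" for h
    unfolding cum_gap_def by (induction h) auto
  from this[of "play ob h zs"] show ?thesis by (simp only: map_fst_play)
qed

lemma sum_list_le_length:
  fixes r :: real
  assumes "\<And>x. x \<in> set zs \<Longrightarrow> f x \<le> r"
  shows "sum_list (map f zs) \<le> real (length zs) * r"
  using assms by (induction zs) (auto simp: algebra_simps add_mono)

locale bandit_regret = bandit_run +
  fixes xs :: rvec
  assumes best: "is_unique_best B \<gamma> xs"
begin

abbreviation "\<Delta> \<equiv> gap \<gamma> xs"
abbreviation "zb \<equiv> grp B xs"
abbreviation "\<Delta>neq \<equiv> gap_neq B \<gamma> xs"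
abbreviation "\<Delta>min \<equiv> gap_min B \<gamma> xs"

lemma xs_in: "xs \<in> acts B" and xs_max: "x \<in> acts B \<Longrightarrow> x \<bullet> \<gamma> \<le> xs \<bullet> \<gamma>"
  and xs_unique: "x \<in> acts B \<Longrightarrow> x \<bullet> \<gamma> = xs \<bullet> \<gamma> \<Longrightarrow> x = xs"
proof -
  note b = best[unfolded is_unique_best_def]
  have m: "xs \<in> {x \<in> acts B. \<forall>x'\<in>acts B. x' \<bullet> \<gamma> \<le> x \<bullet> \<gamma>}" unfolding b by simp
  then show "xs \<in> acts B" and "x \<in> acts B \<Longrightarrow> x \<bullet> \<gamma> \<le> xs \<bullet> \<gamma>" for x by auto
  assume x: "x \<in> acts B" "x \<bullet> \<gamma> = xs \<bullet> \<gamma>"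
  then have "x \<in> {x \<in> acts B. \<forall>x'\<in>acts B. x' \<bullet> \<gamma> \<le> x \<bullet> \<gamma>}" using m by auto
  then show "x = xs" unfolding b by simp
qed

lemma gap_eq: "x \<in> acts B \<Longrightarrow> \<Delta> x = xs \<bullet> \<gamma> - x \<bullet> \<gamma>"
  unfolding gap_def using xs_in acts_carrier \<gamma>_carrier by (intro minus_scalar_prod_distrib) auto

lemma gap_nonneg: "x \<in> acts B \<Longrightarrow> 0 \<le> \<Delta> x"
  using gap_eq xs_max by simp

lemma gap_zero_iff: "x \<in> acts B \<Longrightarrow> \<Delta> x = 0 \<longleftrightarrow> x = xs"
  using gap_eq xs_unique xs_in by fastforce

lemma gap_pos: "x \<in> acts B \<Longrightarrow> x \<noteq> xs \<Longrightarrow> 0 < \<Delta> x"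
  using gap_nonneg gap_zero_iff by (metis order_less_le)

lemma gap_le_2: "x \<in> acts B \<Longrightarrow> \<Delta> x \<le> 2"
proof -
  have "\<bar>x \<bullet> \<gamma>\<bar> \<le> 1" if "x \<in> acts B" for x
  proof -
    have "\<bar>x \<bullet> \<gamma>\<bar> \<le> (MAX x\<in>acts B. \<bar>x \<bullet> \<gamma>\<bar>)" using that by (intro Max_ge) auto
    then show ?thesis using bandit unfolding biased_bandit_def by linarith
  qed
  from this[of x] this[of xs] show "x \<in> acts B \<Longrightarrow> \<Delta> x \<le> 2" using gap_eq xs_in by fastforce
qed

lemma zb_values: "zb = -1 \<or> zb = 1" using grp_values[OF xs_in] .

lemma gap_neq_le: "x \<in> acts B \<Longrightarrow> grp B x = - zb \<Longrightarrow> \<Delta>neq \<le> \<Delta> x"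
  unfolding gap_neq_def by (intro Min_le) auto

lemma gap_neq_attained: "\<exists>x\<in>acts B. grp B x = - zb \<and> \<Delta> x = \<Delta>neq"
proof -
  have "{x \<in> acts B. grp B x = - zb} \<noteq> {}" using group_nonempty[of "- zb"] zb_values by auto
  then have "\<Delta>neq \<in> \<Delta> ` {x \<in> acts B. grp B x = - zb}" unfolding gap_neq_def by (intro Min_in) auto
  then show ?thesis by auto
qed

lemma gap_neq_pos: "0 < \<Delta>neq"
proof -
  obtain x where x: "x \<in> acts B" "grp B x = - zb" "\<Delta> x = \<Delta>neq" using gap_neq_attained by blast
  then have "x \<noteq> xs" using zb_values by auto
  then show ?thesis using gap_pos x by fastforce
qed

lemma gap_min_le: "x \<in> acts B \<Longrightarrow> x \<noteq> xs \<Longrightarrow> \<Delta>min \<le> \<Delta> x"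
  unfolding gap_min_def by (intro Min_le) auto

lemma gap_min_le_neq: "\<Delta>min \<le> \<Delta>neq"
proof -
  obtain x where x: "x \<in> acts B" "grp B x = - zb" "\<Delta> x = \<Delta>neq" using gap_neq_attained by blast
  then have "x \<noteq> xs" using zb_values by auto
  then show ?thesis using gap_min_le x by fastforce
qed

lemma gap_min_pos: "0 < \<Delta>min"
proof -
  obtain x where x: "x \<in> acts B" "grp B x = - zb" using gap_neq_attained by blast
  then have "acts B - {xs} \<noteq> {}" using zb_values by auto
  then have "\<Delta>min \<in> \<Delta> ` (acts B - {xs})" unfolding gap_min_def by (intro Min_in) auto
  then obtain y where "y \<in> acts B" "y \<noteq> xs" "\<Delta>min = \<Delta> y" by auto
  then show ?thesis using gap_pos by simp
qed

lemma gap_neq_le_2: "\<Delta>neq \<le> 2"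
  using gap_neq_attained gap_le_2 by fastforce

text \<open>The gap of the best action of group \<open>z\<close>.\<close>

definition base :: "int \<Rightarrow> real" where
  "base z = (if z = zb then 0 else \<Delta>neq)"

lemma base_le: "x \<in> acts B \<Longrightarrow> base (grp B x) \<le> \<Delta> x"
  using gap_neq_le[of x] gap_nonneg[of x] grp_values[of x] zb_values unfolding base_def by auto

lemma base_attained:
  assumes "z \<in> {-1, 1}" shows "\<exists>x\<in>acts B. grp B x = z \<and> \<Delta> x = base z"
proof (cases "z = zb")
  case True
  then show ?thesis using xs_in gap_zero_iff[OF xs_in] unfolding base_def by auto
next
  case False
  then have "z = - zb" using zb_values assms by auto
  then show ?thesis using gap_neq_attained False unfolding base_def by auto
qed

definition group_tight :: "real \<Rightarrow> int \<Rightarrow> fpe_state \<Rightarrow> bool" where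
  "group_tight r z s \<longleftrightarrow> (\<exists>x\<in>cand s z. \<Delta> x = base z) \<and> (\<forall>x\<in>cand s z. \<Delta> x \<le> base z + r)"

text \<open>The estimated gap of an action is no longer updated once the action is eliminated. At that
  time its gap is at least the accuracy, so the error of its last estimate is bounded by a multiple of
  the gap itself.\<close>

definition gaps_accurate :: "nat \<Rightarrow> fpe_state \<Rightarrow> bool" where
  "gaps_accurate l s \<longleftrightarrow> (\<forall>x\<in>acts B. \<Delta> x \<le> est_gap s x \<and> eps l \<le> est_gap s x \<and>
     (if x \<in> cand s (grp B x) then est_gap s x \<le> \<Delta> x + 16 * eps l else est_gap s x \<le> 17 * \<Delta> x))"

text \<open>What holds before phase \<open>l\<close> if all estimates have been accurate. That the better group has
  not been identified in phase \<open>l - 1\<close> forces \<open>\<Delta>neq < 8 * eps (l - 1)\<close>, which is \<open>16 * eps l\<close>.\<close>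

definition phase_inv :: "nat \<Rightarrow> fpe_state \<Rightarrow> bool" where
  "phase_inv l s \<longleftrightarrow> (best_grp s = 0 \<or> best_grp s = zb) \<and>
     (\<forall>z\<in>{-1, 1}. z \<noteq> - best_grp s \<longrightarrow> group_tight (10 * eps l) z s) \<and>
     (best_grp s = 0 \<longrightarrow> \<Delta>neq < 16 * eps l \<and> gaps_accurate l s)"

lemma phase_inv_init: "phase_inv 1 (fpe_init B)"
proof -
  have "group_tight 20 z (fpe_init B)" if "z \<in> {-1, 1}" for z
    unfolding group_tight_def fpe_init_def
  proof (simp, intro conjI allI impI)
    show "\<exists>x. x \<in> acts B \<and> grp B x = z \<and> \<Delta> x = base z"
      using base_attained[OF that] by blast
    fix x assume x: "x \<in> acts B \<and> grp B x = z"
    have "0 \<le> base z" unfolding base_def using gap_neq_pos by auto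
    then show "\<Delta> x \<le> base z + 20" using gap_le_2[of x] x by linarith
  qed
  moreover have "gaps_accurate 1 (fpe_init B)"
    unfolding gaps_accurate_def eps_1 fpe_init_def using gap_le_2 gap_nonneg by fastforce
  ultimately show ?thesis unfolding phase_inv_def using gap_neq_le_2
    by (simp add: eps_1[unfolded One_nat_def] fpe_init_def)
qed

lemma feat_diff_\<theta>s:
  assumes "x \<in> acts B" "y \<in> acts B" "grp B x = grp B y"
  shows "feat B y \<bullet> \<theta>s - feat B x \<bullet> \<theta>s = \<Delta> x - \<Delta> y"
proof -
  have "x \<in> carrier_vec (dimn B)" "y \<in> carrier_vec (dimn B)" using assms acts_carrier by auto
  then show ?thesis using assms by (simp add: feat_\<theta>s gap_eq)
qed

definition accurate :: "nat \<Rightarrow> int \<Rightarrow> fpe_state \<Rightarrow> bool" where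
  "accurate l z s \<longleftrightarrow> (\<forall>x\<in>cand s z. \<bar>feat B x \<bullet> est s z - feat B x \<bullet> \<theta>s\<bar> \<le> eps l)"

text \<open>Estimated differences of features are correct up to \<open>2 * e\<close>. Hence the test with threshold \<open>3 * e\<close>
  keeps a best action, removes all actions that are worse than it by more than \<open>5 * e\<close>, and removes
  only actions that are worse than another one by at least \<open>e\<close>.\<close>

lemma elimination:
  assumes S: "S \<noteq> {}" "finite S" "S \<subseteq> {x \<in> acts B. grp B x = z}" and \<theta>: "\<theta> \<in> carrier_vec n"
    and acc: "\<And>x. x \<in> S \<Longrightarrow> \<bar>feat B x \<bullet> \<theta> - feat B x \<bullet> \<theta>s\<bar> \<le> e" and e: "0 < e"
    and bs: "b \<in> S" "\<Delta> b = base z"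
  defines "S' \<equiv> {x \<in> S. (MAX x'\<in>S. (feat B x' - feat B x) \<bullet> \<theta>) \<le> 3 * e}"
  shows "b \<in> S'" and "x \<in> S' \<Longrightarrow> \<Delta> x \<le> base z + 5 * e" and "x \<in> S - S' \<Longrightarrow> e \<le> \<Delta> x"
proof -
  have fc: "feat B x \<in> carrier_vec n" if "x \<in> S" for x using that S acts_carrier by auto
  have diff: "(feat B x' - feat B x) \<bullet> \<theta> = feat B x' \<bullet> \<theta> - feat B x \<bullet> \<theta>" if "x \<in> S" "x' \<in> S" for x x'
    using fc that \<theta> by (intro minus_scalar_prod_distrib) auto
  have le: "\<bar>(feat B x' - feat B x) \<bullet> \<theta> - (\<Delta> x - \<Delta> x')\<bar> \<le> 2 * e" if "x \<in> S" "x' \<in> S" for x x'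
  proof -
    have "feat B x' \<bullet> \<theta>s - feat B x \<bullet> \<theta>s = \<Delta> x - \<Delta> x'"
      by (rule feat_diff_\<theta>s) (use that S in auto)
    then show ?thesis using diff[OF that] acc[OF that(1)] acc[OF that(2)] by linarith
  qed
  have mem: "x \<in> S' \<longleftrightarrow> x \<in> S \<and> (\<forall>x'\<in>S. (feat B x' - feat B x) \<bullet> \<theta> \<le> 3 * e)" for x
    unfolding S'_def using S by (auto simp: Max_le_iff)
  show "b \<in> S'" unfolding mem
  proof (intro conjI ballI)
    fix x' assume x': "x' \<in> S"
    have "base z \<le> \<Delta> x'" using base_le[of x'] x' S by auto
    then show "(feat B x' - feat B b) \<bullet> \<theta> \<le> 3 * e" using le[OF bs(1) x'] bs(2) e by linarith
  qed (rule bs)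
  show "\<Delta> x \<le> base z + 5 * e" if "x \<in> S'"
    using that le[of x b] bs unfolding mem by fastforce
  show "e \<le> \<Delta> x" if x: "x \<in> S - S'"
  proof -
    obtain x' where x': "x' \<in> S" "(feat B x' - feat B x) \<bullet> \<theta> > 3 * e" using x by (auto simp: mem not_le)
    have "0 \<le> \<Delta> x'" using gap_nonneg x' S by auto
    then show ?thesis using le[of x x'] x x' by auto
  qed
qed

text \<open>At most \<open>26 * eps l\<close> for each of the rounds of a group step, since a sampled action is within \<open>10 * eps l\<close>
  of the best action of a group whose own gap is at most \<open>16 * eps l\<close>. If this is below \<open>\<Delta>min\<close>, the best action
  is the only one left.\<close>

definition gcost :: "nat \<Rightarrow> real" where
  "gcost l = (if \<Delta>min \<le> 26 * eps l then 26 * eps l *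
     (2 * real n * ln (real (card (acts B)) * real l * (real l + 1) / \<delta>) / (eps l)\<^sup>2 + (real n * (real n + 1)) / 2) else 0)"

lemma nat_ceiling_sum:
  fixes r :: "'b \<Rightarrow> real"
  assumes "finite S" "\<And>x. x \<in> S \<Longrightarrow> 0 \<le> r x"
  shows "real (\<Sum>x\<in>S. nat \<lceil>r x\<rceil>) \<le> sum r S + real (card {x \<in> S. r x \<noteq> 0})"
proof -
  have "real (nat \<lceil>r x\<rceil>) \<le> r x + (if r x \<noteq> 0 then 1 else 0)" if "x \<in> S" for x
    using assms(2)[OF that] by (auto simp: of_nat_nat)
  then have "real (\<Sum>x\<in>S. nat \<lceil>r x\<rceil>) \<le> (\<Sum>x\<in>S. r x + (if r x \<noteq> 0 then 1 else 0))"
    unfolding of_nat_sum by (rule sum_mono)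
  also have "\<dots> = sum r S + real (card {x \<in> S. r x \<noteq> 0})"
    using assms(1) by (simp add: sum.distrib sum.If_cases Int_def)
  finally show ?thesis .
qed

lemma gcount_sum_le:
  assumes "1 \<le> l" "S \<noteq> {}" "S \<subseteq> acts B"
  shows "real (sum (gcount l S) S) \<le>
    2 * real n * ln (real (card (acts B)) * real l * (real l + 1) / \<delta>) / (eps l)\<^sup>2 + (real n * (real n + 1)) / 2"
proof -
  have fin: "finite S" using finite_subset[OF assms(3)] by simp
  define L where "L = ln (real (card (acts B)) * real l * (real l + 1) / \<delta>)"
  have L: "0 < L" unfolding L_def by (rule group_log_pos(1)[OF assms(1)])
  define p where "p = g_design c l S"
  have p: "\<And>x. x \<in> S \<Longrightarrow> 0 \<le> p x" "sum p S = 1"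
    using g_design_optimal[OF assms(2,3), of l] unfolding G_optimal_def G_feasible_def prob_on_def p_def by auto
  define r where "r = (\<lambda>x. 2 * (real (dimn B) + 1) * p x / (eps l)\<^sup>2 * L)"
  have "real (sum (gcount l S) S) = real (\<Sum>x\<in>S. nat \<lceil>r x\<rceil>)"
    unfolding group_count_def r_def p_def L_def by simp
  also have "\<dots> \<le> sum r S + real (card {x \<in> S. r x \<noteq> 0})"
    by (rule nat_ceiling_sum[OF fin]) (use p L in \<open>auto simp: r_def\<close>)
  also have "{x \<in> S. r x \<noteq> 0} = {x \<in> S. p x \<noteq> 0}" unfolding r_def using L by auto
  also have "real (card {x \<in> S. p x \<noteq> 0}) \<le> (real n * (real n + 1)) / 2"
    using g_design_support[OF assms(2,3), of l] unfolding p_def by (simp add: algebra_simps)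
  also have "sum r S = (2 * (real (dimn B) + 1) / (eps l)\<^sup>2 * L) * sum p S"
    unfolding r_def sum_distrib_left by (intro sum.cong) auto
  also have "\<dots> = 2 * real n * L / (eps l)\<^sup>2" using p by (simp add: algebra_simps)
  finally show ?thesis unfolding L_def by simp
qed

lemma gcost_nonneg: "1 \<le> l \<Longrightarrow> 0 \<le> gcost l"
  unfolding gcost_def using group_log_pos(1)[of l] by (auto intro!: mult_nonneg_nonneg add_nonneg_nonneg divide_nonneg_nonneg less_imp_le[OF eps_pos])

text \<open>If the step runs out of rounds, fewer rounds remain than it was going to play, and the action played
  comes from the same set. So sampling and exhausting have the same cost bound.\<close>

lemma group_step_analysis:
  assumes v: "valid_state \<xi> s" and z: "z \<in> {-1, 1}" and l: "1 \<le> l"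
    and nb: "z \<noteq> - best_grp s" and tight: "group_tight (10 * eps l) z s"
    and bs: "base z \<le> 16 * eps l" and good: "group_good l z \<xi> s"
  defines "s' \<equiv> gstep \<xi> l z s"
  shows "cum_gap \<gamma> xs (hist s') \<le> cum_gap \<gamma> xs (hist s) + gcost l"
    and "length (hist s') < T \<Longrightarrow> group_tight (5 * eps l) z s' \<and> accurate l z s' \<and>
      (\<forall>x\<in>cand s z - cand s' z. eps l \<le> \<Delta> x) \<and> cand s' (- z) = cand s (- z) \<and> est s' (- z) = est s (- z)"
    and "best_grp s' = best_grp s" "est_gap s' = est_gap s"
proof -
  define S where "S = cand s z"
  define \<mu> where "\<mu> = gcount l S"
  define zs where "zs = schedule c l \<mu>"
  note S = validD(1-4)[OF v z, folded S_def]
  have zs: "set zs \<subseteq> S" "length zs = sum \<mu> S"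
    unfolding zs_def \<mu>_def using schedule_facts[OF S(3) gcount_support] by auto
  have gapS: "\<Delta> x \<le> (if \<Delta>min \<le> 26 * eps l then 26 * eps l else 0)" if x: "x \<in> S" for x
  proof -
    have "\<Delta> x \<le> 26 * eps l" using tight x bs unfolding group_tight_def S_def by fastforce
    moreover have "\<Delta> x = 0 \<or> \<Delta>min \<le> \<Delta> x"
      using gap_min_le[of x] gap_zero_iff[of x] x S(3) by auto
    ultimately show ?thesis by auto
  qed
  have cost: "sum_list (map \<Delta> ws) \<le> gcost l" if ws: "set ws \<subseteq> S" "length ws \<le> sum \<mu> S" for ws
  proof -
    have "sum_list (map \<Delta> ws) \<le> real (length ws) * (if \<Delta>min \<le> 26 * eps l then 26 * eps l else 0)"
      by (rule sum_list_le_length) (use ws gapS in auto)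
    also have "\<dots> \<le> (2 * real n * ln (real (card (acts B)) * real l * (real l + 1) / \<delta>) / (eps l)\<^sup>2 + (real n * (real n + 1)) / 2)
        * (if \<Delta>min \<le> 26 * eps l then 26 * eps l else 0)"
    proof (rule mult_right_mono)
      show "real (length ws) \<le> 2 * real n * ln (real (card (acts B)) * real l * (real l + 1) / \<delta>) / (eps l)\<^sup>2 + (real n * (real n + 1)) / 2"
        using ws(2) gcount_sum_le[OF l S(1,3)] unfolding \<mu>_def by linarith
    qed (auto intro: less_imp_le)
    also have "\<dots> = gcost l" unfolding gcost_def by (simp only: mult.commute if_distrib[of "(*) _"] mult_zero_right) simp
    finally show ?thesis .
  qed
  have "(length (hist s) + sum \<mu> S \<le> T \<and> s' = group_update B l z S (least_squares B S \<mu> (play (obs \<xi>) (hist s) zs))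
      (hist s @ play (obs \<xi>) (hist s) zs) s) \<or> (T < length (hist s) + sum \<mu> S \<and> s' = exhaust c T (obs \<xi>) S s)"
    unfolding s'_def group_step_unfold Let_def S_def zs_def \<mu>_def using nb by auto
  then have "cum_gap \<gamma> xs (hist s') \<le> cum_gap \<gamma> xs (hist s) + gcost l \<and>
     (length (hist s') < T \<longrightarrow> group_tight (5 * eps l) z s' \<and> accurate l z s' \<and>
      (\<forall>x\<in>cand s z - cand s' z. eps l \<le> \<Delta> x) \<and> cand s' (- z) = cand s (- z) \<and> est s' (- z) = est s (- z)) \<and>
     best_grp s' = best_grp s \<and> est_gap s' = est_gap s"
  proof (elim disjE conjE)
    assume le: "T < length (hist s) + sum \<mu> S" and s': "s' = exhaust c T (obs \<xi>) S s"
    have len: "length (hist s') = T" unfolding s' using validD(7)[OF v] by simp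
    have "set (replicate (T - length (hist s)) (emp_best c (hist s) S)) \<subseteq> S"
      using emp_best_in[OF S(1,3)] by (auto simp: set_replicate_conv_if)
    then have "sum_list (map \<Delta> (replicate (T - length (hist s)) (emp_best c (hist s) S))) \<le> gcost l"
      by (rule cost) (use le in simp)
    then show ?thesis using len unfolding s' hist_exhaust cum_gap_append cum_gap_play by simp
  next
    define \<theta> where "\<theta> = least_squares B S \<mu> (play (obs \<xi>) (hist s) zs)"
    assume le: "length (hist s) + sum \<mu> S \<le> T"
      and s': "s' = group_update B l z S (least_squares B S \<mu> (play (obs \<xi>) (hist s) zs)) (hist s @ play (obs \<xi>) (hist s) zs) s"
    note s' = s'[folded \<theta>_def]
    have acc: "\<bar>feat B x \<bullet> \<theta> - feat B x \<bullet> \<theta>s\<bar> \<le> eps l" if "x \<in> S" for x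
      using good nb le that unfolding group_good_def \<theta>_def zs_def \<mu>_def S_def by blast
    obtain b where b: "b \<in> S" "\<Delta> b = base z" using tight unfolding group_tight_def S_def by blast
    have \<theta>: "\<theta> \<in> carrier_vec n" unfolding \<theta>_def by (rule least_squares_carrier)
    note el = elimination[OF S(1,4,2) \<theta> acc eps_pos b]
    have c': "cand s' z = {x \<in> S. (MAX x'\<in>S. (feat B x' - feat B x) \<bullet> \<theta>) \<le> 3 * eps l}" unfolding s' by simp
    have "group_tight (5 * eps l) z s'" unfolding group_tight_def c' using el(1,2) b(2) by blast
    moreover have "accurate l z s'" unfolding accurate_def c' using acc unfolding s' by simp
    moreover have "\<forall>x\<in>cand s z - cand s' z. eps l \<le> \<Delta> x" unfolding c' S_def[symmetric] using el(3) by blast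
    moreover have "- z \<noteq> z" using z by auto
    moreover have "cum_gap \<gamma> xs (hist s') \<le> cum_gap \<gamma> xs (hist s) + gcost l"
      using cost[OF zs(1)] zs(2) unfolding s' group_update_select cum_gap_append cum_gap_play by simp
    ultimately show ?thesis unfolding s' by simp
  qed
  then show "cum_gap \<gamma> xs (hist s') \<le> cum_gap \<gamma> xs (hist s) + gcost l"
    and "length (hist s') < T \<Longrightarrow> group_tight (5 * eps l) z s' \<and> accurate l z s' \<and>
      (\<forall>x\<in>cand s z - cand s' z. eps l \<le> \<Delta> x) \<and> cand s' (- z) = cand s (- z) \<and> est s' (- z) = est s (- z)"
    and "best_grp s' = best_grp s" "est_gap s' = est_gap s" by blast+
qed

end

section \<open>The bias exploration step\<close>

context bandit_regret
begin

definition gap_floor :: "rvec \<Rightarrow> real" where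
  "gap_floor x = max (\<Delta> x) (max \<Delta>neq (eps_T B T))"

abbreviation "K \<equiv> kappa B gap_floor"

lemma K_nonneg: "0 \<le> K"
  by (rule kappa_nonneg[OF unit_variance_nonempty]) (auto simp: gap_floor_def gap_nonneg le_max_iff_disj)

text \<open>All three endings of the bias step cost at most \<open>168 * ln T * \<kappa> / (eps l)\<^sup>2 + 42 * n\<close>, where \<open>\<kappa>\<close> belongs to
  the estimated gaps and is at most \<open>17 * (1 + eps l / \<Delta>neq) * K\<close>; note \<open>2856 = 168 * 17\<close>.\<close>

definition bcost :: "nat \<Rightarrow> real" where
  "bcost l = (if \<Delta>neq < 16 * eps l
     then 2856 * ln (real T) * K * (1 / (eps l)\<^sup>2 + 1 / (eps l * \<Delta>neq)) + 42 * real n else 0)"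

lemma bcost_nonneg: "0 \<le> bcost l"
  unfolding bcost_def using K_nonneg T_pos gap_neq_pos less_imp_le[OF eps_pos[of l]]
  by (auto intro!: add_nonneg_nonneg mult_nonneg_nonneg divide_nonneg_nonneg)

text \<open>The estimated gaps are at most \<open>17 * (1 + eps l / \<Delta>neq)\<close> times \<open>gap_floor\<close>, and \<open>kappa\<close> is monotone
  and homogeneous.\<close>

lemma kappa_est_gap:
  assumes "gaps_accurate l s"
  shows "kappa B (est_gap s) \<le> 17 * (1 + eps l / \<Delta>neq) * K"
proof (rule kappa_le_scale[OF unit_variance_nonempty])
  have q: "0 \<le> eps l / \<Delta>neq" using gap_neq_pos less_imp_le[OF eps_pos[of l]] by simp
  then show "0 < 17 * (1 + eps l / \<Delta>neq)" by simp
  fix x assume x: "x \<in> acts B"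
  have a: "\<Delta> x \<le> est_gap s x" "est_gap s x \<le> 17 * max (\<Delta> x) (eps l)"
    using assms x gap_nonneg[OF x] unfolding gaps_accurate_def by (auto simp: max_def split: if_splits)
  show "0 \<le> est_gap s x" using a(1) gap_nonneg[OF x] by linarith
  have D: "\<Delta> x \<le> gap_floor x" "\<Delta>neq \<le> gap_floor x" unfolding gap_floor_def by auto
  have "eps l = eps l / \<Delta>neq * \<Delta>neq" using gap_neq_pos by simp
  also have "\<dots> \<le> eps l / \<Delta>neq * gap_floor x" by (rule mult_left_mono[OF D(2) q])
  finally have "eps l \<le> eps l / \<Delta>neq * gap_floor x" .
  moreover have g0: "0 \<le> gap_floor x" using D gap_neq_pos by linarith
  moreover have "0 \<le> eps l / \<Delta>neq * gap_floor x" by (rule mult_nonneg_nonneg[OF q g0])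
  ultimately have "max (\<Delta> x) (eps l) \<le> (1 + eps l / \<Delta>neq) * gap_floor x"
    using D(1) unfolding distrib_right by simp
  then show "est_gap s x \<le> 17 * (1 + eps l / \<Delta>neq) * gap_floor x" using a(2) by linarith
qed

text \<open>Every phase plays at least one round, so the number of phases adds no more than a constant factor to
  the logarithm.\<close>

lemma bias_log_le:
  assumes "1 \<le> l" "l \<le> T" "2 \<le> T"
  shows "ln (real l * (real l + 1) / \<delta>) \<le> 4 * ln (real T)"
proof -
  have t: "2 \<le> real T" using assms(3) by simp
  have "2 * real T \<le> real T * real T" by (rule mult_right_mono) (use t in auto)
  then have TT: "real T + 1 \<le> real T * real T" using t by linarith
  have "real l * (real l + 1) * real T \<le> real T * (real T + 1) * real T"
    using assms by (intro mult_right_mono mult_mono) auto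
  also have "\<dots> \<le> real T * (real T * real T) * real T"
    using TT by (intro mult_right_mono mult_left_mono) auto
  also have "\<dots> = real T ^ 4" by (simp add: power4_eq_xxxx)
  finally have "ln (real l * (real l + 1) * real T) \<le> ln (real T ^ 4)"
    using assms by (subst ln_le_cancel_iff) (auto intro!: mult_pos_pos)
  then show ?thesis using assms by (simp add: ln_realpow)
qed

text \<open>Rounding up adds at most one sample to each of the at most \<open>n\<close> actions in the support of the design.\<close>

lemma bcount_weighted:
  fixes f :: "rvec \<Rightarrow> real"
  assumes l: "1 \<le> l" and D: "\<And>x. x \<in> acts B \<Longrightarrow> 0 < D x"
    and f: "\<And>x. x \<in> acts B \<Longrightarrow> 0 \<le> f x" "\<And>x. x \<in> acts B \<Longrightarrow> f x \<le> M" and M: "0 \<le> M"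
  shows "(\<Sum>x\<in>acts B. real (bcount l D x) * f x)
    \<le> 2 * ln (real l * (real l + 1) / \<delta>) / (eps l)\<^sup>2 * (\<Sum>x\<in>acts B. gap_design c l D x * f x) + M * real n"
proof -
  define L where "L = ln (real l * (real l + 1) / \<delta>)"
  have L: "0 < L" unfolding L_def by (rule group_log_pos(2)[OF l])
  define p where "p = gap_design c l D"
  have p: "\<And>x. x \<in> acts B \<Longrightarrow> 0 \<le> p x"
    using gap_design_optimal[of D l] D
    unfolding gap_optimal_def unit_variance_measures_def bias_measures_def p_def by auto
  define r where "r = (\<lambda>x. 2 * p x / (eps l)\<^sup>2 * L)"
  have r: "x \<in> acts B \<Longrightarrow> 0 \<le> r x" for x unfolding r_def using p L by auto
  have rb: "real (bcount l D x) \<le> r x + (if p x \<noteq> 0 then 1 else 0)" if "x \<in> acts B" for x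
    using r[OF that] that unfolding bias_count_def r_def p_def L_def by (auto simp: of_nat_nat)
  have "(\<Sum>x\<in>acts B. real (bcount l D x) * f x) \<le> (\<Sum>x\<in>acts B. (r x + (if p x \<noteq> 0 then 1 else 0)) * f x)"
    using rb f by (intro sum_mono mult_right_mono) auto
  also have "\<dots> = (\<Sum>x\<in>acts B. r x * f x) + (\<Sum>x\<in>acts B. if p x \<noteq> 0 then f x else 0)"
    unfolding sum.distrib[symmetric] by (intro sum.cong) (auto simp: distrib_right)
  also have "(\<Sum>x\<in>acts B. r x * f x) = 2 * L / (eps l)\<^sup>2 * (\<Sum>x\<in>acts B. p x * f x)"
    unfolding r_def sum_distrib_left by (intro sum.cong) auto
  also have "(\<Sum>x\<in>acts B. if p x \<noteq> 0 then f x else 0) = sum f {x \<in> acts B. p x \<noteq> 0}"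
    by (simp add: sum.If_cases Int_def)
  also have "\<dots> \<le> (\<Sum>x\<in>{x \<in> acts B. p x \<noteq> 0}. M)" by (intro sum_mono f) auto
  also have "\<dots> = M * real (card {x \<in> acts B. p x \<noteq> 0})" by simp
  also have "\<dots> \<le> M * real n"
    using gap_design_support[of D l] D M unfolding p_def by (intro mult_left_mono) auto
  finally show ?thesis unfolding L_def p_def by simp
qed

lemma gap_design_cost:
  assumes "\<And>x. x \<in> acts B \<Longrightarrow> 0 < D x" "\<And>x. x \<in> acts B \<Longrightarrow> f x \<le> D x"
  shows "(\<Sum>x\<in>acts B. gap_design c l D x * f x) \<le> kappa B D"
proof -
  have opt: "gap_optimal B D (gap_design c l D)" by (rule gap_design_optimal) (rule assms)
  then have "\<And>x. x \<in> acts B \<Longrightarrow> 0 \<le> gap_design c l D x"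
    unfolding gap_optimal_def unit_variance_measures_def bias_measures_def by auto
  then show ?thesis unfolding kappa_gap_optimal[OF opt] using assms(2)
    by (intro sum_mono mult_left_mono) auto
qed

lemma bias_estimate_error:
  assumes x: "x \<in> acts B" and "\<bar>feat B x \<bullet> E (grp B x) - feat B x \<bullet> \<theta>s\<bar> \<le> e" and "\<bar>w - \<omega>\<bar> \<le> e"
  shows "\<bar>bias_estimate B E w x - x \<bullet> \<gamma>\<bar> \<le> 2 * e"
proof -
  have "feat B x \<bullet> \<theta>s = x \<bullet> \<gamma> + of_int (grp B x) * \<omega>"
    by (rule feat_\<theta>s) (use x acts_carrier in auto)
  then show ?thesis using assms(2,3) grp_values[OF x] unfolding bias_estimate_def by auto
qed

text \<open>The actions still in play have gaps of at most \<open>21 * eps l\<close>. If the step samples, it costs \<open>\<kappa>\<close> times the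
  scaling of the design because the estimated gaps dominate the gaps. If too few rounds remain, the same
  computation applies with \<open>eps l\<close> in place of the gaps, because the estimated gaps also dominate \<open>eps l\<close>. If
  the algorithm recovers, then \<open>eps l ^ 3 \<le> \<kappa> * ln T / T\<close>, so \<open>T\<close> rounds with gaps of order \<open>eps l\<close> cost
  at most of order \<open>\<kappa> * ln T / (eps l)\<^sup>2\<close>.

  A group wins only if it contains the best action, as the estimates of the two groups are
  both correct up to \<open>2 * eps l\<close>; and the better group wins if \<open>8 * eps l \<le> \<Delta>neq\<close>.\<close>

lemma bias_step_analysis:
  assumes v: "valid_state \<xi> s" and l: "1 \<le> l" "l \<le> T" and T2: "2 \<le> T" and b0: "best_grp s = 0"
    and nq: "\<Delta>neq < 16 * eps l"
    and tight: "\<And>z. z \<in> {-1, 1} \<Longrightarrow> group_tight (5 * eps l) z s"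
    and acc: "\<And>z. z \<in> {-1, 1} \<Longrightarrow> accurate l z s"
    and gaps: "gaps_accurate l s" and good: "bias_good l \<xi> s"
  defines "s' \<equiv> bstep \<xi> l s"
  shows "cum_gap \<gamma> xs (hist s') \<le> cum_gap \<gamma> xs (hist s) + bcost l"
    and "length (hist s') < T \<Longrightarrow> phase_inv (Suc l) s'"
proof -
  define D where "D = est_gap s"
  define A where "A = cand s (-1) \<union> cand s 1"
  define L where "L = ln (real l * (real l + 1) / \<delta>)"
  define \<mu> where "\<mu> = bcount l D"
  define zs where "zs = schedule c l \<mu>"
  define e where "e = eps l"
  have e: "0 < e" "e \<le> 2" unfolding e_def using eps_le_2[OF l(1)] by auto
  have L: "0 < L" "L \<le> 4 * ln (real T)" unfolding L_def
    using group_log_pos(2)[OF l(1)] bias_log_le[OF l T2] by auto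
  have lnT: "0 \<le> ln (real T)" using T_pos by simp
  have A: "A \<noteq> {}" "A \<subseteq> acts B" "finite A"
    unfolding A_def using validD(1,3,4)[OF v, of 1] validD(1,3,4)[OF v, of "-1"] by auto
  have inA: "x \<in> cand s (grp B x)" if "x \<in> A" for x
    using that validD(2)[OF v, of 1] validD(2)[OF v, of "-1"] unfolding A_def by auto
  have candA: "cand s z \<subseteq> A" if "z \<in> {-1, 1}" for z using that unfolding A_def by auto
  have D: "0 < D x" if "x \<in> acts B" for x unfolding D_def by (rule validD(9)[OF v that])
  have Dge: "\<Delta> x \<le> D x" "e \<le> D x" if "x \<in> acts B" for x
    using gaps that unfolding gaps_accurate_def D_def e_def by auto
  have base16: "base z \<le> 16 * e" for z unfolding base_def using nq[folded e_def] e by auto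
  have gapA: "\<Delta> x \<le> 21 * e" if x: "x \<in> A" for x
  proof -
    have "grp B x \<in> {-1, 1}" using grp_values[of x] x A by auto
    then have "\<Delta> x \<le> base (grp B x) + 5 * e" using tight inA[OF x] unfolding group_tight_def e_def by blast
    then show ?thesis using base16[of "grp B x"] by linarith
  qed
  define k where "k = kappa B D"
  have k1: "0 \<le> k" unfolding k_def by (rule kappa_nonneg[OF unit_variance_nonempty]) (rule less_imp_le[OF D])
  have k2: "k \<le> 17 * (1 + e / \<Delta>neq) * K" using kappa_est_gap[OF gaps] unfolding k_def e_def D_def .
  note k = k1 k2
  have bc: "168 * ln (real T) * k / e\<^sup>2 + 42 * real n \<le> bcost l"
  proof -
    have "168 * ln (real T) * k / e\<^sup>2 \<le> 168 * ln (real T) * (17 * (1 + e / \<Delta>neq) * K) / e\<^sup>2"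
      using k lnT by (intro divide_right_mono mult_left_mono) auto
    also have "\<dots> = 2856 * ln (real T) * K * (1 / e\<^sup>2 + 1 / (e * \<Delta>neq))"
      using e gap_neq_pos by (simp add: power2_eq_square field_simps)
    finally show ?thesis unfolding bcost_def e_def using nq by simp
  qed
  have L4: "42 * L * k / e\<^sup>2 \<le> 168 * ln (real T) * k / e\<^sup>2"
  proof (rule divide_right_mono)
    have "L * k \<le> 4 * ln (real T) * k" by (rule mult_right_mono[OF L(2) k1])
    then show "42 * L * k \<le> 168 * ln (real T) * k" by linarith
  qed simp
  note sched = schedule_facts[OF subset_refl bcount_support[of l D], of l, folded \<mu>_def zs_def]
  \<comment> \<open>recovery, too few rounds left, or a completed block\<close>
  consider "recovers B T l D" | "\<not> recovers B T l D" "T < length (hist s) + sum \<mu> (acts B)"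
    | "\<not> recovers B T l D" "\<not> T < length (hist s) + sum \<mu> (acts B)" by blast
  then have "cum_gap \<gamma> xs (hist s') \<le> cum_gap \<gamma> xs (hist s) + bcost l \<and>
    (length (hist s') < T \<longrightarrow> phase_inv (Suc l) s')"
  proof cases
    case 3
    define w where "w = e_last B \<bullet> least_squares B (acts B) \<mu> (play (obs \<xi>) (hist s) zs)"
    define m where "m = bias_estimate B (est s) w"
    have s': "s' = bias_update l m (hist s @ play (obs \<xi>) (hist s) zs) s"
      using b0 3 unfolding s'_def bias_step_unfold Let_def m_def w_def zs_def \<mu>_def D_def by simp
    have w: "\<bar>w - \<omega>\<bar> \<le> e"
      using good b0 3 unfolding bias_good_def w_def zs_def \<mu>_def D_def e_def by simp
    have m: "\<bar>m x - x \<bullet> \<gamma>\<bar> \<le> 2 * e" if x: "x \<in> A" for x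
      unfolding m_def
    proof (rule bias_estimate_error)
      show "x \<in> acts B" using x A by auto
      have "grp B x \<in> {-1, 1}" using grp_values[of x] x A by auto
      then show "\<bar>feat B x \<bullet> est s (grp B x) - feat B x \<bullet> \<theta>s\<bar> \<le> e"
        using acc inA[OF x] unfolding accurate_def e_def by blast
    qed (rule w)
    have zbz: "zb \<in> {-1, 1}" "- zb \<in> {-1, 1}" using zb_values by auto
    have xsC: "xs \<in> cand s zb"
    proof -
      obtain x where x: "x \<in> cand s zb" "\<Delta> x = base zb" using tight[OF zbz(1)] unfolding group_tight_def by blast
      then have "x \<in> acts B" using validD(3)[OF v zbz(1)] by auto
      then have "x = xs" using x(2) gap_zero_iff unfolding base_def by simp
      then show ?thesis using x by simp
    qed
    then have xsA: "xs \<in> A" using candA[OF zbz(1)] by blast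
    have Mb: "xs \<bullet> \<gamma> - 2 * e \<le> (MAX x\<in>cand s zb. m x)"
    proof -
      have "m xs \<le> (MAX x\<in>cand s zb. m x)" using xsC validD(4)[OF v zbz(1)] by (intro Max_ge) auto
      then show ?thesis using m[OF xsA] by linarith
    qed
    have Mo: "(MAX x\<in>cand s (- zb). m x) \<le> xs \<bullet> \<gamma> - \<Delta>neq + 2 * e"
    proof (subst Max_le_iff)
      show "\<forall>a\<in>m ` cand s (- zb). a \<le> xs \<bullet> \<gamma> - \<Delta>neq + 2 * e"
      proof
        fix a assume "a \<in> m ` cand s (- zb)"
        then obtain x where x: "x \<in> cand s (- zb)" "a = m x" by blast
        then have xa: "x \<in> acts B" "grp B x = - zb" using validD(2)[OF v zbz(2)] by auto
        have "\<Delta>neq \<le> xs \<bullet> \<gamma> - x \<bullet> \<gamma>" using gap_neq_le[OF xa] gap_eq[OF xa(1)] by simp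
        then show "a \<le> xs \<bullet> \<gamma> - \<Delta>neq + 2 * e" using m[of x] x candA[OF zbz(2)] by auto
      qed
    qed (use validD(1,4)[OF v zbz(2)] in auto)
    \<comment> \<open>the worse group is behind by \<open>\<Delta>neq\<close> up to an error of \<open>4 * e\<close>, and the test asks for a lead of \<open>4 * e\<close>\<close>
    have loser: "\<not> group_wins l (cand s) m (- zb)"
      unfolding group_wins_def using Mb Mo gap_neq_pos e by (simp add: e_def)
    have winner: "group_wins l (cand s) m zb" if "8 * e \<le> \<Delta>neq"
      unfolding group_wins_def using Mb Mo that by (simp add: e_def)
    have bg: "best_grp s' = 0 \<or> best_grp s' = zb"
      using loser zb_values unfolding s' bias_update_select by auto
    have bg0: "\<Delta>neq < 16 * eps (Suc l)" if "best_grp s' = 0"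
    proof -
      have "\<not> group_wins l (cand s) m zb"
        using that zb_values unfolding s' bias_update_select by (auto split: if_splits)
      then show ?thesis using winner unfolding eps_Suc e_def by linarith
    qed
    have tight': "group_tight (10 * eps (Suc l)) z s'" if "z \<in> {-1, 1}" for z
      using tight[OF that] unfolding group_tight_def s' bias_update_select eps_Suc by simp
    have ga: "gaps_accurate (Suc l) s'"
      unfolding gaps_accurate_def
    proof
      fix x assume x: "x \<in> acts B"
      have gx: "grp B x \<in> {-1, 1}" using grp_values[OF x] by auto
      show "\<Delta> x \<le> est_gap s' x \<and> eps (Suc l) \<le> est_gap s' x \<and> (if x \<in> cand s' (grp B x)
          then est_gap s' x \<le> \<Delta> x + 16 * eps (Suc l) else est_gap s' x \<le> 17 * \<Delta> x)"
      proof (cases "x \<in> A")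
        case True
        have E: "est_gap s' x = min 2 ((MAX x'\<in>A. m x') - m x + 4 * e)"
          using True unfolding s' bias_update_select A_def e_def by simp
        have le: "m xs \<le> (MAX x'\<in>A. m x')" "m x \<le> (MAX x'\<in>A. m x')"
          using A xsA True by (auto intro!: Max_ge)
        have ub: "(MAX x'\<in>A. m x') \<le> xs \<bullet> \<gamma> + 2 * e"
        proof (subst Max_le_iff)
          show "\<forall>a\<in>m ` A. a \<le> xs \<bullet> \<gamma> + 2 * e"
          proof
            fix a assume "a \<in> m ` A"
            then obtain y where y: "y \<in> A" "a = m y" by blast
            then show "a \<le> xs \<bullet> \<gamma> + 2 * e" using m[of y] xs_max[of y] A by auto
          qed
        qed (use A in auto)
        have "\<Delta> x = xs \<bullet> \<gamma> - x \<bullet> \<gamma>" by (rule gap_eq[OF x])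
        then have "\<Delta> x \<le> est_gap s' x" "est_gap s' x \<le> \<Delta> x + 8 * e" "e / 2 \<le> est_gap s' x"
          unfolding E using gap_le_2[OF x] m[OF True] m[OF xsA] le ub e by auto
        moreover have "x \<in> cand s' (grp B x)" using inA[OF True] unfolding s' by simp
        ultimately show ?thesis unfolding eps_Suc e_def[symmetric] by simp
      next
        case False
        then have "x \<notin> cand s (grp B x)" using candA[OF gx] by blast
        moreover have "est_gap s' x = est_gap s x" using False unfolding s' bias_update_select A_def by simp
        moreover have "eps (Suc l) \<le> eps l" using e unfolding eps_Suc e_def by simp
        ultimately show ?thesis using gaps x unfolding gaps_accurate_def s' by auto
      qed
    qed
    have "phase_inv (Suc l) s'" unfolding phase_inv_def using bg bg0 tight' ga by blast
    moreover have "sum_list (map \<Delta> zs) \<le> bcost l"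
    proof -
      have "sum_list (map \<Delta> zs) = (\<Sum>j<length zs. \<Delta> (zs ! j))"
        by (simp add: sum_list_sum_nth atLeast0LessThan)
      also have "\<dots> = (\<Sum>x\<in>acts B. real (count_list zs x) * \<Delta> x)"
        by (rule sum_nth_count_list[OF finite_acts sched(1)])
      also have "\<dots> = (\<Sum>x\<in>acts B. real (bcount l D x) * \<Delta> x)"
        unfolding zs_def using schedule_count[OF bcount_support[of l D], of l] by (simp add: \<mu>_def)
      also have "\<dots> \<le> 2 * L / e\<^sup>2 * (\<Sum>x\<in>acts B. gap_design c l D x * \<Delta> x) + 2 * real n"
        unfolding L_def e_def by (rule bcount_weighted[OF l(1) D]) (use gap_nonneg gap_le_2 in auto)
      also have "\<dots> \<le> 2 * L / e\<^sup>2 * k + 2 * real n"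
        unfolding k_def using L by (intro add_right_mono mult_left_mono gap_design_cost D Dge) auto
      also have "\<dots> \<le> 42 * L * k / e\<^sup>2 + 42 * real n"
        using L k e by (intro add_mono) (auto simp: divide_simps)
      finally show ?thesis using L4 bc by linarith
    qed
    ultimately show ?thesis unfolding s' bias_update_select cum_gap_append cum_gap_play by simp
  next
    case 1
    have s': "s' = exhaust c T (obs \<xi>) A s"
      using b0 1 unfolding s'_def bias_step_unfold A_def D_def by simp
    have len: "length (hist s') = T" unfolding s' using validD(7)[OF v] by simp
    let ?ws = "replicate (T - length (hist s)) (emp_best c (hist s) A)"
    have "sum_list (map \<Delta> ?ws) \<le> real (length ?ws) * (21 * e)"
      by (rule sum_list_le_length) (use gapA emp_best_in[OF A(1,2)] in \<open>auto simp: set_replicate_conv_if split: if_splits\<close>)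
    also have "\<dots> \<le> real T * (21 * e)" using e by (intro mult_right_mono) auto
    also have "real T * e \<le> k * ln (real T) / e\<^sup>2"
    proof -
      have "e ^ 3 \<le> root 3 (k * ln (real T) / real T) ^ 3"
        using 1[unfolded recovers_def, folded e_def k_def] less_imp_le[OF e(1)] by (rule power_mono)
      also have "\<dots> = k * ln (real T) / real T" by (rule odd_real_root_pow) simp
      finally have "e * e\<^sup>2 * real T \<le> k * ln (real T)" using T_pos
        by (simp add: field_simps power3_eq_cube power2_eq_square)
      then show ?thesis using e by (simp add: field_simps)
    qed
    then have "real T * (21 * e) \<le> 21 * (k * ln (real T) / e\<^sup>2)" by simp
    also have "\<dots> \<le> 168 * ln (real T) * k / e\<^sup>2 + 42 * real n"
    proof -
      have "0 \<le> k * ln (real T) / e\<^sup>2" using k lnT by simp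
      moreover have "168 * ln (real T) * k / e\<^sup>2 = 168 * (k * ln (real T) / e\<^sup>2)" by simp
      ultimately show ?thesis by linarith
    qed
    finally have "sum_list (map \<Delta> ?ws) \<le> bcost l" using bc by linarith
    then show ?thesis using len unfolding s' hist_exhaust cum_gap_append cum_gap_play by simp
  next
    case 2
    have s': "s' = exhaust c T (obs \<xi>) A s"
      using b0 2 unfolding s'_def bias_step_unfold A_def D_def \<mu>_def by simp
    have len: "length (hist s') = T" unfolding s' using validD(7)[OF v] by simp
    let ?ws = "replicate (T - length (hist s)) (emp_best c (hist s) A)"
    have "sum_list (map \<Delta> ?ws) \<le> real (length ?ws) * (21 * e)"
      by (rule sum_list_le_length) (use gapA emp_best_in[OF A(1,2)] in \<open>auto simp: set_replicate_conv_if split: if_splits\<close>)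
    also have "\<dots> \<le> real (sum \<mu> (acts B)) * (21 * e)" 
    proof (rule mult_right_mono)
      have "length ?ws \<le> sum \<mu> (acts B)" using 2 by simp
      then show "real (length ?ws) \<le> real (sum \<mu> (acts B))" by (simp only: of_nat_le_iff)
    qed (use e in simp)
    also have "\<dots> = 21 * (\<Sum>x\<in>acts B. real (bcount l D x) * e)"
      unfolding \<mu>_def of_nat_sum sum_distrib_right sum_distrib_left by (intro sum.cong) auto
    also have "\<dots> \<le> 21 * (2 * L / e\<^sup>2 * (\<Sum>x\<in>acts B. gap_design c l D x * e) + e * real n)"
      unfolding L_def e_def by (intro mult_left_mono bcount_weighted[OF l(1) D]) (auto intro: less_imp_le)
    also have "\<dots> \<le> 21 * (2 * L / e\<^sup>2 * k + 2 * real n)"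
      unfolding k_def using L e by (intro mult_left_mono add_mono gap_design_cost D Dge mult_right_mono) auto
    also have "\<dots> = 42 * L * k / e\<^sup>2 + 42 * real n" by simp
    finally have "sum_list (map \<Delta> ?ws) \<le> bcost l" using L4 bc by linarith
    then show ?thesis using len unfolding s' hist_exhaust cum_gap_append cum_gap_play by simp
  qed
  then show "cum_gap \<gamma> xs (hist s') \<le> cum_gap \<gamma> xs (hist s) + bcost l"
    and "length (hist s') < T \<Longrightarrow> phase_inv (Suc l) s'" by blast+
qed

end

section \<open>Phases and runs\<close>

context bandit_run
begin

lemma cand_group_step_subset: "cand (gstep \<xi> l z s) z' \<subseteq> cand s z'"
  unfolding group_step_unfold Let_def by auto

lemma phase_as_steps:
  obtains z where "z \<in> {-1, 1}"
    "\<And>ob s. fpe_phase B c \<delta> T ob l s =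
       bias_step B c \<delta> T ob l (group_step B c \<delta> T ob l (- z) (group_step B c \<delta> T ob l z s))"
    "group_order c l = [z, - z]"
  using group_order_values[of l]
proof (elim disjE)
  assume "group_order c l = [-1, 1]"
  then show ?thesis by (intro that[of "-1"]) (auto simp: fpe_phase_def)
next
  assume "group_order c l = [1, -1]"
  then show ?thesis by (intro that[of 1]) (auto simp: fpe_phase_def)
qed

definition first_group :: "nat \<Rightarrow> int" where
  "first_group l = hd (group_order c l)"

lemma first_group: "first_group l \<in> {-1, 1}"
  and fpe_phase_steps: "fpe_phase B c \<delta> T ob l s = bias_step B c \<delta> T ob l
    (group_step B c \<delta> T ob l (- first_group l) (group_step B c \<delta> T ob l (first_group l) s))"
  by (rule phase_as_steps[of l]; simp add: first_group_def)+

abbreviation "run \<equiv> \<lambda>m \<xi>. fpe_run B c \<delta> T (obs \<xi>) m"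

lemma phase_full:
  assumes v: "valid_state \<xi> s" and f: "length (hist s) = T" and l: "1 \<le> l"
  shows "fpe_phase B c \<delta> T (obs \<xi>) l s = s"
proof -
  have "first_group l \<in> {-1, 1}" "- first_group l \<in> {-1, 1}" using first_group[of l] by auto
  then show ?thesis unfolding fpe_phase_steps
    using group_step_full[OF v f _ l] bias_step_full[OF v f l] by simp
qed

lemma adapted_run: "adapted (\<lambda>\<xi>. run m \<xi>)"
  and run_Suc: "run (Suc m) \<xi> = fpe_phase B c \<delta> T (obs \<xi>) (Suc m) (run m \<xi>)"
proof -
  have suc: "run (Suc m) \<xi> = fpe_phase B c \<delta> T (obs \<xi>) (Suc m) (run m \<xi>)"
    if "adapted (\<lambda>\<xi>. run m \<xi>)" for m \<xi>
  proof -
    have v: "valid_state \<xi> (run m \<xi>)" using that unfolding adapted_def by blast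
    show ?thesis
    proof (cases "length (hist (run m \<xi>)) < T")
      case True
      then show ?thesis by (simp add: Let_def)
    next
      case False
      then have "length (hist (run m \<xi>)) = T" using validD(7)[OF v] by simp
      then show ?thesis using phase_full[OF v, of "Suc m"] by (simp add: Let_def)
    qed
  qed
  have ad: "adapted (\<lambda>\<xi>. run m \<xi>)" for m
  proof (induction m)
    case 0
    then show ?case using adapted_init by simp
  next
    case (Suc m)
    have z: "- first_group (Suc m) \<in> {-1, 1}" using first_group[of "Suc m"] by auto
    show ?case unfolding suc[OF Suc] fpe_phase_steps
      by (rule adapted_bias_step[OF adapted_group_step[OF adapted_group_step[OF Suc first_group] z]])
  qed
  show "adapted (\<lambda>\<xi>. run m \<xi>)" by (rule ad)
  show "run (Suc m) \<xi> = fpe_phase B c \<delta> T (obs \<xi>) (Suc m) (run m \<xi>)" by (rule suc[OF ad])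
qed

abbreviation "mid1 \<equiv> \<lambda>m \<xi>. gstep \<xi> (Suc m) (first_group (Suc m)) (run m \<xi>)"
abbreviation "mid2 \<equiv> \<lambda>m \<xi>. gstep \<xi> (Suc m) (- first_group (Suc m)) (mid1 m \<xi>)"

definition phase_good :: "nat \<Rightarrow> (nat \<Rightarrow> real) \<Rightarrow> bool" where
  "phase_good m \<xi> \<longleftrightarrow> group_good (Suc m) (first_group (Suc m)) \<xi> (run m \<xi>) \<and>
     group_good (Suc m) (- first_group (Suc m)) \<xi> (mid1 m \<xi>) \<and> bias_good (Suc m) \<xi> (mid2 m \<xi>)"

lemma phase_bad_prob:
  "{\<xi>. \<not> phase_good m \<xi>} \<in> sets noise \<and>
   noise.prob {\<xi>. \<not> phase_good m \<xi>} \<le> 6 * \<delta> * (1 / (real (Suc m) * (real (Suc m) + 1)))"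
proof -
  have z: "- first_group (Suc m) \<in> {-1, 1}" using first_group[of "Suc m"] by auto
  have a1: "adapted (\<lambda>\<xi>. mid1 m \<xi>)" by (rule adapted_group_step[OF adapted_run first_group])
  have a2: "adapted (\<lambda>\<xi>. mid2 m \<xi>)" by (rule adapted_group_step[OF a1 z])
  let ?A = "{\<xi>. \<not> group_good (Suc m) (first_group (Suc m)) \<xi> (run m \<xi>)}"
  let ?B = "{\<xi>. \<not> group_good (Suc m) (- first_group (Suc m)) \<xi> (mid1 m \<xi>)}"
  let ?C = "{\<xi>. \<not> bias_good (Suc m) \<xi> (mid2 m \<xi>)}"
  let ?p = "2 * \<delta> / (real (Suc m) * (real (Suc m) + 1))"
  have "?A \<in> sets noise \<and> noise.prob ?A \<le> ?p" by (rule group_bad_prob[OF adapted_run first_group]) simp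
  then have A: "?A \<in> sets noise" "noise.prob ?A \<le> ?p" by (rule conjunct1, rule conjunct2)
  have "?B \<in> sets noise \<and> noise.prob ?B \<le> ?p" by (rule group_bad_prob[OF a1 z]) simp
  then have B: "?B \<in> sets noise" "noise.prob ?B \<le> ?p" by (rule conjunct1, rule conjunct2)
  have "?C \<in> sets noise \<and> noise.prob ?C \<le> ?p" by (rule bias_bad_prob[OF a2]) simp
  then have C: "?C \<in> sets noise" "noise.prob ?C \<le> ?p" by (rule conjunct1, rule conjunct2)
  have eq: "{\<xi>. \<not> phase_good m \<xi>} = ?A \<union> ?B \<union> ?C" unfolding phase_good_def by auto
  have "noise.prob (?A \<union> ?B \<union> ?C) \<le> noise.prob (?A \<union> ?B) + noise.prob ?C"
    by (rule measure_Un_le) (use A B C in auto)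
  also have "noise.prob (?A \<union> ?B) \<le> noise.prob ?A + noise.prob ?B"
    by (rule measure_Un_le) (use A B in auto)
  finally have "noise.prob (?A \<union> ?B \<union> ?C) \<le> ?p + ?p + ?p" using A B C by linarith
  then show ?thesis unfolding eq using A(1) B(1) C(1) by auto
qed

definition bad_event :: "(nat \<Rightarrow> real) set" where
  "bad_event = (\<Union>m<T. {\<xi>. \<not> phase_good m \<xi>})"

text \<open>Three exceptional events per phase, each of probability at most \<open>2 * \<delta> / (l (l + 1))\<close>; the
  sum over the phases telescopes.\<close>

lemma bad_event_prob: "bad_event \<in> sets noise" "noise.prob bad_event \<le> 6 / real T"
proof -
  show "bad_event \<in> sets noise" unfolding bad_event_def
    using phase_bad_prob by (intro sets.finite_UN) auto
  have tel: "(\<Sum>m<N. 1 / (real (Suc m) * (real (Suc m) + 1))) = 1 - 1 / (real N + 1)" for N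
  proof (induction N)
    case (Suc N)
    have "1 / (x * (x + 1)) = 1 / x - 1 / (x + 1)" if "0 < x" for x :: real
      using that by (simp add: field_simps)
    from this[of "real (Suc N)"] show ?case using Suc by simp
  qed simp
  have "noise.prob bad_event \<le> (\<Sum>m<T. noise.prob {\<xi>. \<not> phase_good m \<xi>})"
    unfolding bad_event_def using phase_bad_prob
    by (intro noise.finite_measure_subadditive_finite) auto
  also have "\<dots> \<le> (\<Sum>m<T. 6 * \<delta> * (1 / (real (Suc m) * (real (Suc m) + 1))))"
    using phase_bad_prob by (intro sum_mono) blast
  also have "\<dots> = 6 * \<delta> * (\<Sum>m<T. 1 / (real (Suc m) * (real (Suc m) + 1)))"
    by (simp only: sum_distrib_left)
  also have "\<dots> \<le> 6 * \<delta> * 1" unfolding tel by (intro mult_left_mono) auto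
  finally show "noise.prob bad_event \<le> 6 / real T" by simp
qed

end

context bandit_regret
begin

lemma group_step_any:
  assumes v: "valid_state \<xi> s" and z: "z \<in> {-1, 1}" and l: "1 \<le> l"
    and bg: "best_grp s = 0 \<or> best_grp s = zb" and nq: "best_grp s = 0 \<longrightarrow> \<Delta>neq < 16 * eps l"
    and tight: "z \<noteq> - best_grp s \<longrightarrow> group_tight (10 * eps l) z s" and good: "group_good l z \<xi> s"
  defines "s' \<equiv> gstep \<xi> l z s"
  shows "cum_gap \<gamma> xs (hist s') \<le> cum_gap \<gamma> xs (hist s) + gcost l"
    and "length (hist s') < T \<Longrightarrow> z \<noteq> - best_grp s \<Longrightarrow> group_tight (5 * eps l) z s'"
    and "length (hist s') < T \<Longrightarrow> z \<noteq> - best_grp s \<Longrightarrow> accurate l z s'"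
    and "length (hist s') < T \<Longrightarrow> x \<in> cand s z - cand s' z \<Longrightarrow> eps l \<le> \<Delta> x"
    and "length (hist s') < T \<Longrightarrow> cand s' (- z) = cand s (- z)"
    and "length (hist s') < T \<Longrightarrow> est s' (- z) = est s (- z)"
    and "best_grp s' = best_grp s" "est_gap s' = est_gap s"
proof -
  have *: "cum_gap \<gamma> xs (hist s') \<le> cum_gap \<gamma> xs (hist s) + gcost l \<and>
    (length (hist s') < T \<longrightarrow> (z \<noteq> - best_grp s \<longrightarrow> group_tight (5 * eps l) z s' \<and> accurate l z s') \<and>
      (\<forall>x\<in>cand s z - cand s' z. eps l \<le> \<Delta> x) \<and> cand s' (- z) = cand s (- z) \<and> est s' (- z) = est s (- z)) \<and>
    best_grp s' = best_grp s \<and> est_gap s' = est_gap s"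
  proof (cases "z = - best_grp s")
    case True
    then have "s' = s" unfolding s'_def group_step_unfold by simp
    then show ?thesis using True gcost_nonneg[OF l] by simp
  next
    case False
    have "base z \<le> 16 * eps l"
    proof (cases "z = zb")
      case True
      then show ?thesis unfolding base_def using less_imp_le[OF eps_pos[of l]] by simp
    next
      case ne: False
      then have "best_grp s = 0" using bg False z zb_values by auto
      then show ?thesis unfolding base_def using nq ne by simp
    qed
    from group_step_analysis[OF v z l False tight[rule_format, OF False] this good, folded s'_def]
    show ?thesis by blast
  qed
  then show "cum_gap \<gamma> xs (hist s') \<le> cum_gap \<gamma> xs (hist s) + gcost l"
    "length (hist s') < T \<Longrightarrow> z \<noteq> - best_grp s \<Longrightarrow> group_tight (5 * eps l) z s'"
    "length (hist s') < T \<Longrightarrow> z \<noteq> - best_grp s \<Longrightarrow> accurate l z s'"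
    "length (hist s') < T \<Longrightarrow> cand s' (- z) = cand s (- z)"
    "length (hist s') < T \<Longrightarrow> est s' (- z) = est s (- z)"
    "best_grp s' = best_grp s" "est_gap s' = est_gap s" by blast+
  show "length (hist s') < T \<Longrightarrow> x \<in> cand s z - cand s' z \<Longrightarrow> eps l \<le> \<Delta> x" using * by blast
qed

lemma phase_analysis:
  assumes v: "valid_state \<xi> s" and z: "z \<in> {-1, 1}" and l: "1 \<le> l" "l \<le> T" and T2: "2 \<le> T"
    and inv: "phase_inv l s"
  defines "s1 \<equiv> gstep \<xi> l z s"
  defines "s2 \<equiv> gstep \<xi> l (- z) s1"
  defines "s3 \<equiv> bstep \<xi> l s2"
  assumes g1: "group_good l z \<xi> s" and g2: "group_good l (- z) \<xi> s1" and g3: "bias_good l \<xi> s2"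
  shows "cum_gap \<gamma> xs (hist s3) \<le> cum_gap \<gamma> xs (hist s) + (2 * gcost l + bcost l)"
    and "length (hist s3) < T \<Longrightarrow> phase_inv (Suc l) s3"
proof -
  have z': "- z \<in> {-1, 1}" using z by auto
  have v1: "valid_state \<xi> s1" unfolding s1_def by (rule valid_group_step[OF v z])
  have v2: "valid_state \<xi> s2" unfolding s2_def by (rule valid_group_step[OF v1 z'])
  have c0: "0 \<le> gcost l" "0 \<le> bcost l" by (rule gcost_nonneg[OF l(1)], rule bcost_nonneg)
  have bg: "best_grp s = 0 \<or> best_grp s = zb" and nq: "best_grp s = 0 \<longrightarrow> \<Delta>neq < 16 * eps l"
    and tight: "\<And>z. z \<in> {-1, 1} \<Longrightarrow> z \<noteq> - best_grp s \<longrightarrow> group_tight (10 * eps l) z s"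
    using inv unfolding phase_inv_def by auto
  note A = group_step_any[OF v z l(1) bg nq tight[OF z] g1, folded s1_def]
  have "cum_gap \<gamma> xs (hist s3) \<le> cum_gap \<gamma> xs (hist s) + (2 * gcost l + bcost l) \<and>
    (length (hist s3) < T \<longrightarrow> phase_inv (Suc l) s3)"
  proof (cases "length (hist s1) < T")
    case False
    then have f: "length (hist s1) = T" using validD(7)[OF v1] by simp
    have "s2 = s1" unfolding s2_def by (rule group_step_full[OF v1 f z' l(1)])
    moreover have "s3 = s2" unfolding s3_def by (rule bias_step_full[OF v2 _ l(1)]) (use f calculation in simp)
    ultimately show ?thesis using f A(1) c0 by simp
  next
    case lt1: True
    have tight1: "- z \<noteq> - best_grp s1 \<longrightarrow> group_tight (10 * eps l) (- z) s1"
      using tight[OF z'] A(5)[OF lt1] A(7) unfolding group_tight_def by simp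
    have nq1: "best_grp s1 = 0 \<longrightarrow> \<Delta>neq < 16 * eps l" using nq A(7) by simp
    have bg1: "best_grp s1 = 0 \<or> best_grp s1 = zb" using bg A(7) by simp
    note B = group_step_any[OF v1 z' l(1) bg1 nq1 tight1 g2, folded s2_def, unfolded minus_minus]
    show ?thesis
    proof (cases "length (hist s2) < T")
      case False
      then have f: "length (hist s2) = T" using validD(7)[OF v2] by simp
      have "s3 = s2" unfolding s3_def by (rule bias_step_full[OF v2 f l(1)])
      then show ?thesis using f A(1) B(1) c0 by simp
    next
      case lt2: True
      have b2: "best_grp s2 = best_grp s" "est_gap s2 = est_gap s" using A(7,8) B(7,8) by auto
      have tight2: "group_tight (5 * eps l) z'' s2 \<and> accurate l z'' s2"
        if "z'' \<in> {-1, 1}" "z'' \<noteq> - best_grp s" for z''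
      proof (cases "z'' = z")
        case True
        then show ?thesis using A(2,3)[OF lt1] B(5,6)[OF lt2] that
          unfolding group_tight_def accurate_def by simp
      next
        case False
        then have "z'' = - z" using that z by auto
        then show ?thesis using B(2,3)[OF lt2] that A(7) by auto
      qed
      show ?thesis
      proof (cases "best_grp s = 0")
        case False
        then have s3: "s3 = s2" unfolding s3_def bias_step_unfold using b2 by simp
        have "phase_inv (Suc l) s2" unfolding phase_inv_def eps_Suc
          using b2 bg False tight2 by auto
        then show ?thesis unfolding s3 using A(1) B(1) c0 by simp
      next
        case True
        have sub: "cand s2 z'' \<subseteq> cand s z''" for z''
          unfolding s2_def s1_def using cand_group_step_subset by blast
        have ga: "gaps_accurate l s2"
          unfolding gaps_accurate_def b2
        proof
          fix x assume x: "x \<in> acts B"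
          have gx: "grp B x = z \<or> grp B x = - z" using grp_values[OF x] z by auto
          have g: "\<Delta> x \<le> est_gap s x" "eps l \<le> est_gap s x"
            "if x \<in> cand s (grp B x) then est_gap s x \<le> \<Delta> x + 16 * eps l else est_gap s x \<le> 17 * \<Delta> x"
            using inv True x unfolding phase_inv_def gaps_accurate_def by auto
          have el: "eps l \<le> \<Delta> x" if "x \<in> cand s (grp B x)" "x \<notin> cand s2 (grp B x)"
            using gx
          proof
            assume "grp B x = z"
            then show ?thesis using A(4)[OF lt1, of x] B(5)[OF lt2] that by simp
          next
            assume "grp B x = - z"
            then show ?thesis using A(5)[OF lt1] B(4)[OF lt2, of x] that by simp
          qed
          show "\<Delta> x \<le> est_gap s x \<and> eps l \<le> est_gap s x \<and>
            (if x \<in> cand s2 (grp B x) then est_gap s x \<le> \<Delta> x + 16 * eps l else est_gap s x \<le> 17 * \<Delta> x)"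
            using g sub[of "grp B x"] el by (auto split: if_splits)
        qed
        have b0: "best_grp s2 = 0" using True b2 by simp
        have t2: "\<And>z. z \<in> {-1, 1} \<Longrightarrow> group_tight (5 * eps l) z s2"
          and a2: "\<And>z. z \<in> {-1, 1} \<Longrightarrow> accurate l z s2" using tight2 True by auto
        note C = bias_step_analysis[OF v2 l T2 b0 nq[rule_format, OF True] t2 a2 ga g3, folded s3_def]
        show ?thesis using A(1) B(1) C by auto
      qed
    qed
  qed
  then show "cum_gap \<gamma> xs (hist s3) \<le> cum_gap \<gamma> xs (hist s) + (2 * gcost l + bcost l)"
    and "length (hist s3) < T \<Longrightarrow> phase_inv (Suc l) s3" by blast+
qed

lemma run_analysis:
  assumes T2: "2 \<le> T" and good: "\<xi> \<notin> bad_event" and m: "m \<le> T"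
  shows "cum_gap \<gamma> xs (hist (run m \<xi>)) \<le> (\<Sum>l=1..m. 2 * gcost l + bcost l) \<and>
    (length (hist (run m \<xi>)) < T \<longrightarrow> phase_inv (Suc m) (run m \<xi>))"
  using m
proof (induction m)
  case 0
  then show ?case using phase_inv_init by (simp add: fpe_init_def cum_gap_def)
next
  case (Suc m)
  let ?z = "first_group (Suc m)"
  have v: "valid_state \<xi> (run m \<xi>)" using adapted_run[of m] unfolding adapted_def by blast
  have IH: "cum_gap \<gamma> xs (hist (run m \<xi>)) \<le> (\<Sum>l=1..m. 2 * gcost l + bcost l)"
    "length (hist (run m \<xi>)) < T \<Longrightarrow> phase_inv (Suc m) (run m \<xi>)" using Suc by auto
  have c0: "0 \<le> 2 * gcost (Suc m) + bcost (Suc m)" using gcost_nonneg[of "Suc m"] bcost_nonneg[of "Suc m"] by simp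
  have st: "run (Suc m) \<xi> = bstep \<xi> (Suc m) (mid2 m \<xi>)" unfolding run_Suc fpe_phase_steps ..
  show ?case
  proof (cases "length (hist (run m \<xi>)) < T")
    case False
    then have f: "length (hist (run m \<xi>)) = T" using validD(7)[OF v] by simp
    have "run (Suc m) \<xi> = run m \<xi>" unfolding run_Suc by (rule phase_full[OF v f]) simp
    then show ?thesis using f IH(1) c0 by simp
  next
    case True
    have pg: "phase_good m \<xi>" using good Suc.prems unfolding bad_event_def by auto
    note P = phase_analysis[OF v first_group[of "Suc m"] _ Suc.prems T2 IH(2)[OF True], folded st]
    have "cum_gap \<gamma> xs (hist (run (Suc m) \<xi>)) \<le> cum_gap \<gamma> xs (hist (run m \<xi>)) + (2 * gcost (Suc m) + bcost (Suc m))"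
      "length (hist (run (Suc m) \<xi>)) < T \<Longrightarrow> phase_inv (Suc (Suc m)) (run (Suc m) \<xi>)"
      using P pg unfolding phase_good_def by auto
    then show ?thesis using IH(1) by simp
  qed
qed

end

section \<open>Summing the costs\<close>

text \<open>The summands at least double from one phase to the next, so the sum is at most twice its last
  nonzero term.\<close>

lemma eps_power_sum:
  assumes r: "0 < r" and p: "1 \<le> p"
  shows "(\<Sum>l=1..N. if r \<le> eps l then 1 / eps l ^ p else 0) \<le> 2 / r ^ p"
proof -
  have *: "(\<Sum>l=1..Suc m. if r \<le> eps l then 1 / eps l ^ p else 0)
    \<le> 2 * (if r \<le> eps (Suc m) then 1 / eps (Suc m) ^ p else 1 / r ^ p)" for m
  proof (induction m)
    case 0
    have "1 / eps (Suc 0) ^ p \<le> 2 / eps (Suc 0) ^ p"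
      by (rule divide_right_mono) (auto intro: less_imp_le)
    then show ?case using r by simp
  next
    case (Suc m)
    let ?e = "eps (Suc m)"
    have e: "0 < ?e" by simp
    have half: "2 / ?e ^ p \<le> 1 / eps (Suc (Suc m)) ^ p"
    proof -
      have "(2::real) ^ 1 \<le> 2 ^ p" by (rule power_increasing) (use p in auto)
      then have "2 / ?e ^ p \<le> 2 ^ p / ?e ^ p" by (intro divide_right_mono) (auto intro: less_imp_le)
      then show ?thesis unfolding eps_Suc[of "Suc m"] by (simp add: power_divide)
    qed
    show ?case
    proof (cases "r \<le> eps (Suc (Suc m))")
      case True
      then have "r \<le> ?e" using e unfolding eps_Suc[of "Suc m"] by linarith
      then show ?thesis using True Suc.IH half by (simp add: algebra_simps)
    next
      case False
      have "1 / ?e ^ p \<le> 1 / r ^ p" if "r \<le> ?e"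
        using r that by (intro divide_left_mono power_mono mult_pos_pos zero_less_power) auto
      then show ?thesis using False Suc.IH by (auto split: if_splits)
    qed
  qed
  show ?thesis
  proof (cases N)
    case 0
    then show ?thesis using r by simp
  next
    case (Suc m)
    have "2 * (if r \<le> eps (Suc m) then 1 / eps (Suc m) ^ p else 1 / r ^ p) \<le> 2 / r ^ p"
      using r by (auto intro!: divide_left_mono power_mono mult_pos_pos zero_less_power)
    then show ?thesis using *[of m] unfolding Suc by linarith
  qed
qed

lemma eps_sum: "(\<Sum>l=1..N. eps l) \<le> 4"
proof -
  have "(\<Sum>l=1..N. eps l) = 4 - 2 * eps (Suc N)" for N
    by (induction N) (simp_all add: eps_Suc[of "Suc _"] eps_1[unfolded One_nat_def])
  then show ?thesis using eps_pos[of "Suc N"] by (simp add: less_imp_le)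
qed

context bandit_regret
begin

abbreviation "d \<equiv> real (dimn B)"
abbreviation "k \<equiv> real (card (acts B))"
abbreviation "lT \<equiv> ln (real T)"

lemma dimn_pos: "1 \<le> d"
proof (rule ccontr)
  assume "\<not> 1 \<le> d"
  then have "dimn B = 0" by simp
  have "x = 0\<^sub>v 0" if "x \<in> acts B" for x
  proof (rule eq_vecI)
    have "x \<in> carrier_vec 0" using that acts_carrier \<open>dimn B = 0\<close> by auto
    then show "dim_vec x = dim_vec (0\<^sub>v 0 :: rvec)" by simp
  qed simp
  then have "acts B \<subseteq> {0\<^sub>v 0}" by blast
  then have "card (acts B) \<le> 1" using card_mono[of "{0\<^sub>v 0}" "acts B"] by simp
  then show False using card_acts by simp
qed

lemma group_log_le:
  assumes "1 \<le> l" "l \<le> T" "2 \<le> T"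
  shows "ln (k * real l * (real l + 1) / \<delta>) \<le> ln k + 4 * lT"
proof -
  have "ln (k * real l * (real l + 1) / \<delta>) = ln (k * (real l * (real l + 1) / \<delta>))" by (simp add: mult.assoc)
  also have "\<dots> = ln k + ln (real l * (real l + 1) / \<delta>)"
    using card_acts assms by (intro ln_mult_pos) (auto intro!: mult_pos_pos)
  finally show ?thesis using bias_log_le[OF assms] by linarith
qed

lemma gcost_sum:
  assumes T2: "2 \<le> T"
  shows "(\<Sum>l=1..T. gcost l) \<le> 5408 * (d / \<Delta>min) * (ln k + 4 * lT) + 312 * d\<^sup>2"
proof -
  define \<Lambda> where "\<Lambda> = ln k + 4 * lT"
  have \<Lambda>: "0 \<le> \<Lambda>" unfolding \<Lambda>_def using card_acts T_pos by simp
  \<comment> \<open>\<open>gcost l\<close> vanishes if \<open>26 * eps l < \<Delta>min\<close>\<close>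
  define r where "r = \<Delta>min / 26"
  have r: "0 < r" unfolding r_def using gap_min_pos by simp
  have g: "gcost l \<le> 52 * real n * \<Lambda> * (if r \<le> eps l then 1 / eps l ^ 1 else 0) + 13 * (real n * (real n + 1)) * eps l"
    if l: "l \<in> {1..T}" for l
  proof (cases "\<Delta>min \<le> 26 * eps l")
    case True
    define L where "L = ln (k * real l * (real l + 1) / \<delta>)"
    have e: "0 < eps l" by simp
    have "L \<le> \<Lambda>" unfolding L_def \<Lambda>_def by (rule group_log_le) (use l T2 in auto)
    then have "52 * real n * L * (1 / eps l) \<le> 52 * real n * \<Lambda> * (1 / eps l)"
      using e by (intro mult_right_mono mult_left_mono) (auto intro: less_imp_le)
    moreover have "gcost l = 52 * real n * L * (1 / eps l) + 13 * (real n * (real n + 1)) * eps l"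
      unfolding gcost_def L_def[symmetric] using True by (simp add: field_simps power2_eq_square)
    moreover have "r \<le> eps l" using True unfolding r_def by simp
    ultimately show ?thesis by simp
  next
    case False
    then show ?thesis unfolding gcost_def using \<Lambda> less_imp_le[OF eps_pos[of l]]
      by (auto intro!: add_nonneg_nonneg mult_nonneg_nonneg)
  qed
  have "(\<Sum>l=1..T. gcost l) \<le> (\<Sum>l=1..T. 52 * real n * \<Lambda> * (if r \<le> eps l then 1 / eps l ^ 1 else 0) + 13 * (real n * (real n + 1)) * eps l)"
    by (rule sum_mono) (rule g)
  also have "\<dots> = 52 * real n * \<Lambda> * (\<Sum>l=1..T. if r \<le> eps l then 1 / eps l ^ 1 else 0)
      + 13 * (real n * (real n + 1)) * (\<Sum>l=1..T. eps l)"
    unfolding sum.distrib sum_distrib_left ..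
  also have "\<dots> \<le> 52 * real n * \<Lambda> * (2 / r ^ 1) + 13 * (real n * (real n + 1)) * 4"
    using \<Lambda> by (intro add_mono mult_left_mono eps_power_sum[OF r] eps_sum) auto
  also have "52 * real n * \<Lambda> * (2 / r ^ 1) = 2704 * \<Lambda> / \<Delta>min * real n"
    unfolding r_def using gap_min_pos by (simp add: field_simps)
  also have "\<dots> \<le> 2704 * \<Lambda> / \<Delta>min * (2 * d)"
    using \<Lambda> gap_min_pos dimn_pos by (intro mult_left_mono) auto
  also have "13 * (real n * (real n + 1)) * 4 \<le> 312 * d\<^sup>2"
  proof -
    have "real n * (real n + 1) \<le> (2 * d) * (3 * d)"
      using dimn_pos by (intro mult_mono) auto
    then show ?thesis by (simp add: power2_eq_square)
  qed
  finally show ?thesis unfolding \<Lambda>_def by (simp add: field_simps)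
qed

lemma bcost_sum:
  assumes T2: "2 \<le> T"
  shows "(\<Sum>l=1..T. bcost l) \<le> 1553664 * (K / \<Delta>neq\<^sup>2) * lT + 10752 * (d / \<Delta>min) * lT"
proof -
  define q where "q = \<Delta>neq"
  have q: "0 < q" unfolding q_def by (rule gap_neq_pos)
  \<comment> \<open>only phases with \<open>\<Delta>neq < 16 * eps l\<close> explore the bias\<close>
  define r where "r = q / 16"
  have r: "0 < r" unfolding r_def using q by simp
  have lT: "1 / 2 \<le> lT"
  proof -
    have "ln 2 \<le> lT" using T2 by simp
    moreover have "1 / 2 \<le> ln (2::real)" using ln_le_minus_one[of "1 / 2 :: real"] by (simp add: ln_div)
    ultimately show ?thesis by linarith
  qed
  define s1 where "s1 = (\<lambda>l. if r \<le> eps l then 1 / eps l ^ 1 else 0)"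
  define s2 where "s2 = (\<lambda>l. if r \<le> eps l then 1 / eps l ^ 2 else 0)"
  define M where "M = 2856 * lT * K"
  have M: "0 \<le> M" unfolding M_def using lT K_nonneg by simp
  have b: "bcost l \<le> M * s2 l + (M / q + 84 * real n) * s1 l" if l: "l \<in> {1..T}" for l
  proof (cases "q < 16 * eps l")
    case True
    have e: "0 < eps l" "eps l \<le> 2" using eps_le_2[of l] l by auto
    \<comment> \<open>the constant \<open>42 * n\<close> per phase is absorbed in a multiple of \<open>n / eps l\<close>, since \<open>eps l \<le> 2\<close>\<close>
    have "1 \<le> 2 * (1 / eps l)" using e by (simp add: field_simps)
    then have "42 * real n * 1 \<le> 42 * real n * (2 * (1 / eps l))" by (intro mult_left_mono) auto
    moreover have "bcost l = M * (1 / eps l ^ 2) + M / q * (1 / eps l) + 42 * real n"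
      unfolding bcost_def M_def q_def[symmetric] using True e q by (simp add: field_simps)
    moreover have "r \<le> eps l" using True unfolding r_def by simp
    then have "s1 l = 1 / eps l" "s2 l = 1 / eps l ^ 2" unfolding s1_def s2_def by simp_all
    moreover have "(M / q + 84 * real n) * (1 / eps l) = M / q * (1 / eps l) + 42 * real n * (2 * (1 / eps l))"
      by (simp add: add_divide_distrib)
    ultimately show ?thesis by (simp only:)
  next
    case False
    then have "bcost l = 0" unfolding bcost_def q_def by simp
    moreover have "0 \<le> s1 l" "0 \<le> s2 l" unfolding s1_def s2_def by (auto intro: less_imp_le)
    ultimately show ?thesis using M q by (simp add: mult_nonneg_nonneg)
  qed
  have "(\<Sum>l=1..T. bcost l) \<le> (\<Sum>l=1..T. M * s2 l + (M / q + 84 * real n) * s1 l)"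
    by (rule sum_mono) (rule b)
  also have "\<dots> = M * sum s2 {1..T} + (M / q + 84 * real n) * sum s1 {1..T}"
    unfolding sum.distrib sum_distrib_left ..
  also have "\<dots> \<le> M * (2 / r ^ 2) + (M / q + 84 * real n) * (2 / r ^ 1)"
    unfolding s1_def s2_def using M q by (intro add_mono mult_left_mono eps_power_sum[OF r]) auto
  also have "\<dots> = 544 * M / q\<^sup>2 + 2688 * real n / q"
    unfolding r_def using q by (simp add: field_simps power2_eq_square)
  also have "2688 * real n / q \<le> 10752 * (d / \<Delta>min) * lT"
  proof -
    have "2688 * real n / q \<le> 2688 * (2 * d) / q"
      using q dimn_pos by (intro divide_right_mono) auto
    also have "\<dots> \<le> 2688 * (2 * d) / \<Delta>min"
      using gap_min_le_neq gap_min_pos dimn_pos unfolding q_def by (intro divide_left_mono) auto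
    also have "\<dots> = 10752 * (d / \<Delta>min) * (1 / 2)" by simp
    also have "\<dots> \<le> 10752 * (d / \<Delta>min) * lT"
      using lT dimn_pos gap_min_pos by (intro mult_left_mono) auto
    finally show ?thesis .
  qed
  also have "544 * M / q\<^sup>2 = 1553664 * (K / \<Delta>neq\<^sup>2) * lT" unfolding M_def q_def by simp
  finally show ?thesis by simp
qed

lemma cum_gap_le:
  "cum_gap \<gamma> xs (hist (run m \<xi>)) \<le> 2 * real T"
proof -
  have v: "valid_state \<xi> (run m \<xi>)" using adapted_run[of m] unfolding adapted_def by blast
  have "cum_gap \<gamma> xs (hist (run m \<xi>)) = sum_list (map \<Delta> (map fst (hist (run m \<xi>))))"
    using validD(5)[OF v] cum_gap_play by metis
  also have "\<dots> \<le> real (length (map fst (hist (run m \<xi>)))) * 2"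
    by (rule sum_list_le_length) (use validD(6)[OF v] gap_le_2 in blast)
  also have "\<dots> \<le> 2 * real T" using validD(7)[OF v] by simp
  finally show ?thesis .
qed

lemma regret_eq: "fpe_regret B \<gamma> \<omega> xs c \<delta> T = (LINT \<xi>|noise. cum_gap \<gamma> xs (hist (run T \<xi>)))"
  unfolding fpe_regret_def fpe_history_def cum_gap_def ..

text \<open>If the cumulated gap were not integrable, its integral would be \<open>0\<close> by convention and the bound
  would hold as well. On the exceptional event the cumulated gap is at most \<open>2 * T\<close>, which contributes \<open>12\<close>.\<close>

lemma regret_le:
  assumes "\<And>\<xi>. \<xi> \<notin> bad_event \<Longrightarrow> cum_gap \<gamma> xs (hist (run T \<xi>)) \<le> b" and b: "0 \<le> b"
  shows "fpe_regret B \<gamma> \<omega> xs c \<delta> T \<le> b + 12"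
proof (cases "integrable noise (\<lambda>\<xi>. cum_gap \<gamma> xs (hist (run T \<xi>)))")
  case True
  have bad: "bad_event \<in> sets noise" by (rule bad_event_prob)
  have "fpe_regret B \<gamma> \<omega> xs c \<delta> T \<le> (LINT \<xi>|noise. b + 2 * real T * indicator bad_event \<xi>)"
    unfolding regret_eq
  proof (rule integral_mono[OF True])
    show "integrable noise (\<lambda>\<xi>. b + 2 * real T * indicator bad_event \<xi>)"
      using bad by (intro Bochner_Integration.integrable_add integrable_mult_right) (auto simp: noise.emeasure_eq_measure)
    show "cum_gap \<gamma> xs (hist (run T \<xi>)) \<le> b + 2 * real T * indicator bad_event \<xi>" for \<xi>
      using assms(1)[of \<xi>] cum_gap_le[of \<xi> T] b by (cases "\<xi> \<in> bad_event") auto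
  qed
  also have "\<dots> = b + 2 * real T * noise.prob bad_event"
    using bad by (subst Bochner_Integration.integral_add) (auto simp: noise.prob_space[unfolded space_noise] noise.emeasure_eq_measure)
  also have "\<dots> \<le> b + 2 * real T * (6 / real T)"
    using bad_event_prob by (intro add_left_mono mult_left_mono) auto
  also have "\<dots> = b + 12" using T_pos by simp
  finally show ?thesis .
next
  case False
  then show ?thesis unfolding regret_eq using b by (simp add: not_integrable_integral_eq)
qed

lemma regret_bound:
  "fpe_regret B \<gamma> \<omega> xs c \<delta> T \<le>
    2000000 * (max (d / \<Delta>min) (K / \<Delta>neq\<^sup>2) * lT + d\<^sup>2 + d / \<Delta>min * ln k)"
proof -
  define X where "X = max (d / \<Delta>min) (K / \<Delta>neq\<^sup>2)"
  define Y where "Y = d / \<Delta>min"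
  have lT: "0 \<le> lT" using T_pos by simp
  have lk: "0 \<le> ln k" using card_acts by simp
  have Y: "0 \<le> Y" "Y \<le> X" "K / \<Delta>neq\<^sup>2 \<le> X" unfolding X_def Y_def using dimn_pos gap_min_pos by auto
  have d2: "1 \<le> d\<^sup>2" using dimn_pos by simp
  have XL: "0 \<le> X * lT" "Y * lT \<le> X * lT" "K / \<Delta>neq\<^sup>2 * lT \<le> X * lT" "0 \<le> Y * ln k"
    by (rule mult_nonneg_nonneg mult_right_mono, use Y lT lk in linarith, use lT lk in linarith)+
  show ?thesis unfolding X_def[symmetric] unfolding Y_def[symmetric]
  proof (cases "2 \<le> T")
    case True
    define b where "b = (\<Sum>l=1..T. 2 * gcost l + bcost l)"
    have "0 \<le> b" unfolding b_def using gcost_nonneg bcost_nonneg by (intro sum_nonneg) auto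
    then have "fpe_regret B \<gamma> \<omega> xs c \<delta> T \<le> b + 12"
      using regret_le[of b] run_analysis[OF True _ order_refl] unfolding b_def by blast
    also have "b = 2 * (\<Sum>l=1..T. gcost l) + (\<Sum>l=1..T. bcost l)"
      unfolding b_def by (simp add: sum.distrib sum_distrib_left)
    also have "2 * (\<Sum>l=1..T. gcost l) + (\<Sum>l=1..T. bcost l) + 12 \<le> 2 * (5408 * Y * (ln k + 4 * lT) + 312 * d\<^sup>2)
        + (1553664 * (K / \<Delta>neq\<^sup>2) * lT + 10752 * Y * lT) + 12"
      unfolding Y_def by (intro add_mono mult_left_mono gcost_sum[OF True] bcost_sum[OF True]) auto
    also have "\<dots> = 10816 * (Y * ln k) + 54016 * (Y * lT) + 624 * d\<^sup>2 + 1553664 * (K / \<Delta>neq\<^sup>2 * lT) + 12"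
      by (simp add: algebra_simps)
    also have "\<dots> \<le> 2000000 * (X * lT + d\<^sup>2 + Y * ln k)"
    proof -
      have "10816 * a + 54016 * b + 624 * e + 1553664 * f + 12 \<le> 2000000 * (x + e + a)"
        if "0 \<le> x" "b \<le> x" "f \<le> x" "0 \<le> a" "1 \<le> e" for a b e f x :: real
        using that unfolding distrib_left by linarith
      from this[OF XL(1-4) d2] show ?thesis .
    qed
    finally show "fpe_regret B \<gamma> \<omega> xs c \<delta> T \<le> 2000000 * (X * lT + d\<^sup>2 + Y * ln k)" .
  next
    case False
    \<comment> \<open>here \<open>ln T = 0\<close>, and the constant \<open>2 + 12\<close> is paid by \<open>d\<^sup>2\<close>\<close>
    then have T1: "T = 1" using T_pos by simp
    have "cum_gap \<gamma> xs (hist (run T \<xi>)) \<le> 2" for \<xi>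
      using cum_gap_le[of \<xi> T] by (simp only: T1)
    then have "fpe_regret B \<gamma> \<omega> xs c \<delta> T \<le> 2 + 12" by (intro regret_le) auto
    then show "fpe_regret B \<gamma> \<omega> xs c \<delta> T \<le> 2000000 * (X * lT + d\<^sup>2 + Y * ln k)"
    proof -
      have "2 + 12 \<le> 2000000 * (x + e + a)" if "0 \<le> x" "0 \<le> a" "1 \<le> e" for a e x :: real
        using that unfolding distrib_left by linarith
      from order_trans[OF \<open>fpe_regret B \<gamma> \<omega> xs c \<delta> T \<le> 2 + 12\<close> this[OF XL(1,4) d2]] show ?thesis .
    qed
  qed
qed

text \<open>\<open>T \<ge> k\<close> bounds \<open>ln k\<close> by \<open>ln T\<close>, and \<open>T \<ge> exp (d * \<Delta>min)\<close> bounds \<open>d\<^sup>2\<close> by \<open>d / \<Delta>min * ln T\<close>.\<close>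

lemma regret_bound_large_horizon:
  assumes "max k (exp (d * \<Delta>min)) \<le> real T"
  shows "fpe_regret B \<gamma> \<omega> xs c \<delta> T \<le> 6000000 * max (d / \<Delta>min) (K / \<Delta>neq\<^sup>2) * lT"
proof -
  define X where "X = max (d / \<Delta>min) (K / \<Delta>neq\<^sup>2)"
  define Y where "Y = d / \<Delta>min"
  have lT: "0 \<le> lT" using T_pos by simp
  have Y: "0 \<le> Y" "Y \<le> X" unfolding X_def Y_def using dimn_pos gap_min_pos by auto
  have a: "k \<le> real T" "exp (d * \<Delta>min) \<le> real T" using assms by (simp_all only: max.bounded_iff)
  have "ln k \<le> lT" using a(1) card_acts by (intro ln_mono) auto
  then have 1: "Y * ln k \<le> Y * lT" using Y by (intro mult_left_mono)
  have "d * \<Delta>min \<le> lT" using a(2) T_pos by (subst ln_ge_iff) auto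
  then have "Y * (d * \<Delta>min) \<le> Y * lT" using Y by (intro mult_left_mono)
  then have 2: "d\<^sup>2 \<le> Y * lT" unfolding Y_def using gap_min_pos by (simp add: power2_eq_square)
  have 3: "Y * lT \<le> X * lT" using Y lT by (intro mult_right_mono)
  have "fpe_regret B \<gamma> \<omega> xs c \<delta> T \<le> 2000000 * (X * lT + d\<^sup>2 + Y * ln k)"
    using regret_bound unfolding X_def Y_def .
  also have "\<dots> \<le> 6000000 * (X * lT)" using 1 2 3 unfolding distrib_left by linarith
  finally show ?thesis unfolding X_def by simp
qed

end

theorem theorem2:
  shows "\<exists>C C' :: real. C > 0 \<and> C' > 0 \<and>
    (\<forall>B \<gamma> \<omega> xs c (T :: nat).
       biased_bandit B \<gamma> \<longrightarrow> is_unique_best B \<gamma> xs \<longrightarrow> valid_choices B c \<longrightarrow> T \<ge> 1 \<longrightarrow>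
       (let d = real (dimn B);
            k = real (card (acts B));
            \<Delta>min = gap_min B \<gamma> xs;
            \<Delta>neq = gap_neq B \<gamma> xs;
            \<kappa> = kappa B (\<lambda>x. max (gap \<gamma> xs x) (max \<Delta>neq (eps_T B T)));
            R = fpe_regret B \<gamma> \<omega> xs c (1 / real T) T
        in R \<le> C * (max (d / \<Delta>min) (\<kappa> / \<Delta>neq\<^sup>2) * ln (real T) + d\<^sup>2 + d / \<Delta>min * ln k) \<and>
           (real T \<ge> max k (exp (d * \<Delta>min)) \<longrightarrow>
              R \<le> C' * max (d / \<Delta>min) (\<kappa> / \<Delta>neq\<^sup>2) * ln (real T))))"
proof (intro exI conjI allI impI)
  fix B \<gamma> \<omega> xs c and T :: nat
  assume "biased_bandit B \<gamma>" "is_unique_best B \<gamma> xs" "valid_choices B c" "T \<ge> 1"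
  then interpret bandit_regret B \<gamma> \<omega> c T xs by unfold_locales auto
  have gf: "(\<lambda>x. max (gap \<gamma> xs x) (max (gap_neq B \<gamma> xs) (eps_T B T))) = gap_floor"
    unfolding gap_floor_def ..
  show "let d = real (dimn B);
            k = real (card (acts B));
            \<Delta>min = gap_min B \<gamma> xs;
            \<Delta>neq = gap_neq B \<gamma> xs;
            \<kappa> = kappa B (\<lambda>x. max (gap \<gamma> xs x) (max \<Delta>neq (eps_T B T)));
            R = fpe_regret B \<gamma> \<omega> xs c (1 / real T) T
        in R \<le> 2000000 * (max (d / \<Delta>min) (\<kappa> / \<Delta>neq\<^sup>2) * ln (real T) + d\<^sup>2 + d / \<Delta>min * ln k) \<and>
           (real T \<ge> max k (exp (d * \<Delta>min)) \<longrightarrow>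
              R \<le> 6000000 * max (d / \<Delta>min) (\<kappa> / \<Delta>neq\<^sup>2) * ln (real T))"
    unfolding Let_def gf using regret_bound regret_bound_large_horizon by blast
qed auto

end
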